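(* Let $\Omega\subset\mathbb{R}$ be a nonempty bounded open interval and let $F:\Omega-\Omega\to\mathbb{C}$ be a continuous positive definite function, with reproducing kernel Hilbert space $\mathscr{H}_F$ and vectors $F_\varphi\in\mathscr{H}_F$ for $\varphi\in C_c^\infty(\Omega)$. Then the following two conditions are equivalent. (i) $F$ is extendable to a continuous positive definite function $\widetilde F$ defined on $\mathbb{R}$, i.e. there is a continuous positive definite $\widetilde F:\mathbb{R}\to\mathbb{C}$ with $\widetilde F(x)=F(x)$ for all $x\in\Omega-\Omega$. (ii) There is a Hilbert space $\mathscr{K}$, an isometry $W:\mathscr{H}_F\to\mathscr{K}$, and a strongly continuous unitary one-parameter group $U_t:\mathscr{K}\to\mathscr{K}$, $t\in\mathbb{R}$, such that, if $A$ is the skew-adjoint generator of $U_t$ (i.e. $\frac1t(U_tk-k)\to Ak$ as $t\to0$ for all $k\in\mathrm{dom}(A)$), then $$WF_\varphi\in\mathrm{dom}(A)\quad\text{and}\quad AWF_\varphi=WF_{\varphi'}\qquad\text{for all }\varphi\in C_c^\infty(\Omega),$$ where $\varphi'=d\varphi/dx$.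
   Context: For an open interval $\Omega\subset\mathbb{R}$, $\Omega-\Omega=\{x-y: x,y\in\Omega\}$. A function $F:\Omega-\Omega\to\mathbb{C}$ is positive definite if $\sum_i\sum_j\overline{c_i}c_jF(x_i-x_j)\ge0$ for all finite systems $c_i\in\mathbb{C}$, $x_i\in\Omega$ (on $\mathbb{R}$: all $x_i\in\mathbb{R}$). Inner products are conjugate linear in the first variable. The reproducing kernel Hilbert space $\mathscr{H}_F$ is the Hilbert space of continuous functions on $\Omega$ obtained by completing the span of $F(\cdot-x)$, $x\in\Omega$, in the inner product $\langle F(\cdot-x),F(\cdot-y)\rangle_{\mathscr{H}_F}=F(x-y)$. For $\varphi\in C_c^\infty(\Omega)$, $F_\varphi(x)=\int_\Omega\varphi(y)F(x-y)\,dy$; these vectors are dense in $\mathscr{H}_F$ and $\langle F_\varphi,F_\psi\rangle_{\mathscr{H}_F}=\int_\Omega\int_\Omega\overline{\varphi(x)}\psi(y)F(x-y)\,dx\,dy$. *)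

theory Defs
  imports "HOL-Analysis.Analysis" "HOL-Library.Function_Algebras" "HOL-Library.Nonpos_Ints"
begin

section \<open>Complex Hilbert spaces on a carrier\<close>

definition hnorm :: "('k \<Rightarrow> 'k \<Rightarrow> complex) \<Rightarrow> 'k \<Rightarrow> real"
  where "hnorm ip x = sqrt (Re (ip x x))"

definition hcauchy :: "('k::ab_group_add \<Rightarrow> 'k \<Rightarrow> complex) \<Rightarrow> (nat \<Rightarrow> 'k) \<Rightarrow> bool"
  where "hcauchy ip X \<longleftrightarrow> (\<forall>e>0. \<exists>N. \<forall>m\<ge>N. \<forall>n\<ge>N. hnorm ip (X m - X n) < e)"

definition hlim ::
  "'k::ab_group_add set \<Rightarrow> ('k \<Rightarrow> 'k \<Rightarrow> complex) \<Rightarrow> ('a \<Rightarrow> 'k) \<Rightarrow> 'k \<Rightarrow> 'a filter \<Rightarrow> bool"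
  where "hlim K ip f l \<F> \<longleftrightarrow> l \<in> K \<and> ((\<lambda>t. hnorm ip (f t - l)) \<longlongrightarrow> 0) \<F>"

text \<open>
  A Hilbert space is a linear subspace \<open>K\<close> of an ambient complex vector space, with an inner product
  (conjugate linear in its first argument) that is only meaningful on \<open>K\<close>. Since \<open>K\<close> is a variable
  and not a type, one can quantify over Hilbert spaces existentially.
\<close>

locale complex_hilbert_space = vector_space sc
  for sc :: "complex \<Rightarrow> 'k::ab_group_add \<Rightarrow> 'k" +
  fixes K :: "'k set" and ip :: "'k \<Rightarrow> 'k \<Rightarrow> complex"
  assumes subspace_carrier: "module.subspace sc K"
    and ip_add: "\<lbrakk>x \<in> K; y \<in> K; z \<in> K\<rbrakk> \<Longrightarrow> ip x (y + z) = ip x y + ip x z"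
    and ip_scale: "\<lbrakk>x \<in> K; y \<in> K\<rbrakk> \<Longrightarrow> ip x (sc c y) = c * ip x y"
    and ip_cnj: "\<lbrakk>x \<in> K; y \<in> K\<rbrakk> \<Longrightarrow> ip y x = cnj (ip x y)"
    and ip_nonneg: "x \<in> K \<Longrightarrow> ip x x \<in> \<real>\<^sub>\<ge>\<^sub>0"
    and ip_definite: "\<lbrakk>x \<in> K; ip x x = 0\<rbrakk> \<Longrightarrow> x = 0"
    and complete: "\<lbrakk>\<And>n. X n \<in> K; hcauchy ip X\<rbrakk> \<Longrightarrow> \<exists>l. hlim K ip X l sequentially"

definition linear_isometry ::
  "(complex \<Rightarrow> 'h::ab_group_add \<Rightarrow> 'h) \<Rightarrow> 'h set \<Rightarrow> ('h \<Rightarrow> 'h \<Rightarrow> complex) \<Rightarrow>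
   (complex \<Rightarrow> 'k::ab_group_add \<Rightarrow> 'k) \<Rightarrow> 'k set \<Rightarrow> ('k \<Rightarrow> 'k \<Rightarrow> complex) \<Rightarrow> ('h \<Rightarrow> 'k) \<Rightarrow> bool"
  where "linear_isometry scH H ipH scK K ipK W \<longleftrightarrow>
    W ` H \<subseteq> K \<and>
    (\<forall>x\<in>H. \<forall>y\<in>H. W (x + y) = W x + W y) \<and>
    (\<forall>c. \<forall>x\<in>H. W (scH c x) = scK c (W x)) \<and>
    (\<forall>x\<in>H. hnorm ipK (W x) = hnorm ipH x)"

definition unitary_op ::
  "(complex \<Rightarrow> 'k::ab_group_add \<Rightarrow> 'k) \<Rightarrow> 'k set \<Rightarrow> ('k \<Rightarrow> 'k \<Rightarrow> complex) \<Rightarrow> ('k \<Rightarrow> 'k) \<Rightarrow> bool"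
  where "unitary_op sc K ip V \<longleftrightarrow> linear_isometry sc K ip sc K ip V \<and> V ` K = K"

definition unitary_group ::
  "(complex \<Rightarrow> 'k::ab_group_add \<Rightarrow> 'k) \<Rightarrow> 'k set \<Rightarrow> ('k \<Rightarrow> 'k \<Rightarrow> complex) \<Rightarrow>
   (real \<Rightarrow> 'k \<Rightarrow> 'k) \<Rightarrow> bool"
  where "unitary_group sc K ip U \<longleftrightarrow>
    (\<forall>t. unitary_op sc K ip (U t)) \<and>
    (\<forall>k\<in>K. U 0 k = k) \<and>
    (\<forall>s t. \<forall>k\<in>K. U (s + t) k = U s (U t k)) \<and>
    (\<forall>k\<in>K. \<forall>s. hlim K ip (\<lambda>t. U t k) (U s k) (at s))"

definition generates_at ::
  "(complex \<Rightarrow> 'k::ab_group_add \<Rightarrow> 'k) \<Rightarrow> 'k set \<Rightarrow> ('k \<Rightarrow> 'k \<Rightarrow> complex) \<Rightarrow>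
   (real \<Rightarrow> 'k \<Rightarrow> 'k) \<Rightarrow> 'k \<Rightarrow> 'k \<Rightarrow> bool"
  where "generates_at sc K ip U k l \<longleftrightarrow>
    hlim K ip (\<lambda>t. sc (complex_of_real (1 / t)) (U t k - k)) l (at 0)"

definition generator_dom ::
  "(complex \<Rightarrow> 'k::ab_group_add \<Rightarrow> 'k) \<Rightarrow> 'k set \<Rightarrow> ('k \<Rightarrow> 'k \<Rightarrow> complex) \<Rightarrow>
   (real \<Rightarrow> 'k \<Rightarrow> 'k) \<Rightarrow> 'k set"
  where "generator_dom sc K ip U = {k \<in> K. \<exists>l. generates_at sc K ip U k l}"

definition generator ::
  "(complex \<Rightarrow> 'k::ab_group_add \<Rightarrow> 'k) \<Rightarrow> 'k set \<Rightarrow> ('k \<Rightarrow> 'k \<Rightarrow> complex) \<Rightarrow>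
   (real \<Rightarrow> 'k \<Rightarrow> 'k) \<Rightarrow> 'k \<Rightarrow> 'k"
  where "generator sc K ip U k = (THE l. generates_at sc K ip U k l)"

section \<open>Positive definite functions and test functions\<close>

definition difference_set :: "real set \<Rightarrow> real set"
  where "difference_set \<Omega> = {x - y | x y. x \<in> \<Omega> \<and> y \<in> \<Omega>}"

text \<open>
  A function on \<open>\<Omega> - \<Omega>\<close> is represented by a total function whose values outside
  \<open>difference_set \<Omega>\<close> are never used; \<open>\<Omega> = UNIV\<close> gives positive definite functions on the line.
\<close>

definition positive_definite_on :: "real set \<Rightarrow> (real \<Rightarrow> complex) \<Rightarrow> bool"
  where "positive_definite_on \<Omega> F \<longleftrightarrow>
    (\<forall>(n::nat) (c :: nat \<Rightarrow> complex) (x :: nat \<Rightarrow> real). (\<forall>i<n. x i \<in> \<Omega>) \<longrightarrow>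
      (\<Sum>i<n. \<Sum>j<n. cnj (c i) * c j * F (x i - x j)) \<in> \<real>\<^sub>\<ge>\<^sub>0)"

definition extendable :: "real set \<Rightarrow> (real \<Rightarrow> complex) \<Rightarrow> bool"
  where "extendable \<Omega> F \<longleftrightarrow>
    (\<exists>G :: real \<Rightarrow> complex. continuous_on UNIV G \<and> positive_definite_on UNIV G \<and>
       (\<forall>x \<in> difference_set \<Omega>. G x = F x))"

definition derivative :: "(real \<Rightarrow> complex) \<Rightarrow> real \<Rightarrow> complex"
  where "derivative \<phi> = (\<lambda>x. vector_derivative \<phi> (at x))"

text \<open>The space \<open>C\<^sub>c\<^sup>\<infinity>(\<Omega>)\<close> for open \<open>\<Omega>\<close>, its elements being extended by zero to the line.\<close>

definition test_functions :: "real set \<Rightarrow> (real \<Rightarrow> complex) set"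
  where "test_functions \<Omega> = {\<phi>.
    (\<forall>n x. (derivative ^^ n) \<phi> differentiable (at x)) \<and>
    compact (closure {x. \<phi> x \<noteq> 0}) \<and> closure {x. \<phi> x \<noteq> 0} \<subseteq> \<Omega>}"

section \<open>The reproducing kernel Hilbert space\<close>

text \<open>
  Elements of the span of the functions \<open>F(\<cdot> - x)\<close>, \<open>x \<in> \<Omega>\<close>, are given by finitely supported
  coefficient functions \<open>c\<close> on \<open>\<Omega>\<close>; \<open>span_ip F\<close> is the sesquilinear extension of
  \<open>\<langle>F(\<cdot> - x), F(\<cdot> - y)\<rangle> = F(x - y)\<close>.
\<close>

definition coefficients :: "real set \<Rightarrow> (real \<Rightarrow> complex) set"
  where "coefficients \<Omega> = {c. finite {x. c x \<noteq> 0} \<and> {x. c x \<noteq> 0} \<subseteq> \<Omega>}"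

definition span_fun :: "real set \<Rightarrow> (real \<Rightarrow> complex) \<Rightarrow> (real \<Rightarrow> complex) \<Rightarrow> real \<Rightarrow> complex"
  where "span_fun \<Omega> F c = (\<lambda>z. if z \<in> \<Omega> then \<Sum>x | c x \<noteq> 0. c x * F (z - x) else 0)"

definition span_ip :: "(real \<Rightarrow> complex) \<Rightarrow> (real \<Rightarrow> complex) \<Rightarrow> (real \<Rightarrow> complex) \<Rightarrow> complex"
  where "span_ip F c d = (\<Sum>x | c x \<noteq> 0. \<Sum>y | d y \<noteq> 0. cnj (c x) * d y * F (x - y))"

text \<open>
  The completion of the span, realized as functions on \<open>\<Omega>\<close> (extended by zero): point evaluations are
  bounded on the span, so a Cauchy sequence has a pointwise limit, and this limit is \<open>0\<close> only if the
  sequence tends to \<open>0\<close> in norm.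
\<close>

definition represents ::
  "real set \<Rightarrow> (real \<Rightarrow> complex) \<Rightarrow> (nat \<Rightarrow> real \<Rightarrow> complex) \<Rightarrow> (real \<Rightarrow> complex) \<Rightarrow> bool"
  where "represents \<Omega> F c f \<longleftrightarrow>
    (\<forall>n. c n \<in> coefficients \<Omega>) \<and> hcauchy (span_ip F) c \<and>
    (\<forall>z. (\<lambda>n. span_fun \<Omega> F (c n) z) \<longlonglongrightarrow> f z)"

definition rkhs :: "real set \<Rightarrow> (real \<Rightarrow> complex) \<Rightarrow> (real \<Rightarrow> complex) set"
  where "rkhs \<Omega> F = {f. \<exists>c. represents \<Omega> F c f}"

definition rkhs_ip ::
  "real set \<Rightarrow> (real \<Rightarrow> complex) \<Rightarrow> (real \<Rightarrow> complex) \<Rightarrow> (real \<Rightarrow> complex) \<Rightarrow> complex"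
  where "rkhs_ip \<Omega> F f g = (THE l. \<forall>c d. represents \<Omega> F c f \<and> represents \<Omega> F d g \<longrightarrow>
    (\<lambda>n. span_ip F (c n) (d n)) \<longlonglongrightarrow> l)"

definition fun_scale :: "complex \<Rightarrow> (real \<Rightarrow> complex) \<Rightarrow> real \<Rightarrow> complex"
  where "fun_scale c f = (\<lambda>x. c * f x)"

text \<open>The vector \<open>F\<^sub>\<phi>\<close>:\<close>

definition smear :: "real set \<Rightarrow> (real \<Rightarrow> complex) \<Rightarrow> (real \<Rightarrow> complex) \<Rightarrow> real \<Rightarrow> complex"
  where "smear \<Omega> F \<phi> = (\<lambda>x. if x \<in> \<Omega> then (LINT y:\<Omega>|lborel. \<phi> y * F (x - y)) else 0)"

text \<open>
  An existential statement can only range over the carriers in one fixed type. Every separable Hilbert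
  space is isomorphic to one with carrier in \<open>real \<Rightarrow> complex\<close>, which suffices for producing a
  realization; for using one, the type \<open>'k\<close> should be left arbitrary.
\<close>

definition group_realization ::
  "real set \<Rightarrow> (real \<Rightarrow> complex) \<Rightarrow>
   (complex \<Rightarrow> 'k::ab_group_add \<Rightarrow> 'k) \<Rightarrow> 'k set \<Rightarrow> ('k \<Rightarrow> 'k \<Rightarrow> complex) \<Rightarrow>
   ((real \<Rightarrow> complex) \<Rightarrow> 'k) \<Rightarrow> (real \<Rightarrow> 'k \<Rightarrow> 'k) \<Rightarrow> bool"
  where "group_realization \<Omega> F sc K ip W U \<longleftrightarrow>
    complex_hilbert_space sc K ip \<and>
    linear_isometry fun_scale (rkhs \<Omega> F) (rkhs_ip \<Omega> F) sc K ip W \<and>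
    unitary_group sc K ip U \<and>
    (\<forall>\<phi> \<in> test_functions \<Omega>.
       W (smear \<Omega> F \<phi>) \<in> generator_dom sc K ip U \<and>
       generator sc K ip U (W (smear \<Omega> F \<phi>)) = W (smear \<Omega> F (derivative \<phi>)))"

section \<open>Well-definedness of the inner product\<close>

text \<open>
  The limit defining \<open>rkhs_ip\<close> exists and is independent of the representing sequences
  (\<open>rkhs_ip_limit\<close>), and the kernel sections have the prescribed inner products
  (\<open>rkhs_ip_kernel\<close>).
\<close>

lemma coefficients_closed:
  assumes "c \<in> coefficients \<Omega>" "d \<in> coefficients \<Omega>"
  shows "c + d \<in> coefficients \<Omega>" "c - d \<in> coefficients \<Omega>" "fun_scale a c \<in> coefficients \<Omega>"
proof -
  let ?S = "{x. c x \<noteq> 0} \<union> {x. d x \<noteq> 0}"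
  have S: "finite ?S" "?S \<subseteq> \<Omega>" using assms by (auto simp: coefficients_def)
  have "{x. (c + d) x \<noteq> 0} \<subseteq> ?S" "{x. (c - d) x \<noteq> 0} \<subseteq> ?S" "{x. fun_scale a c x \<noteq> 0} \<subseteq> ?S"
    by (auto simp: fun_scale_def)
  with S show "c + d \<in> coefficients \<Omega>" "c - d \<in> coefficients \<Omega>" "fun_scale a c \<in> coefficients \<Omega>"
    unfolding coefficients_def by (blast intro: finite_subset)+
qed

lemma span_ip_eq:
  assumes "finite S" "{x. c x \<noteq> 0} \<subseteq> S" "finite T" "{x. d x \<noteq> 0} \<subseteq> T"
  shows "span_ip F c d = (\<Sum>x\<in>S. \<Sum>y\<in>T. cnj (c x) * d y * F (x - y))"
proof -
  have "span_ip F c d = (\<Sum>x | c x \<noteq> 0. \<Sum>y\<in>T. cnj (c x) * d y * F (x - y))"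
    unfolding span_ip_def using assms by (intro sum.cong sum.mono_neutral_left) auto
  also have "\<dots> = (\<Sum>x\<in>S. \<Sum>y\<in>T. cnj (c x) * d y * F (x - y))"
    using assms by (intro sum.mono_neutral_left) auto
  finally show ?thesis .
qed

lemma span_ip_linear:
  assumes "c \<in> coefficients \<Omega>" "d \<in> coefficients \<Omega>" "e \<in> coefficients \<Omega>"
  shows "span_ip F c (d + e) = span_ip F c d + span_ip F c e"
    and "span_ip F c (d - e) = span_ip F c d - span_ip F c e"
    and "span_ip F (d + e) c = span_ip F d c + span_ip F e c"
    and "span_ip F (d - e) c = span_ip F d c - span_ip F e c"
    and "span_ip F c (fun_scale a d) = a * span_ip F c d"
    and "span_ip F (fun_scale a d) c = cnj a * span_ip F d c"
proof -
  define S where "S = {x. c x \<noteq> 0} \<union> {x. d x \<noteq> 0} \<union> {x. e x \<noteq> 0}"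
  have S: "finite S" using assms by (auto simp: coefficients_def S_def)
  have eq: "span_ip F p q = (\<Sum>x\<in>S. \<Sum>y\<in>S. cnj (p x) * q y * F (x - y))"
    if "p \<in> {c, d, e, d + e, d - e, fun_scale a d}" "q \<in> {c, d, e, d + e, d - e, fun_scale a d}" for p q
    using that by (intro span_ip_eq S) (auto simp: S_def fun_scale_def)
  show "span_ip F c (d + e) = span_ip F c d + span_ip F c e"
    "span_ip F c (d - e) = span_ip F c d - span_ip F c e"
    "span_ip F (d + e) c = span_ip F d c + span_ip F e c"
    "span_ip F (d - e) c = span_ip F d c - span_ip F e c"
    "span_ip F c (fun_scale a d) = a * span_ip F c d"
    "span_ip F (fun_scale a d) c = cnj a * span_ip F d c"
    by (simp_all add: eq fun_scale_def algebra_simps sum.distrib sum_subtractf sum_distrib_left)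
qed

lemma span_ip_nonneg:
  assumes pd: "positive_definite_on \<Omega> F" and c: "c \<in> coefficients \<Omega>"
  shows "span_ip F c c \<in> \<real>\<^sub>\<ge>\<^sub>0"
proof -
  let ?S = "{x. c x \<noteq> 0}"
  have S: "finite ?S" "?S \<subseteq> \<Omega>" using c by (auto simp: coefficients_def)
  obtain h where h: "bij_betw h {0..<card ?S} ?S" using ex_bij_betw_nat_finite[OF S(1)] by blast
  hence h': "bij_betw h {..<card ?S} ?S" by (simp add: atLeast0LessThan)
  have "span_ip F c c = (\<Sum>i<card ?S. \<Sum>j<card ?S. cnj (c (h i)) * c (h j) * F (h i - h j))"
    unfolding span_ip_def
    by (simp add: sum.reindex_bij_betw[OF h', symmetric])
  also have "\<dots> \<in> \<real>\<^sub>\<ge>\<^sub>0"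
  proof -
    have "\<forall>i<card ?S. h i \<in> \<Omega>" using h' S(2) by (auto simp: bij_betw_def)
    thus ?thesis using pd[unfolded positive_definite_on_def, rule_format, of "card ?S" h "\<lambda>i. c (h i)"]
      by blast
  qed
  finally show ?thesis .
qed

lemma positive_definite_cnj:
  assumes pd: "positive_definite_on \<Omega> F" and "x \<in> \<Omega>" "y \<in> \<Omega>"
  shows "F (y - x) = cnj (F (x - y))"
proof -
  have *: "(\<Sum>i<2::nat. \<Sum>j<2::nat. cnj (if i = 0 then 1 else a) * (if j = 0 then 1 else a) *
      F ((if i = 0 then x else y) - (if j = 0 then x else y))) \<in> \<real>\<^sub>\<ge>\<^sub>0" for a
    using pd[unfolded positive_definite_on_def, rule_format, of 2 "\<lambda>i. if i = 0 then x else y"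
        "\<lambda>i. if i = 0 then 1 else a"] assms by simp
  have 0: "Im (F 0) = 0"
    using pd[unfolded positive_definite_on_def, rule_format, of 1 "\<lambda>i. x" "\<lambda>i. 1"] assms
    by (simp add: complex_nonneg_Reals_iff)
  show ?thesis
    using *[of 1] *[of \<i>] 0
    by (simp add: complex_nonneg_Reals_iff numeral_2_eq_2 complex_eq_iff algebra_simps)
qed

lemma span_ip_cnj:
  assumes pd: "positive_definite_on \<Omega> F" and c: "c \<in> coefficients \<Omega>" and d: "d \<in> coefficients \<Omega>"
  shows "span_ip F d c = cnj (span_ip F c d)"
proof -
  have "span_ip F d c = (\<Sum>x | c x \<noteq> 0. \<Sum>y | d y \<noteq> 0. cnj (d y) * c x * F (y - x))"
    unfolding span_ip_def by (rule sum.swap)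
  also have "\<dots> = cnj (span_ip F c d)"
    unfolding span_ip_def cnj_sum using c d
    by (intro sum.cong refl) (auto simp: coefficients_def positive_definite_cnj[OF pd, symmetric] subset_iff)
  finally show ?thesis .
qed

lemma span_cauchy_schwarz:
  assumes pd: "positive_definite_on \<Omega> F" and c: "c \<in> coefficients \<Omega>" and d: "d \<in> coefficients \<Omega>"
  shows "norm (span_ip F c d) \<le> hnorm (span_ip F) c * hnorm (span_ip F) d"
proof -
  define a b e where "a = Re (span_ip F c c)" "b = span_ip F c d" "e = Re (span_ip F d d)"
  have nn: "Re (span_ip F p p) \<ge> 0" "Im (span_ip F p p) = 0" if "p \<in> coefficients \<Omega>" for p
    using span_ip_nonneg[OF pd that] by (auto simp: complex_nonneg_Reals_iff)
  have dc: "span_ip F d c = cnj b" using span_ip_cnj[OF pd c d] by (simp add: a_b_e_def)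
  have key: "0 \<le> a - 2 * s * (norm b)\<^sup>2 + s\<^sup>2 * (norm b)\<^sup>2 * e" for s :: real
  proof -
    let ?t = "of_real s * cnj b" let ?d = "fun_scale ?t d"
    have sd: "?d \<in> coefficients \<Omega>" using coefficients_closed(3)[OF d d] .
    have "0 \<le> Re (span_ip F (c - ?d) (c - ?d))" using nn coefficients_closed(2)[OF c sd] by blast
    also have "span_ip F (c - ?d) (c - ?d) =
        span_ip F c c - ?t * b - cnj ?t * cnj b + cnj ?t * ?t * span_ip F d d"
      by (simp add: span_ip_linear[OF coefficients_closed(2)[OF c sd] c sd] span_ip_linear[OF c c sd]
          span_ip_linear[OF sd c sd] span_ip_linear[OF sd d d] span_ip_linear[OF c d d] span_ip_linear[OF d d d] dc)
         (simp add: a_b_e_def algebra_simps)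
    also have "cnj ?t * ?t = of_real (s\<^sup>2 * (norm b)\<^sup>2)"
      unfolding of_real_mult complex_norm_square by (simp add: power2_eq_square)
    also have "?t * b = of_real (s * (norm b)\<^sup>2)"
      by (simp only: of_real_mult complex_norm_square) simp
    also have "cnj ?t * cnj b = of_real (s * (norm b)\<^sup>2)"
      by (simp only: of_real_mult complex_norm_square) simp
    finally show ?thesis by (simp add: a_b_e_def)
  qed
  have a0: "a \<ge> 0" and e0: "e \<ge> 0" using nn c d by (auto simp: a_b_e_def)
  have "(norm b)\<^sup>2 \<le> a * e"
  proof (cases "e = 0")
    case True
    have "norm b = 0"
    proof (rule ccontr)
      assume "norm b \<noteq> 0"
      hence "(a + 1) / (norm b)\<^sup>2 * (norm b)\<^sup>2 = a + 1" by simp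
      thus False using key[of "(a + 1) / (norm b)\<^sup>2"] True a0 \<open>norm b \<noteq> 0\<close> by (simp add: mult.assoc)
    qed
    thus ?thesis using True by simp
  next
    case False
    thus ?thesis using key[of "1 / e"] e0 by (simp add: field_simps power2_eq_square)
  qed
  hence "sqrt ((norm b)\<^sup>2) \<le> sqrt (a * e)" by (rule real_sqrt_le_mono)
  thus ?thesis by (simp add: hnorm_def a_b_e_def real_sqrt_mult)
qed

lemma span_hnorm:
  assumes pd: "positive_definite_on \<Omega> F" and c: "c \<in> coefficients \<Omega>"
  shows "0 \<le> hnorm (span_ip F) c" "(hnorm (span_ip F) c)\<^sup>2 = norm (span_ip F c c)"
  using span_ip_nonneg[OF pd c] by (auto simp: hnorm_def complex_nonneg_Reals_iff cmod_eq_Re)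

lemma span_triangle:
  assumes pd: "positive_definite_on \<Omega> F" and c: "c \<in> coefficients \<Omega>" and d: "d \<in> coefficients \<Omega>"
  shows "hnorm (span_ip F) (c + d) \<le> hnorm (span_ip F) c + hnorm (span_ip F) d"
proof -
  let ?n = "hnorm (span_ip F)"
  have cd: "c + d \<in> coefficients \<Omega>" using coefficients_closed(1)[OF c d] .
  have "(?n (c + d))\<^sup>2 = norm (span_ip F (c + d) (c + d))" by (rule span_hnorm(2)[OF pd cd])
  also have "span_ip F (c + d) (c + d) =
      span_ip F c c + span_ip F c d + (span_ip F d c + span_ip F d d)"
    by (simp add: span_ip_linear[OF cd c d] span_ip_linear[OF c c d] span_ip_linear[OF d c d])
  also have "norm \<dots> \<le> norm (span_ip F c c) + norm (span_ip F c d) + (norm (span_ip F d c) + norm (span_ip F d d))"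
    by (intro order_trans[OF norm_triangle_ineq] add_mono norm_triangle_ineq)
  also have "\<dots> \<le> (?n c)\<^sup>2 + ?n c * ?n d + (?n d * ?n c + (?n d)\<^sup>2)"
    using span_cauchy_schwarz[OF pd c d] span_cauchy_schwarz[OF pd d c] span_hnorm(2)[OF pd c]
      span_hnorm(2)[OF pd d] by (intro add_mono) auto
  also have "\<dots> = (?n c + ?n d)\<^sup>2" by (simp add: power2_eq_square algebra_simps)
  finally show ?thesis
    by (rule power2_le_imp_le) (simp add: span_hnorm(1)[OF pd c] span_hnorm(1)[OF pd d])
qed

lemma span_cauchy_bounded:
  assumes pd: "positive_definite_on \<Omega> F" and c: "\<And>n. c n \<in> coefficients \<Omega>"
    and C: "hcauchy (span_ip F) c"
  obtains B N where "\<And>n. n \<ge> N \<Longrightarrow> hnorm (span_ip F) (c n) \<le> B" "B > 0"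
proof -
  obtain N where N: "\<forall>m\<ge>N. \<forall>n\<ge>N. hnorm (span_ip F) (c m - c n) < 1"
    using C unfolding hcauchy_def by (meson zero_less_one)
  have "hnorm (span_ip F) (c n) \<le> 1 + hnorm (span_ip F) (c N)" if "n \<ge> N" for n
    using span_triangle[OF pd coefficients_closed(2)[OF c c] c, of n N N] N that by force
  moreover have "1 + hnorm (span_ip F) (c N) > 0" using span_hnorm(1)[OF pd c, of N] by linarith
  ultimately show ?thesis using that by blast
qed

lemma span_ip_fun:
  assumes "c \<in> coefficients \<Omega>"
  shows "span_ip F c d = (\<Sum>x | c x \<noteq> 0. cnj (c x) * span_fun \<Omega> F d x)"
  unfolding span_ip_def span_fun_def using assms
  by (intro sum.cong refl) (auto simp: coefficients_def sum_distrib_left algebra_simps)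

lemma span_null:
  assumes pd: "positive_definite_on \<Omega> F" and c: "\<And>n. c n \<in> coefficients \<Omega>"
    and C: "hcauchy (span_ip F) c" and z: "\<And>z. (\<lambda>n. span_fun \<Omega> F (c n) z) \<longlonglongrightarrow> 0"
  shows "(\<lambda>n. hnorm (span_ip F) (c n)) \<longlonglongrightarrow> 0"
proof -
  let ?n = "hnorm (span_ip F)"
  obtain B M where B: "\<And>n. n \<ge> M \<Longrightarrow> ?n (c n) \<le> B" "B > 0"
    using span_cauchy_bounded[OF pd c C] by blast
  have "(\<lambda>n. (?n (c n))\<^sup>2) \<longlonglongrightarrow> 0"
  proof (rule LIMSEQ_I)
    fix r :: real assume r: "r > 0"
    obtain N0 where N0: "\<forall>m\<ge>N0. \<forall>n\<ge>N0. ?n (c m - c n) < r / (2 * B)"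
      using C r B(2) unfolding hcauchy_def by (meson divide_pos_pos mult_pos_pos zero_less_numeral)
    define N where "N = max N0 M"
    have "(\<lambda>n. \<Sum>x | c N x \<noteq> 0. cnj (c N x) * span_fun \<Omega> F (c n) x) \<longlonglongrightarrow> (\<Sum>x | c N x \<noteq> 0. cnj (c N x) * 0)"
      by (intro tendsto_intros z)
    hence "(\<lambda>n. span_ip F (c N) (c n)) \<longlonglongrightarrow> 0" by (simp add: span_ip_fun[OF c])
    then obtain N1 where N1: "\<forall>n\<ge>N1. norm (span_ip F (c N) (c n)) < r / 2"
      using LIMSEQ_D[of _ 0 "r / 2"] r by fastforce
    have "norm ((?n (c n))\<^sup>2 - 0) < r" if n: "n \<ge> max N1 N" for n
    proof -
      have "(?n (c n))\<^sup>2 = norm (span_ip F (c n - c N) (c n) + span_ip F (c N) (c n))"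
        by (simp add: span_hnorm(2)[OF pd c] span_ip_linear(4)[OF c c c])
      also have "\<dots> \<le> ?n (c n - c N) * ?n (c n) + norm (span_ip F (c N) (c n))"
        using span_cauchy_schwarz[OF pd coefficients_closed(2)[OF c c] c, of n N n]
        by (intro order_trans[OF norm_triangle_ineq]) auto
      also have "?n (c n - c N) * ?n (c n) \<le> r / (2 * B) * B"
      proof (intro mult_mono)
        show "?n (c n - c N) \<le> r / (2 * B)" using N0 n by (auto simp: N_def intro: less_imp_le)
        show "?n (c n) \<le> B" using B(1) n by (auto simp: N_def)
      qed (use r B(2) span_hnorm(1)[OF pd c] in auto)
      finally have "(?n (c n))\<^sup>2 \<le> r / 2 + norm (span_ip F (c N) (c n))" using B(2) by simp
      also have "\<dots> < r" using N1 n by force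
      finally show ?thesis by simp
    qed
    thus "\<exists>no. \<forall>n\<ge>no. norm ((?n (c n))\<^sup>2 - 0) < r" by blast
  qed
  from tendsto_real_sqrt[OF this] show ?thesis
    using span_hnorm(1)[OF pd c] by simp
qed

lemma represents_unique:
  assumes pd: "positive_definite_on \<Omega> F" and "represents \<Omega> F c f" "represents \<Omega> F c' f"
  shows "(\<lambda>n. hnorm (span_ip F) (c n - c' n)) \<longlonglongrightarrow> 0"
proof (rule span_null[OF pd])
  have c: "\<And>n. c n \<in> coefficients \<Omega>" "\<And>n. c' n \<in> coefficients \<Omega>"
    using assms by (auto simp: represents_def)
  show "c n - c' n \<in> coefficients \<Omega>" for n using coefficients_closed(2)[OF c] .
  have fin: "finite {x. c n x \<noteq> 0}" "finite {x. c' n x \<noteq> 0}" for n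
    using c by (auto simp: coefficients_def)
  have "span_fun \<Omega> F (c n - c' n) z = span_fun \<Omega> F (c n) z - span_fun \<Omega> F (c' n) z" for n z
  proof (cases "z \<in> \<Omega>")
    case True
    let ?S = "{x. c n x \<noteq> 0} \<union> {x. c' n x \<noteq> 0}"
    have e: "span_fun \<Omega> F p z = (\<Sum>x\<in>?S. p x * F (z - x))" if "{x. p x \<noteq> 0} \<subseteq> ?S" for p
      unfolding span_fun_def using True that fin by (auto intro!: sum.mono_neutral_left)
    show ?thesis by (subst (1 2 3) e) (auto simp: sum_subtractf algebra_simps)
  qed (simp add: span_fun_def)
  moreover have "(\<lambda>n. span_fun \<Omega> F (c n) z - span_fun \<Omega> F (c' n) z) \<longlonglongrightarrow> f z - f z" for z
    using assms by (intro tendsto_diff) (auto simp: represents_def)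
  ultimately show "(\<lambda>n. span_fun \<Omega> F (c n - c' n) z) \<longlonglongrightarrow> 0" for z by simp
  show "hcauchy (span_ip F) (\<lambda>n. c n - c' n)" unfolding hcauchy_def
  proof (intro allI impI)
    fix e :: real assume "e > 0"
    then obtain N N' where N: "\<forall>m\<ge>N. \<forall>n\<ge>N. hnorm (span_ip F) (c m - c n) < e / 2"
      and N': "\<forall>m\<ge>N'. \<forall>n\<ge>N'. hnorm (span_ip F) (c' m - c' n) < e / 2"
      using assms unfolding represents_def hcauchy_def by (meson half_gt_zero)
    have "hnorm (span_ip F) (c m - c' m - (c n - c' n)) < e" if "m \<ge> max N N'" "n \<ge> max N N'" for m n
    proof -
      have "c m - c' m - (c n - c' n) = (c m - c n) + (c' n - c' m)" by simp
      hence "hnorm (span_ip F) (c m - c' m - (c n - c' n)) \<le>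
          hnorm (span_ip F) (c m - c n) + hnorm (span_ip F) (c' n - c' m)"
        using span_triangle[OF pd coefficients_closed(2)[OF c(1) c(1)] coefficients_closed(2)[OF c(2) c(2)],
            of m n n m] by (simp only:)
      also have "hnorm (span_ip F) (c m - c n) < e / 2" using N that by simp
      also have "hnorm (span_ip F) (c' n - c' m) < e / 2" using N' that by simp
      finally show ?thesis by simp
    qed
    thus "\<exists>M. \<forall>m\<ge>M. \<forall>n\<ge>M. hnorm (span_ip F) (c m - c' m - (c n - c' n)) < e" by blast
  qed
qed

lemma rkhs_ip_limit:
  assumes pd: "positive_definite_on \<Omega> F" and c: "represents \<Omega> F c f" and d: "represents \<Omega> F d g"
  shows "(\<lambda>n. span_ip F (c n) (d n)) \<longlonglongrightarrow> rkhs_ip \<Omega> F f g"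
proof -
  let ?n = "hnorm (span_ip F)"
  have co: "c' n \<in> coefficients \<Omega>" if "represents \<Omega> F c' f'" for c' f' n
    using that by (auto simp: represents_def)
  have ca: "hcauchy (span_ip F) c'" if "represents \<Omega> F c' f'" for c' f'
    using that by (auto simp: represents_def)
  have diff: "norm (span_ip F p q - span_ip F p' q') \<le> ?n (p - p') * ?n q + ?n p' * ?n (q - q')"
    if "p \<in> coefficients \<Omega>" "q \<in> coefficients \<Omega>" "p' \<in> coefficients \<Omega>" "q' \<in> coefficients \<Omega>" for p q p' q'
  proof -
    have "span_ip F p q - span_ip F p' q' = span_ip F (p - p') q + span_ip F p' (q - q')"
      using span_ip_linear(4)[OF that(2) that(1) that(3)] span_ip_linear(2)[OF that(3) that(2) that(4)]
      by simp
    thus ?thesis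
      using span_cauchy_schwarz[OF pd coefficients_closed(2)[OF that(1) that(3)] that(2)]
        span_cauchy_schwarz[OF pd that(3) coefficients_closed(2)[OF that(2) that(4)]]
        norm_triangle_ineq[of "span_ip F (p - p') q" "span_ip F p' (q - q')"] by simp
  qed
  obtain B M where B: "\<And>n. n \<ge> M \<Longrightarrow> ?n (c n) \<le> B" "B > 0"
    using span_cauchy_bounded[OF pd co[OF c] ca[OF c]] by blast
  obtain B' M' where B': "\<And>n. n \<ge> M' \<Longrightarrow> ?n (d n) \<le> B'" "B' > 0"
    using span_cauchy_bounded[OF pd co[OF d] ca[OF d]] by blast
  have "Cauchy (\<lambda>n. span_ip F (c n) (d n))"
  proof (rule CauchyI)
    fix e :: real assume e: "e > 0"
    obtain N where N: "\<forall>m\<ge>N. \<forall>n\<ge>N. ?n (c m - c n) < e / (2 * B')"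
      using ca[OF c] e B'(2) unfolding hcauchy_def by (meson divide_pos_pos mult_pos_pos zero_less_numeral)
    obtain N' where N': "\<forall>m\<ge>N'. \<forall>n\<ge>N'. ?n (d m - d n) < e / (2 * B)"
      using ca[OF d] e B(2) unfolding hcauchy_def by (meson divide_pos_pos mult_pos_pos zero_less_numeral)
    let ?K = "max (max N N') (max M M')"
    have "norm (span_ip F (c m) (d m) - span_ip F (c n) (d n)) < e" if "m \<ge> ?K" "n \<ge> ?K" for m n
    proof -
      have "norm (span_ip F (c m) (d m) - span_ip F (c n) (d n)) \<le>
          ?n (c m - c n) * ?n (d m) + ?n (c n) * ?n (d m - d n)"
        by (intro diff co[OF c] co[OF d])
      also have "?n (c m - c n) * ?n (d m) \<le> ?n (c m - c n) * B'"
        using B'(1)[of m] that span_hnorm(1)[OF pd coefficients_closed(2)[OF co[OF c] co[OF c]]]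
        by (intro mult_left_mono) auto
      also have "?n (c n) * ?n (d m - d n) \<le> B * ?n (d m - d n)"
        using B(1)[of n] that span_hnorm(1)[OF pd coefficients_closed(2)[OF co[OF d] co[OF d]]]
        by (intro mult_right_mono) auto
      also have "?n (c m - c n) * B' < e / (2 * B') * B'"
        using N that B'(2) by (intro mult_strict_right_mono) auto
      also have "B * ?n (d m - d n) < B * (e / (2 * B))"
        using N' that B(2) by (intro mult_strict_left_mono) auto
      finally show ?thesis using B(2) B'(2) by simp
    qed
    thus "\<exists>K. \<forall>m\<ge>K. \<forall>n\<ge>K. norm (span_ip F (c m) (d m) - span_ip F (c n) (d n)) < e" by blast
  qed
  then obtain l where l: "(\<lambda>n. span_ip F (c n) (d n)) \<longlonglongrightarrow> l"
    using Cauchy_convergent convergent_def by blast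
  have all: "(\<lambda>n. span_ip F (c' n) (d' n)) \<longlonglongrightarrow> l"
    if c': "represents \<Omega> F c' f" and d': "represents \<Omega> F d' g" for c' d'
  proof -
    obtain B2 M2 where B2: "\<And>n. n \<ge> M2 \<Longrightarrow> ?n (d' n) \<le> B2" "B2 > 0"
      using span_cauchy_bounded[OF pd co[OF d'] ca[OF d']] by blast
    have "(\<lambda>n. span_ip F (c' n) (d' n) - span_ip F (c n) (d n)) \<longlonglongrightarrow> 0"
    proof (rule tendsto_0_le[where K = 1])
      show "(\<lambda>n. ?n (c' n - c n) * B2 + B * ?n (d' n - d n)) \<longlonglongrightarrow> 0"
        using tendsto_add[OF tendsto_mult_right[OF represents_unique[OF pd c' c], of B2]
            tendsto_mult_left[OF represents_unique[OF pd d' d], of B]] by simp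
      show "\<forall>\<^sub>F n in sequentially. norm (span_ip F (c' n) (d' n) - span_ip F (c n) (d n)) \<le>
          norm (?n (c' n - c n) * B2 + B * ?n (d' n - d n)) * 1"
        using eventually_ge_at_top[of "max M M2"]
      proof eventually_elim
        case (elim n)
        have "norm (span_ip F (c' n) (d' n) - span_ip F (c n) (d n)) \<le>
            ?n (c' n - c n) * ?n (d' n) + ?n (c n) * ?n (d' n - d n)"
          by (intro diff co[OF c] co[OF d] co[OF c'] co[OF d'])
        also have "\<dots> \<le> ?n (c' n - c n) * B2 + B * ?n (d' n - d n)"
          using B(1)[of n] B2(1)[of n] elim span_hnorm(1)[OF pd coefficients_closed(2)[OF co[OF d'] co[OF d]]]
            span_hnorm(1)[OF pd coefficients_closed(2)[OF co[OF c'] co[OF c]]]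
          by (intro add_mono mult_left_mono mult_right_mono) auto
        finally show ?case by simp
      qed
    qed
    from tendsto_add[OF this l] show ?thesis by simp
  qed
  have "rkhs_ip \<Omega> F f g = l" unfolding rkhs_ip_def
    using all c d LIMSEQ_unique by (intro the_equality) blast+
  thus ?thesis using l by simp
qed

lemma represents_kernel:
  assumes pd: "positive_definite_on \<Omega> F" and x: "x \<in> \<Omega>"
  shows "represents \<Omega> F (\<lambda>n y. if y = x then 1 else 0) (\<lambda>z. if z \<in> \<Omega> then F (z - x) else 0)"
proof -
  have "{y. (if y = x then 1 else (0::complex)) \<noteq> 0} = {x}" by auto
  thus ?thesis using x
    by (auto simp: represents_def coefficients_def span_fun_def hcauchy_def hnorm_def span_ip_def)
qed

lemma rkhs_reproducing:
  assumes pd: "positive_definite_on \<Omega> F" and x: "x \<in> \<Omega>" and f: "f \<in> rkhs \<Omega> F"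
  shows "rkhs_ip \<Omega> F (\<lambda>z. if z \<in> \<Omega> then F (z - x) else 0) f = f x"
proof -
  obtain c where c: "represents \<Omega> F c f" using f by (auto simp: rkhs_def)
  let ?d = "\<lambda>y. if y = x then 1 else (0::complex)"
  have s: "{y. ?d y \<noteq> 0} = {x}" by auto
  have "?d \<in> coefficients \<Omega>" using x by (simp add: coefficients_def s)
  hence "span_ip F ?d (c n) = (\<Sum>y | ?d y \<noteq> 0. cnj (?d y) * span_fun \<Omega> F (c n) y)" for n
    by (rule span_ip_fun)
  hence "span_ip F ?d (c n) = span_fun \<Omega> F (c n) x" for n by (simp only: s) simp
  hence "(\<lambda>n. span_fun \<Omega> F (c n) x) \<longlonglongrightarrow> rkhs_ip \<Omega> F (\<lambda>z. if z \<in> \<Omega> then F (z - x) else 0) f"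
    using rkhs_ip_limit[OF pd represents_kernel[OF pd x] c] by simp
  moreover have "(\<lambda>n. span_fun \<Omega> F (c n) x) \<longlonglongrightarrow> f x" using c by (simp add: represents_def)
  ultimately show ?thesis by (rule LIMSEQ_unique)
qed

corollary rkhs_ip_kernel:
  assumes "positive_definite_on \<Omega> F" and "x \<in> \<Omega>" and "y \<in> \<Omega>"
  shows "rkhs_ip \<Omega> F (\<lambda>z. if z \<in> \<Omega> then F (z - x) else 0) (\<lambda>z. if z \<in> \<Omega> then F (z - y) else 0)
    = F (x - y)"
proof -
  have "(\<lambda>z. if z \<in> \<Omega> then F (z - y) else 0) \<in> rkhs \<Omega> F"
    using represents_kernel[OF assms(1,3)] by (auto simp: rkhs_def)
  from rkhs_reproducing[OF assms(1,2) this] show ?thesis using assms(2) by simp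
qed

end

theory Submission
  imports Defs
begin

text \<open>
  Write \<open>k\<^sub>x = F(\<cdot> - x)\<close> for \<open>x \<in> \<Omega>\<close>, so that \<open>\<langle>k\<^sub>x, k\<^sub>y\<rangle> = F(x - y)\<close>. Both directions
  rest on the estimate \<open>\<parallel>F\<^sub>\<phi>\<parallel> \<le> F(0)\<^sup>1\<^sup>/\<^sup>2 \<parallel>\<phi>\<parallel>\<^sub>1\<close> (\<open>smear_hnorm_bound\<close>), which holds
  because \<open>F\<^sub>\<phi>\<close> is a norm limit of combinations \<open>\<Sum> c(x) k\<^sub>x\<close> with \<open>\<Sum> \<bar>c(x)\<bar> \<le> \<parallel>\<phi>\<parallel>\<^sub>1\<close> and
  \<open>\<parallel>k\<^sub>x\<parallel> = F(0)\<^sup>1\<^sup>/\<^sup>2\<close>. It converts \<open>L\<^sup>1\<close> statements about test functions into norm statements about vectors;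
  in particular \<open>F\<^bsub>\<phi>(\<cdot> + h)\<^esub> = F\<^sub>\<phi> + h F\<^bsub>\<phi>'\<^esub> + O(h\<^sup>2)\<close> (\<open>smear_taylor\<close>).

  Let \<open>G\<close> be an extension of \<open>F\<close> to the line. Then \<open>\<K>\<close> is the reproducing kernel Hilbert space of \<open>G\<close>,
  \<open>(U\<^sub>t f)(x) = f(x + t)\<close>, and \<open>W\<close> sends the combination of the \<open>F(\<cdot> - x)\<close> with coefficients \<open>c\<close> to the
  combination of the \<open>G(\<cdot> - x)\<close> with the same coefficients; this preserves norms because only values of
  \<open>G\<close> on \<open>\<Omega> - \<Omega>\<close> occur. Then \<open>W F\<^sub>\<phi> = G\<^sub>\<phi>\<close> and \<open>U\<^sub>t G\<^sub>\<phi> = G\<^bsub>\<phi>(\<cdot> + t)\<^esub>\<close>, so the Taylor expansion says that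
  the generator maps \<open>G\<^sub>\<phi>\<close> to \<open>G\<^bsub>\<phi>'\<^esub>\<close> (\<open>extension_group_realization\<close>).

  Conversely, let \<open>\<K>\<close>, \<open>W\<close>, \<open>U\<close> be given. As long as the support of \<open>\<phi>(\<cdot> + s)\<close> stays in \<open>\<Omega>\<close>, the curves
  \<open>U\<^sub>s W F\<^sub>\<phi>\<close> and \<open>W F\<^bsub>\<phi>(\<cdot> + s)\<^esub>\<close> solve the same linear differential equation with the same initial value
  and therefore agree (\<open>U_smear\<close>). Letting \<open>\<phi>\<close> shrink to a point mass at \<open>x\<close> gives
  \<open>U\<^sub>t W k\<^sub>x = W k\<^bsub>x - t\<^esub>\<close> whenever \<open>x\<close> and \<open>x - t\<close> lie in \<open>\<Omega>\<close> (\<open>U_kernel\<close>); here \<open>\<Omega>\<close> being an interval keeps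
  the supports inside \<open>\<Omega>\<close> all the way. Fix \<open>x\<^sub>0 \<in> \<Omega>\<close> and \<open>w = W k\<^bsub>x\<^sub>0\<^esub>\<close>. The matrix coefficient
  \<open>G(t) = \<langle>w, U\<^sub>t w\<rangle>\<close> is continuous and positive definite on the line, and for \<open>x, y \<in> \<Omega>\<close>
  \<open>F(x - y) = \<langle>W k\<^sub>x, W k\<^sub>y\<rangle> = \<langle>U\<^bsub>x\<^sub>0 - x\<^esub> w, U\<^bsub>x\<^sub>0 - y\<^esub> w\<rangle> = G(x - y)\<close>.
\<close>

section \<open>Geometry of carrier Hilbert spaces\<close>

context complex_hilbert_space
begin

lemma carrier_zero: "0 \<in> K"
  and carrier_add: "\<lbrakk>x \<in> K; y \<in> K\<rbrakk> \<Longrightarrow> x + y \<in> K"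
  and carrier_diff: "\<lbrakk>x \<in> K; y \<in> K\<rbrakk> \<Longrightarrow> x - y \<in> K"
  and carrier_scale: "x \<in> K \<Longrightarrow> sc c x \<in> K"
  and carrier_sum: "(\<And>i. i \<in> A \<Longrightarrow> f i \<in> K) \<Longrightarrow> sum f A \<in> K"
  using subspace_carrier
  by (auto intro: subspace_0 subspace_add subspace_diff subspace_scale subspace_sum)

lemma ip_diff: "\<lbrakk>x \<in> K; y \<in> K; z \<in> K\<rbrakk> \<Longrightarrow> ip x (y - z) = ip x y - ip x z"
  using ip_add[of x "y - z" z] by (simp add: carrier_diff)

lemma ip_add_left: "\<lbrakk>x \<in> K; y \<in> K; z \<in> K\<rbrakk> \<Longrightarrow> ip (y + z) x = ip y x + ip z x"
  by (metis carrier_add complex_cnj_add ip_add ip_cnj)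

lemma ip_diff_left: "\<lbrakk>x \<in> K; y \<in> K; z \<in> K\<rbrakk> \<Longrightarrow> ip (y - z) x = ip y x - ip z x"
  by (metis carrier_diff complex_cnj_diff ip_diff ip_cnj)

lemma ip_scale_left: "\<lbrakk>x \<in> K; y \<in> K\<rbrakk> \<Longrightarrow> ip (sc c y) x = cnj c * ip y x"
  by (metis carrier_scale complex_cnj_mult ip_scale ip_cnj)

lemma ip_zero: "x \<in> K \<Longrightarrow> ip x 0 = 0"
  using ip_diff[of x x x] by simp

lemma ip_sum:
  assumes "x \<in> K" "\<And>i. i \<in> A \<Longrightarrow> f i \<in> K"
  shows "ip x (sum f A) = (\<Sum>i\<in>A. ip x (f i))"
  using assms
  by (induction A rule: infinite_finite_induct) (auto simp: ip_zero ip_add carrier_sum)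

lemma ip_sum_left:
  assumes "x \<in> K" "\<And>i. i \<in> A \<Longrightarrow> f i \<in> K"
  shows "ip (sum f A) x = (\<Sum>i\<in>A. ip (f i) x)"
proof -
  have "ip (sum f A) x = cnj (ip x (sum f A))" using assms by (intro ip_cnj carrier_sum) auto
  also have "\<dots> = (\<Sum>i\<in>A. ip (f i) x)"
    using assms by (simp add: ip_sum) (intro sum.cong refl ip_cnj[symmetric]; simp)
  finally show ?thesis .
qed

lemma hnorm_nonneg: "x \<in> K \<Longrightarrow> 0 \<le> hnorm ip x"
  and hnorm_square: "x \<in> K \<Longrightarrow> (hnorm ip x)\<^sup>2 = Re (ip x x)"
  and ip_self: "x \<in> K \<Longrightarrow> ip x x = of_real ((hnorm ip x)\<^sup>2)"
  using ip_nonneg[of x] by (auto simp: hnorm_def complex_nonneg_Reals_iff complex_eq_iff)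

lemma hnorm_eq_0_iff: "x \<in> K \<Longrightarrow> hnorm ip x = 0 \<longleftrightarrow> x = 0"
  using ip_self[of x] ip_definite[of x] ip_zero[of 0] carrier_zero by (auto simp: hnorm_def)

lemma hnorm_zero: "hnorm ip 0 = 0"
  using hnorm_eq_0_iff carrier_zero by blast

lemma hnorm_scale:
  assumes x: "x \<in> K"
  shows "hnorm ip (sc c x) = norm c * hnorm ip x"
proof -
  have "ip (sc c x) (sc c x) = of_real ((norm c)\<^sup>2) * ip x x"
    using x by (simp add: ip_scale ip_scale_left carrier_scale complex_norm_square del: of_real_power)
  thus ?thesis using x by (simp add: hnorm_def real_sqrt_mult)
qed

lemma hnorm_diff_square:
  assumes "x \<in> K" "y \<in> K"
  shows "(hnorm ip (x - y))\<^sup>2 = (hnorm ip x)\<^sup>2 + (hnorm ip y)\<^sup>2 - 2 * Re (ip x y)"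
proof -
  have "Re (ip y x) = Re (ip x y)" using ip_cnj[OF assms] by simp
  thus ?thesis using assms
    by (simp add: hnorm_square carrier_diff ip_diff ip_diff_left)
qed

lemma hnorm_add_square:
  assumes "x \<in> K" "y \<in> K"
  shows "(hnorm ip (x + y))\<^sup>2 = (hnorm ip x)\<^sup>2 + (hnorm ip y)\<^sup>2 + 2 * Re (ip x y)"
proof -
  have "Re (ip y x) = Re (ip x y)" using ip_cnj[OF assms] by simp
  thus ?thesis using assms
    by (simp add: hnorm_square carrier_add ip_add ip_add_left)
qed

text \<open>Expanding \<open>0 \<le> \<parallel>b x - a y\<parallel>\<^sup>2\<close> with \<open>a = \<parallel>x\<parallel>\<close>, \<open>b = \<parallel>y\<parallel>\<close> bounds the real part.\<close>

lemma Re_ip_le: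
  assumes x: "x \<in> K" and y: "y \<in> K"
  shows "Re (ip x y) \<le> hnorm ip x * hnorm ip y"
proof (cases "x = 0 \<or> y = 0")
  case True
  have "ip 0 y = 0" using ip_cnj[OF y carrier_zero] ip_zero[OF y] by simp
  with True show ?thesis using ip_zero[OF x] hnorm_zero by auto
next
  case False
  define a b where "a = hnorm ip x" and "b = hnorm ip y"
  have ab: "a > 0" "b > 0"
    using False x y hnorm_nonneg[OF x] hnorm_nonneg[OF y] hnorm_eq_0_iff[OF x] hnorm_eq_0_iff[OF y]
    by (auto simp: a_def b_def less_le)
  have "0 \<le> (hnorm ip (sc (of_real b) x - sc (of_real a) y))\<^sup>2" by simp
  also have "\<dots> = 2 * (a * b) * (a * b - Re (ip x y))"
    using x y ab
    by (simp add: hnorm_diff_square carrier_scale hnorm_scale ip_scale ip_scale_left a_def[symmetric]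
        b_def[symmetric]) (simp add: power2_eq_square algebra_simps)
  finally have "0 \<le> a * b - Re (ip x y)"
    using mult_pos_pos[OF ab] by (subst (asm) zero_le_mult_iff) linarith
  thus ?thesis by (simp add: a_def b_def)
qed

lemma hnorm_triangle:
  assumes "x \<in> K" "y \<in> K"
  shows "hnorm ip (x + y) \<le> hnorm ip x + hnorm ip y"
proof (rule power2_le_imp_le)
  show "(hnorm ip (x + y))\<^sup>2 \<le> (hnorm ip x + hnorm ip y)\<^sup>2"
    using Re_ip_le[OF assms] by (simp add: hnorm_add_square[OF assms] power2_sum)
qed (use assms in \<open>simp add: hnorm_nonneg\<close>)

lemma hnorm_minus:
  assumes "x \<in> K" "y \<in> K"
  shows "hnorm ip (x - y) = hnorm ip (y - x)"
proof -
  have "hnorm ip (sc (-1) (y - x)) = hnorm ip (y - x)"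
    using hnorm_scale[OF carrier_diff[OF assms(2,1)], of "-1"]
    by (simp only: norm_minus_cancel norm_one mult_1)
  moreover have "sc (-1) (y - x) = x - y" using scale_minus_left[of 1 "y - x"] by simp
  ultimately show ?thesis by simp
qed

lemma hnorm_triangle_diff:
  assumes "x \<in> K" "y \<in> K" "z \<in> K"
  shows "hnorm ip (x - z) \<le> hnorm ip (x - y) + hnorm ip (y - z)"
  using hnorm_triangle[of "x - y" "y - z"] assms by (simp add: carrier_diff)

lemma hnorm_reverse_triangle:
  assumes "x \<in> K" "y \<in> K"
  shows "\<bar>hnorm ip x - hnorm ip y\<bar> \<le> hnorm ip (x - y)"
  using hnorm_triangle[of "x - y" y] hnorm_triangle[of "y - x" x] hnorm_minus[of x y] assms
  by (simp add: carrier_diff abs_le_iff)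

text \<open>Multiplying one argument by a phase turns \<open>Re_ip_le\<close> into the Cauchy--Schwarz inequality.\<close>

lemma hnorm_cauchy_schwarz:
  assumes "x \<in> K" "y \<in> K"
  shows "norm (ip x y) \<le> hnorm ip x * hnorm ip y"
proof (cases "ip x y = 0")
  case False
  let ?u = "cnj (sgn (ip x y))"
  have u: "norm ?u = 1" using False by (simp add: norm_sgn)
  have "Re (?u * ip x y) = norm (ip x y)"
  proof -
    have "?u * ip x y = of_real (norm (ip x y))"
      using False complex_norm_square[of "ip x y"]
      by (simp add: sgn_div_norm scaleR_conv_of_real field_simps power2_eq_square)
    thus ?thesis by simp
  qed
  thus ?thesis
    using Re_ip_le[of x "sc ?u y"] assms u by (simp add: ip_scale carrier_scale hnorm_scale)
qed (use assms in \<open>simp add: hnorm_nonneg\<close>)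

lemma hlim_unique:
  assumes l: "hlim K ip f l \<F>" "hlim K ip f l' \<F>" and f: "\<And>t. f t \<in> K" and "\<F> \<noteq> bot"
  shows "l = l'"
proof -
  have K: "l \<in> K" "l' \<in> K" using l by (auto simp: hlim_def)
  have "((\<lambda>t. hnorm ip (f t - l) + hnorm ip (f t - l')) \<longlongrightarrow> 0 + 0) \<F>"
    using l by (intro tendsto_add) (auto simp: hlim_def)
  moreover have "hnorm ip (l - l') \<le> hnorm ip (f t - l) + hnorm ip (f t - l')" for t
    using hnorm_triangle_diff[of l "f t" l'] hnorm_minus[of l "f t"] f K by simp
  ultimately have "hnorm ip (l - l') \<le> 0"
    using \<open>\<F> \<noteq> bot\<close> by (intro tendsto_lowerbound) auto
  thus ?thesis using hnorm_eq_0_iff[of "l - l'"] hnorm_nonneg[of "l - l'"] K carrier_diff by auto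
qed

lemma hlim_ip:
  assumes l: "hlim K ip f l \<F>" and f: "\<And>t. f t \<in> K" and x: "x \<in> K"
  shows "((\<lambda>t. ip x (f t)) \<longlongrightarrow> ip x l) \<F>"
proof -
  have K: "l \<in> K" using l by (auto simp: hlim_def)
  have "((\<lambda>t. ip x (f t) - ip x l) \<longlongrightarrow> 0) \<F>"
  proof (rule Lim_null_comparison)
    show "\<forall>\<^sub>F t in \<F>. norm (ip x (f t) - ip x l) \<le> hnorm ip x * hnorm ip (f t - l)"
      using hnorm_cauchy_schwarz[OF x carrier_diff[OF f K]] f K x by (simp add: ip_diff)
    show "((\<lambda>t. hnorm ip x * hnorm ip (f t - l)) \<longlongrightarrow> 0) \<F>"
      using l by (auto simp: hlim_def intro!: tendsto_eq_intros)
  qed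
  thus ?thesis by (simp add: LIM_zero_iff)
qed

end

text \<open>By polarization, preserving norms is the same as preserving inner products.\<close>

lemma linear_isometry_ip:
  assumes H: "complex_hilbert_space scH H ipH" and K: "complex_hilbert_space scK K ipK"
    and W: "linear_isometry scH H ipH scK K ipK W" and xy: "x \<in> H" "y \<in> H"
  shows "ipK (W x) (W y) = ipH x y"
proof -
  interpret H: complex_hilbert_space scH H ipH by (rule H)
  interpret K: complex_hilbert_space scK K ipK by (rule K)
  have WK: "W u \<in> K" if "u \<in> H" for u using W that by (auto simp: linear_isometry_def)
  have Re: "Re (ipK (W u) (W v)) = Re (ipH u v)" if uv: "u \<in> H" "v \<in> H" for u v
  proof -
    have "hnorm ipK (W u + W v) = hnorm ipH (u + v)" "hnorm ipK (W u) = hnorm ipH u"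
      "hnorm ipK (W v) = hnorm ipH v"
      using W uv H.carrier_add[OF uv] unfolding linear_isometry_def by metis+
    thus ?thesis
      using H.hnorm_add_square[OF uv] K.hnorm_add_square[OF WK WK, OF uv] by simp
  qed
  have "Im (ipK (W x) (W y)) = Re (ipK (scK \<i> (W x)) (W y))"
    using WK xy by (simp add: K.ip_scale_left)
  also have "\<dots> = Re (ipH (scH \<i> x) y)"
    using Re[of "scH \<i> x" y] W xy by (simp add: linear_isometry_def H.carrier_scale)
  also have "\<dots> = Im (ipH x y)" using xy by (simp add: H.ip_scale_left)
  finally show ?thesis using Re[OF xy] by (simp add: complex_eq_iff)
qed

lemma linear_isometry_carrier:
  "linear_isometry scH H ipH scK K ipK W \<Longrightarrow> x \<in> H \<Longrightarrow> W x \<in> K"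
  and linear_isometry_hnorm:
  "linear_isometry scH H ipH scK K ipK W \<Longrightarrow> x \<in> H \<Longrightarrow> hnorm ipK (W x) = hnorm ipH x"
  and linear_isometry_scale:
  "linear_isometry scH H ipH scK K ipK W \<Longrightarrow> x \<in> H \<Longrightarrow> W (scH c x) = scK c (W x)"
  by (auto simp: linear_isometry_def)

lemma linear_isometry_diff:
  assumes H: "complex_hilbert_space scH H ipH"
    and W: "linear_isometry scH H ipH scK K ipK W" and "x \<in> H" "y \<in> H"
  shows "W (x - y) = W x - W y"
proof -
  interpret H: complex_hilbert_space scH H ipH by (rule H)
  have "W x = W (x - y) + W y"
    using W assms(3,4) H.carrier_diff[of x y] by (metis diff_add_cancel linear_isometry_def)
  thus ?thesis by simp
qed

section \<open>The reproducing kernel Hilbert space is a Hilbert space\<close>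

definition point_mass :: "real \<Rightarrow> real \<Rightarrow> complex"
  where "point_mass x = (\<lambda>y. if y = x then 1 else 0)"

lemma point_mass_support: "{y. point_mass x y \<noteq> 0} = {x}"
  by (auto simp: point_mass_def)

lemma point_mass_coefficients: "x \<in> \<Omega> \<Longrightarrow> point_mass x \<in> coefficients \<Omega>"
  by (simp add: coefficients_def point_mass_support)

lemma span_ip_point_mass: "span_ip F (point_mass x) (point_mass y) = F (x - y)"
  unfolding span_ip_def point_mass_support by (simp add: point_mass_def)

lemma hnorm_point_mass: "hnorm (span_ip F) (point_mass x) = sqrt (Re (F 0))"
  by (simp add: hnorm_def span_ip_point_mass)

lemma span_ip_point_mass_left:
  "x \<in> \<Omega> \<Longrightarrow> span_ip F (point_mass x) c = span_fun \<Omega> F c x"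
  by (subst span_ip_fun[OF point_mass_coefficients])
     (auto simp only: point_mass_support sum.insert sum.empty finite.emptyI, simp add: point_mass_def)

lemma span_fun_linear:
  assumes "c \<in> coefficients \<Omega>" "d \<in> coefficients \<Omega>"
  shows "span_fun \<Omega> F (c + d) = span_fun \<Omega> F c + span_fun \<Omega> F d"
    and "span_fun \<Omega> F (c - d) = span_fun \<Omega> F c - span_fun \<Omega> F d"
    and "span_fun \<Omega> F (fun_scale a c) = fun_scale a (span_fun \<Omega> F c)"
proof -
  have out: "span_fun \<Omega> F e z = 0" if "z \<notin> \<Omega>" for e z
    using that by (simp add: span_fun_def)
  note sp = span_ip_point_mass_left[symmetric]
  have "span_fun \<Omega> F (c + d) z = span_fun \<Omega> F c z + span_fun \<Omega> F d z"
    "span_fun \<Omega> F (c - d) z = span_fun \<Omega> F c z - span_fun \<Omega> F d z"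
    "span_fun \<Omega> F (fun_scale a c) z = a * span_fun \<Omega> F c z" for z
    using assms
    by (cases "z \<in> \<Omega>";
        simp add: sp out span_ip_linear[OF point_mass_coefficients])+
  thus "span_fun \<Omega> F (c + d) = span_fun \<Omega> F c + span_fun \<Omega> F d"
    "span_fun \<Omega> F (c - d) = span_fun \<Omega> F c - span_fun \<Omega> F d"
    "span_fun \<Omega> F (fun_scale a c) = fun_scale a (span_fun \<Omega> F c)"
    by (auto simp: fun_scale_def)
qed

text \<open>The Cauchy--Schwarz inequality against a point mass: point evaluations are bounded by the norm.\<close>

lemma span_fun_bound:
  assumes pd: "positive_definite_on \<Omega> F" and c: "c \<in> coefficients \<Omega>"
  shows "norm (span_fun \<Omega> F c z) \<le> sqrt (Re (F 0)) * hnorm (span_ip F) c"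
proof (cases "z \<in> \<Omega>")
  case True
  thus ?thesis
    using span_cauchy_schwarz[OF pd point_mass_coefficients[OF True] c]
    by (simp add: span_ip_point_mass_left hnorm_point_mass)
next
  case False
  show ?thesis
  proof (cases "\<Omega> = {}")
    case True
    hence "c = 0" using c by (auto simp: coefficients_def)
    thus ?thesis by (simp add: span_fun_def hnorm_def span_ip_def)
  next
    case False
    then obtain x where "x \<in> \<Omega>" by blast
    hence "0 \<le> sqrt (Re (F 0))"
      using span_hnorm(1)[OF pd point_mass_coefficients] hnorm_point_mass by metis
    thus ?thesis using \<open>z \<notin> \<Omega>\<close> span_hnorm(1)[OF pd c] by (simp add: span_fun_def)
  qed
qed

lemma positive_definite_bound:
  assumes pd: "positive_definite_on \<Omega> F" and "x \<in> \<Omega>" "y \<in> \<Omega>"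
  shows "norm (F (x - y)) \<le> Re (F 0)" "0 \<le> Re (F 0)"
proof -
  have "0 \<le> sqrt (Re (F 0))"
    using span_hnorm(1)[OF pd point_mass_coefficients[OF assms(2)]] hnorm_point_mass by metis
  thus 0: "0 \<le> Re (F 0)" by simp
  show "norm (F (x - y)) \<le> Re (F 0)"
    using span_cauchy_schwarz[OF pd point_mass_coefficients[OF assms(2)] point_mass_coefficients[OF assms(3)]] 0
    by (simp add: span_ip_point_mass hnorm_point_mass)
qed

lemma represents_coefficients: "represents \<Omega> F c f \<Longrightarrow> c n \<in> coefficients \<Omega>"
  by (simp add: represents_def)

lemma represents_const:
  "c \<in> coefficients \<Omega> \<Longrightarrow> represents \<Omega> F (\<lambda>n. c) (span_fun \<Omega> F c)"
  by (simp add: represents_def hcauchy_def hnorm_def span_ip_def)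

lemma span_fun_rkhs: "c \<in> coefficients \<Omega> \<Longrightarrow> span_fun \<Omega> F c \<in> rkhs \<Omega> F"
  using represents_const by (auto simp: rkhs_def)

lemma span_hnorm_scale:
  assumes c: "c \<in> coefficients \<Omega>"
  shows "hnorm (span_ip F) (fun_scale a c) = norm a * hnorm (span_ip F) c"
proof -
  have "span_ip F (fun_scale a c) (fun_scale a c) = of_real ((norm a)\<^sup>2) * span_ip F c c"
    using span_ip_linear(5,6)[OF _ c c] c coefficients_closed(3)[OF c c]
    by (simp add: complex_norm_square del: of_real_power)
  thus ?thesis by (simp add: hnorm_def real_sqrt_mult)
qed

lemma represents_add:
  assumes pd: "positive_definite_on \<Omega> F" and c: "represents \<Omega> F c f" and d: "represents \<Omega> F d g"
  shows "represents \<Omega> F (\<lambda>n. c n + d n) (f + g)"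
  unfolding represents_def
proof (intro conjI allI)
  note co = represents_coefficients[OF c] represents_coefficients[OF d]
  show "c n + d n \<in> coefficients \<Omega>" for n using coefficients_closed(1) co by blast
  show "(\<lambda>n. span_fun \<Omega> F (c n + d n) z) \<longlonglongrightarrow> (f + g) z" for z
    using c d by (simp add: span_fun_linear[OF co] represents_def tendsto_add)
  show "hcauchy (span_ip F) (\<lambda>n. c n + d n)" unfolding hcauchy_def
  proof (intro allI impI)
    fix e :: real assume "e > 0"
    then obtain N N' where N: "\<forall>m\<ge>N. \<forall>n\<ge>N. hnorm (span_ip F) (c m - c n) < e / 2"
      and N': "\<forall>m\<ge>N'. \<forall>n\<ge>N'. hnorm (span_ip F) (d m - d n) < e / 2"
      using c d unfolding represents_def hcauchy_def by (meson half_gt_zero)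
    have "hnorm (span_ip F) (c m + d m - (c n + d n)) < e" if "m \<ge> max N N'" "n \<ge> max N N'" for m n
    proof -
      have "hnorm (span_ip F) (c m + d m - (c n + d n)) \<le>
          hnorm (span_ip F) (c m - c n) + hnorm (span_ip F) (d m - d n)"
        using span_triangle[OF pd coefficients_closed(2) coefficients_closed(2), OF co(1) co(1) co(2) co(2),
            of m n m n] by (simp only: add_diff_add)
      also have "\<dots> < e"
        using N[rule_format, of m n] N'[rule_format, of m n] that by simp
      finally show ?thesis .
    qed
    thus "\<exists>M. \<forall>m\<ge>M. \<forall>n\<ge>M. hnorm (span_ip F) (c m + d m - (c n + d n)) < e" by blast
  qed
qed

lemma represents_scale:
  assumes c: "represents \<Omega> F c f"
  shows "represents \<Omega> F (\<lambda>n. fun_scale a (c n)) (fun_scale a f)"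
  unfolding represents_def
proof (intro conjI allI)
  note co = represents_coefficients[OF c]
  show "fun_scale a (c n) \<in> coefficients \<Omega>" for n using coefficients_closed(3) co by blast
  show "(\<lambda>n. span_fun \<Omega> F (fun_scale a (c n)) z) \<longlonglongrightarrow> fun_scale a f z" for z
    using c by (simp add: span_fun_linear(3)[OF co co] represents_def) (simp add: fun_scale_def tendsto_mult_left)
  show "hcauchy (span_ip F) (\<lambda>n. fun_scale a (c n))" unfolding hcauchy_def
  proof (intro allI impI)
    fix e :: real assume e: "e > 0"
    have "e / (norm a + 1) > 0" using e by (intro divide_pos_pos) (auto simp: add_nonneg_pos)
    then obtain N where N: "\<forall>m\<ge>N. \<forall>n\<ge>N. hnorm (span_ip F) (c m - c n) < e / (norm a + 1)"
      using c unfolding represents_def hcauchy_def by blast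
    have "hnorm (span_ip F) (fun_scale a (c m) - fun_scale a (c n)) < e" if "m \<ge> N" "n \<ge> N" for m n
    proof -
      have "fun_scale a (c m) - fun_scale a (c n) = fun_scale a (c m - c n)"
        by (auto simp: fun_scale_def algebra_simps)
      hence "hnorm (span_ip F) (fun_scale a (c m) - fun_scale a (c n)) =
          norm a * hnorm (span_ip F) (c m - c n)"
        using span_hnorm_scale[OF coefficients_closed(2)[OF co co]] by simp
      also have "\<dots> \<le> norm a * (e / (norm a + 1))"
        using N that by (intro mult_left_mono) (auto intro: less_imp_le)
      also have "\<dots> < (norm a + 1) * (e / (norm a + 1))"
        using \<open>e / (norm a + 1) > 0\<close> by (intro mult_strict_right_mono) auto
      also have "\<dots> = e" using \<open>e / (norm a + 1) > 0\<close> by (cases "norm a + 1 = 0") simp_all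
      finally show ?thesis .
    qed
    thus "\<exists>M. \<forall>m\<ge>M. \<forall>n\<ge>M. hnorm (span_ip F) (fun_scale a (c m) - fun_scale a (c n)) < e" by blast
  qed
qed

lemma represents_diff:
  assumes pd: "positive_definite_on \<Omega> F" and c: "represents \<Omega> F c f" and d: "represents \<Omega> F d g"
  shows "represents \<Omega> F (\<lambda>n. c n - d n) (f - g)"
proof -
  have *: "p + fun_scale (-1) q = p - q" for p q by (auto simp: fun_scale_def)
  show ?thesis using represents_add[OF pd c represents_scale[OF d, of "-1"]] by (simp only: *)
qed

text \<open>Point evaluations are bounded, so norm-Cauchy coefficient sequences converge pointwise.\<close>

lemma represents_exists:
  assumes pd: "positive_definite_on \<Omega> F" and c: "\<And>n. c n \<in> coefficients \<Omega>"
    and C: "hcauchy (span_ip F) c"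
  shows "\<exists>f. represents \<Omega> F c f"
proof -
  define B where "B = \<bar>sqrt (Re (F 0))\<bar> + 1"
  have B: "B > 0" by (simp add: B_def)
  have "Cauchy (\<lambda>n. span_fun \<Omega> F (c n) z)" for z
  proof (rule CauchyI)
    fix e :: real assume "e > 0"
    hence "e / B > 0" using B by simp
    then obtain N where N: "\<forall>m\<ge>N. \<forall>n\<ge>N. hnorm (span_ip F) (c m - c n) < e / B"
      using C unfolding hcauchy_def by blast
    have "norm (span_fun \<Omega> F (c m) z - span_fun \<Omega> F (c n) z) < e" if "m \<ge> N" "n \<ge> N" for m n
    proof -
      have "norm (span_fun \<Omega> F (c m) z - span_fun \<Omega> F (c n) z) \<le>
          sqrt (Re (F 0)) * hnorm (span_ip F) (c m - c n)"
        using span_fun_bound[OF pd coefficients_closed(2)[OF c c], of m n z]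
        by (simp add: span_fun_linear[OF c c])
      also have "\<dots> \<le> B * hnorm (span_ip F) (c m - c n)"
        using span_hnorm(1)[OF pd coefficients_closed(2)[OF c c]]
        by (intro mult_right_mono) (auto simp: B_def)
      also have "\<dots> < B * (e / B)" using N that B by (intro mult_strict_left_mono) auto
      finally show ?thesis using B by simp
    qed
    thus "\<exists>M. \<forall>m\<ge>M. \<forall>n\<ge>M. norm (span_fun \<Omega> F (c m) z - span_fun \<Omega> F (c n) z) < e" by blast
  qed
  hence "\<forall>z. \<exists>l. (\<lambda>n. span_fun \<Omega> F (c n) z) \<longlonglongrightarrow> l"
    using Cauchy_convergent convergent_def by blast
  thus ?thesis using c C unfolding represents_def by metis
qed

lemma rkhs_hnorm_limit:
  assumes pd: "positive_definite_on \<Omega> F" and c: "represents \<Omega> F c f"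
  shows "(\<lambda>n. hnorm (span_ip F) (c n)) \<longlonglongrightarrow> hnorm (rkhs_ip \<Omega> F) f"
  unfolding hnorm_def by (intro tendsto_intros rkhs_ip_limit[OF pd c c])

lemma rkhs_hnorm_nonneg:
  assumes pd: "positive_definite_on \<Omega> F" and "f \<in> rkhs \<Omega> F"
  shows "0 \<le> hnorm (rkhs_ip \<Omega> F) f"
proof -
  obtain c where c: "represents \<Omega> F c f" using assms by (auto simp: rkhs_def)
  show ?thesis
    using span_hnorm(1)[OF pd represents_coefficients[OF c]]
    by (intro LIMSEQ_le_const[OF rkhs_hnorm_limit[OF pd c]]) auto
qed

lemma rkhs_ip_span_fun:
  assumes pd: "positive_definite_on \<Omega> F" and "c \<in> coefficients \<Omega>" "d \<in> coefficients \<Omega>"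
  shows "rkhs_ip \<Omega> F (span_fun \<Omega> F c) (span_fun \<Omega> F d) = span_ip F c d"
  using rkhs_ip_limit[OF pd represents_const represents_const, OF assms(2,3)]
  by (simp add: LIMSEQ_const_iff)

lemma rkhs_hnorm_span_fun:
  assumes "positive_definite_on \<Omega> F" and "c \<in> coefficients \<Omega>"
  shows "hnorm (rkhs_ip \<Omega> F) (span_fun \<Omega> F c) = hnorm (span_ip F) c"
  by (simp add: hnorm_def rkhs_ip_span_fun[OF assms(1,2,2)])

lemma rkhs_closed:
  assumes pd: "positive_definite_on \<Omega> F" and "f \<in> rkhs \<Omega> F" "g \<in> rkhs \<Omega> F"
  shows "f + g \<in> rkhs \<Omega> F" "f - g \<in> rkhs \<Omega> F" "fun_scale a f \<in> rkhs \<Omega> F"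
  using assms represents_add[OF pd] represents_diff[OF pd] represents_scale
  unfolding rkhs_def by blast+

lemma rkhs_triangle:
  assumes pd: "positive_definite_on \<Omega> F" and "f \<in> rkhs \<Omega> F" "g \<in> rkhs \<Omega> F"
  shows "hnorm (rkhs_ip \<Omega> F) (f + g) \<le> hnorm (rkhs_ip \<Omega> F) f + hnorm (rkhs_ip \<Omega> F) g"
proof -
  obtain c d where c: "represents \<Omega> F c f" and d: "represents \<Omega> F d g"
    using assms by (auto simp: rkhs_def)
  show ?thesis
    using span_triangle[OF pd represents_coefficients[OF c] represents_coefficients[OF d]]
    by (intro LIMSEQ_le[OF rkhs_hnorm_limit[OF pd represents_add[OF pd c d]]
          tendsto_add[OF rkhs_hnorm_limit[OF pd c] rkhs_hnorm_limit[OF pd d]]]) auto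
qed

lemma rkhs_hnorm_minus:
  assumes pd: "positive_definite_on \<Omega> F" and "f \<in> rkhs \<Omega> F" "g \<in> rkhs \<Omega> F"
  shows "hnorm (rkhs_ip \<Omega> F) (f - g) = hnorm (rkhs_ip \<Omega> F) (g - f)"
proof -
  obtain c d where c: "represents \<Omega> F c f" and d: "represents \<Omega> F d g"
    using assms by (auto simp: rkhs_def)
  have "hnorm (span_ip F) (c n - d n) = hnorm (span_ip F) (d n - c n)" for n
  proof -
    have "c n - d n = fun_scale (-1) (d n - c n)" by (auto simp: fun_scale_def)
    thus ?thesis
      using span_hnorm_scale[OF coefficients_closed(2)[OF represents_coefficients[OF d]
            represents_coefficients[OF c]], of F "-1" n n] by simp
  qed
  thus ?thesis
    using rkhs_hnorm_limit[OF pd represents_diff[OF pd c d]] rkhs_hnorm_limit[OF pd represents_diff[OF pd d c]]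
    by (simp add: LIMSEQ_unique)
qed

text \<open>
  The sequence \<open>c m - c n\<close>, \<open>m \<rightarrow> \<infinity>\<close>, represents the difference, so its norm is a limit of the norms that
  the Cauchy condition makes small.
\<close>

lemma represents_converges:
  assumes pd: "positive_definite_on \<Omega> F" and c: "represents \<Omega> F c f"
  shows "(\<lambda>n. hnorm (rkhs_ip \<Omega> F) (f - span_fun \<Omega> F (c n))) \<longlonglongrightarrow> 0"
proof (rule LIMSEQ_I)
  fix e :: real assume e: "e > 0"
  then obtain N where N: "\<forall>m\<ge>N. \<forall>n\<ge>N. hnorm (span_ip F) (c m - c n) < e / 2"
    using c unfolding represents_def hcauchy_def by (meson half_gt_zero)
  have "norm (hnorm (rkhs_ip \<Omega> F) (f - span_fun \<Omega> F (c n)) - 0) < e" if n: "n \<ge> N" for n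
  proof -
    have lim: "(\<lambda>m. hnorm (span_ip F) (c m - c n)) \<longlonglongrightarrow> hnorm (rkhs_ip \<Omega> F) (f - span_fun \<Omega> F (c n))"
      by (intro rkhs_hnorm_limit[OF pd] represents_diff[OF pd c] represents_const
          represents_coefficients[OF c])
    have "hnorm (rkhs_ip \<Omega> F) (f - span_fun \<Omega> F (c n)) \<le> e / 2"
      using N n by (intro LIMSEQ_le_const2[OF lim]) (auto intro: less_imp_le)
    moreover have "0 \<le> hnorm (rkhs_ip \<Omega> F) (f - span_fun \<Omega> F (c n))"
      using span_hnorm(1)[OF pd coefficients_closed(2)] represents_coefficients[OF c]
      by (intro LIMSEQ_le_const[OF lim]) auto
    ultimately show ?thesis using e by simp
  qed
  thus "\<exists>N. \<forall>n\<ge>N. norm (hnorm (rkhs_ip \<Omega> F) (f - span_fun \<Omega> F (c n)) - 0) < e" by blast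
qed

lemma rkhs_span_dense:
  assumes pd: "positive_definite_on \<Omega> F" and "f \<in> rkhs \<Omega> F" and "e > 0"
  obtains c where "c \<in> coefficients \<Omega>" "hnorm (rkhs_ip \<Omega> F) (f - span_fun \<Omega> F c) < e"
proof -
  obtain c where c: "represents \<Omega> F c f" using assms by (auto simp: rkhs_def)
  have "\<forall>\<^sub>F n in sequentially. hnorm (rkhs_ip \<Omega> F) (f - span_fun \<Omega> F (c n)) < e"
    using order_tendstoD(2)[OF represents_converges[OF pd c]] assms by blast
  then obtain n where "hnorm (rkhs_ip \<Omega> F) (f - span_fun \<Omega> F (c n)) < e"
    using eventually_happens by force
  thus ?thesis using that represents_coefficients[OF c] by blast
qed

text \<open>
  A Cauchy sequence of limits is replaced by a Cauchy sequence in the dense span at vanishing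
  distance, which represents the limit by construction of the space.
\<close>

lemma rkhs_complete:
  assumes pd: "positive_definite_on \<Omega> F" and X: "\<And>n. X n \<in> rkhs \<Omega> F"
    and C: "hcauchy (rkhs_ip \<Omega> F) X"
  shows "\<exists>l. hlim (rkhs \<Omega> F) (rkhs_ip \<Omega> F) X l sequentially"
proof -
  let ?n = "hnorm (rkhs_ip \<Omega> F)" and ?s = "span_fun \<Omega> F"
  have "\<exists>c. c \<in> coefficients \<Omega> \<and> ?n (X n - ?s c) < inverse (of_nat (Suc n))" for n
    using rkhs_span_dense[OF pd X, of "inverse (of_nat (Suc n))" n] by auto
  then obtain d where d: "\<And>n. d n \<in> coefficients \<Omega>"
    and dX: "\<And>n. ?n (X n - ?s (d n)) < inverse (of_nat (Suc n))" by metis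
  have s: "?s (d n) \<in> rkhs \<Omega> F" for n using span_fun_rkhs[OF d] .
  have tri: "?n (f - h) \<le> ?n (f - g) + ?n (g - h)"
    if "f \<in> rkhs \<Omega> F" "g \<in> rkhs \<Omega> F" "h \<in> rkhs \<Omega> F" for f g h
    using rkhs_triangle[OF pd rkhs_closed(2)[OF pd] rkhs_closed(2)[OF pd], OF that(1,2,2,3)] by simp
  have near: "(\<lambda>n. ?n (X n - ?s (d n))) \<longlonglongrightarrow> 0"
  proof (rule tendsto_sandwich[OF _ _ tendsto_const LIMSEQ_inverse_real_of_nat])
    show "\<forall>\<^sub>F n in sequentially. 0 \<le> ?n (X n - ?s (d n))"
      using rkhs_hnorm_nonneg[OF pd rkhs_closed(2)[OF pd X s]] by simp
    show "\<forall>\<^sub>F n in sequentially. ?n (X n - ?s (d n)) \<le> inverse (real (Suc n))"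
      using dX by (simp add: less_imp_le)
  qed
  have "hcauchy (span_ip F) d" unfolding hcauchy_def
  proof (intro allI impI)
    fix e :: real assume e: "e > 0"
    then obtain N where N: "\<forall>m\<ge>N. \<forall>n\<ge>N. ?n (X m - X n) < e / 3"
      using C unfolding hcauchy_def by (meson divide_pos_pos zero_less_numeral)
    obtain M where M: "\<And>n. n \<ge> M \<Longrightarrow> ?n (X n - ?s (d n)) < e / 3"
      using order_tendstoD(2)[OF near, of "e / 3"] e unfolding eventually_sequentially by auto
    have "hnorm (span_ip F) (d m - d n) < e" if "m \<ge> max N M" "n \<ge> max N M" for m n
    proof -
      have "hnorm (span_ip F) (d m - d n) = ?n (?s (d m) - ?s (d n))"
        using rkhs_hnorm_span_fun[OF pd coefficients_closed(2)[OF d d]] span_fun_linear(2)[OF d d] by metis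
      also have "\<dots> \<le> ?n (X m - ?s (d m)) + (?n (X m - X n) + ?n (X n - ?s (d n)))"
        using tri[OF s[of m] X[of m] s[of n]] tri[OF X[of m] X[of n] s[of n]]
          rkhs_hnorm_minus[OF pd X[of m] s[of m]] by simp
      also have "\<dots> < e" using N that M[of m] M[of n] by (auto simp: less_imp_le)
          (smt (verit) field_sum_of_halves)
      finally show ?thesis .
    qed
    thus "\<exists>N. \<forall>m\<ge>N. \<forall>n\<ge>N. hnorm (span_ip F) (d m - d n) < e" by blast
  qed
  then obtain f where f: "represents \<Omega> F d f" using represents_exists[where c = d, OF pd d] by blast
  hence fK: "f \<in> rkhs \<Omega> F" by (auto simp: rkhs_def)
  have "(\<lambda>n. ?n (X n - f)) \<longlonglongrightarrow> 0"
  proof (rule tendsto_sandwich[OF _ _ tendsto_const])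
    show "(\<lambda>n. ?n (X n - ?s (d n)) + ?n (f - ?s (d n))) \<longlonglongrightarrow> 0"
      using tendsto_add[OF near represents_converges[OF pd f]] by simp
    show "\<forall>\<^sub>F n in sequentially. ?n (X n - f) \<le> ?n (X n - ?s (d n)) + ?n (f - ?s (d n))"
      using tri[OF X s fK] by (intro always_eventually allI) (subst rkhs_hnorm_minus[OF pd fK s])
    show "\<forall>\<^sub>F n in sequentially. 0 \<le> ?n (X n - f)"
      using rkhs_hnorm_nonneg[OF pd rkhs_closed(2)[OF pd X fK]] by simp
  qed
  thus ?thesis using fK by (auto simp: hlim_def)
qed

text \<open>A vector of norm zero vanishes because point evaluations are bounded by the norm.\<close>

theorem rkhs_hilbert_space:
  assumes pd: "positive_definite_on \<Omega> F"
  shows "complex_hilbert_space fun_scale (rkhs \<Omega> F) (rkhs_ip \<Omega> F)"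
proof -
  interpret vector_space fun_scale
    by unfold_locales (auto simp: fun_scale_def algebra_simps)
  show ?thesis
  proof
    have "span_fun \<Omega> F 0 = 0" by (auto simp: span_fun_def)
    hence "0 \<in> rkhs \<Omega> F" using span_fun_rkhs[of 0 \<Omega> F] by (simp add: coefficients_def)
    thus "subspace (rkhs \<Omega> F)" using rkhs_closed[OF pd] by (auto simp: subspace_def)
  next
    fix f g h assume "f \<in> rkhs \<Omega> F" "g \<in> rkhs \<Omega> F" "h \<in> rkhs \<Omega> F"
    then obtain c d e where c: "represents \<Omega> F c f" and d: "represents \<Omega> F d g" and e: "represents \<Omega> F e h"
      by (auto simp: rkhs_def)
    note co = represents_coefficients[OF c] represents_coefficients[OF d] represents_coefficients[OF e]
    show "rkhs_ip \<Omega> F f (g + h) = rkhs_ip \<Omega> F f g + rkhs_ip \<Omega> F f h"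
      using rkhs_ip_limit[OF pd c represents_add[OF pd d e]]
        tendsto_add[OF rkhs_ip_limit[OF pd c d] rkhs_ip_limit[OF pd c e]]
      unfolding span_ip_linear(1)[OF co] by (rule LIMSEQ_unique)
  next
    fix f g a assume "f \<in> rkhs \<Omega> F" "g \<in> rkhs \<Omega> F"
    then obtain c d where c: "represents \<Omega> F c f" and d: "represents \<Omega> F d g"
      by (auto simp: rkhs_def)
    note co = represents_coefficients[OF c] represents_coefficients[OF d]
    show "rkhs_ip \<Omega> F f (fun_scale a g) = a * rkhs_ip \<Omega> F f g"
      using rkhs_ip_limit[OF pd c represents_scale[OF d, of a]]
        tendsto_mult_left[OF rkhs_ip_limit[OF pd c d], of a]
      unfolding span_ip_linear(5)[OF co co(2)] by (rule LIMSEQ_unique)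
    show "rkhs_ip \<Omega> F g f = cnj (rkhs_ip \<Omega> F f g)"
      using rkhs_ip_limit[OF pd d c] tendsto_cnj[OF rkhs_ip_limit[OF pd c d]]
      unfolding span_ip_cnj[OF pd co, symmetric] by (rule LIMSEQ_unique)
  next
    fix f assume "f \<in> rkhs \<Omega> F"
    then obtain c where c: "represents \<Omega> F c f" by (auto simp: rkhs_def)
    show "rkhs_ip \<Omega> F f f \<in> \<real>\<^sub>\<ge>\<^sub>0"
      using span_ip_nonneg[OF pd represents_coefficients[OF c]]
      by (intro closed_sequentially[OF closed_nonneg_Reals_complex _ rkhs_ip_limit[OF pd c c]]) auto
    assume 0: "rkhs_ip \<Omega> F f f = 0"
    show "f = 0"
    proof
      fix z
      have "(\<lambda>n. sqrt (Re (F 0)) * hnorm (span_ip F) (c n)) \<longlonglongrightarrow> sqrt (Re (F 0)) * 0"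
        using rkhs_hnorm_limit[OF pd c] 0 by (intro tendsto_mult_left) (simp add: hnorm_def)
      hence "(\<lambda>n. sqrt (Re (F 0)) * hnorm (span_ip F) (c n)) \<longlonglongrightarrow> 0" by simp
      hence "(\<lambda>n. span_fun \<Omega> F (c n) z) \<longlonglongrightarrow> 0"
        by (rule Lim_null_comparison[rotated])
           (intro always_eventually allI span_fun_bound[OF pd represents_coefficients[OF c]])
      moreover have "(\<lambda>n. span_fun \<Omega> F (c n) z) \<longlonglongrightarrow> f z" using c by (simp add: represents_def)
      ultimately show "f z = 0 z" unfolding zero_fun_apply by (blast intro: LIMSEQ_unique)
    qed
  qed (rule rkhs_complete[OF pd])
qed

section \<open>Smeared vectors\<close>

definition continuous_supported :: "real \<Rightarrow> real \<Rightarrow> (real \<Rightarrow> complex) \<Rightarrow> bool"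
  where "continuous_supported a b \<phi> \<longleftrightarrow> continuous_on UNIV \<phi> \<and> (\<forall>x. x \<notin> {a..b} \<longrightarrow> \<phi> x = 0)"

definition L1_norm :: "(real \<Rightarrow> complex) \<Rightarrow> real"
  where "L1_norm \<phi> = (LINT y|lborel. norm (\<phi> y))"

text \<open>The maximum with \<open>a\<close> keeps the rounded points of \<open>{a..b}\<close> inside \<open>{a..b}\<close>, and hence inside \<open>\<Omega>\<close>.\<close>

definition round_down :: "real \<Rightarrow> nat \<Rightarrow> real \<Rightarrow> real"
  where "round_down a n y = max a (of_int \<lfloor>real (Suc n) * y\<rfloor> / real (Suc n))"

text \<open>
  Coefficients of a Riemann sum for \<open>\<integral> \<phi>(y) F(\<cdot> - y) dy\<close>: the image of the measure \<open>\<phi> dy\<close> under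
  rounding. Taking the exact masses of the cells, rather than values of \<open>\<phi>\<close> times cell lengths, makes
  the total variation at most \<open>\<parallel>\<phi>\<parallel>\<^sub>1\<close> for every \<open>n\<close>.
\<close>

definition cell_masses :: "real \<Rightarrow> (real \<Rightarrow> complex) \<Rightarrow> nat \<Rightarrow> real \<Rightarrow> complex"
  where "cell_masses a \<phi> n x = (LINT y|lborel. (if round_down a n y = x then \<phi> y else 0))"

lemma difference_setI: "\<lbrakk>x \<in> \<Omega>; y \<in> \<Omega>\<rbrakk> \<Longrightarrow> x - y \<in> difference_set \<Omega>"
  by (auto simp: difference_set_def)

lemma round_down_range:
  assumes "y \<in> {a..b}"
  shows "round_down a n y \<in> {a..b}" and "\<bar>y - round_down a n y\<bar> \<le> 1 / real (Suc n)"
proof -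
  define q where "q = of_int \<lfloor>real (Suc n) * y\<rfloor> / real (Suc n)"
  have "of_int \<lfloor>real (Suc n) * y\<rfloor> \<le> real (Suc n) * y" "real (Suc n) * y \<le> of_int \<lfloor>real (Suc n) * y\<rfloor> + 1"
    by linarith+
  hence "q \<le> y" "y \<le> q + 1 / real (Suc n)"
    unfolding q_def by (simp_all add: field_simps del: of_nat_Suc)
  thus "round_down a n y \<in> {a..b}" "\<bar>y - round_down a n y\<bar> \<le> 1 / real (Suc n)"
    using assms unfolding round_down_def q_def[symmetric] by (auto simp: max_def simp del: of_nat_Suc)
qed

lemma finite_round_down: "finite (round_down a n ` {a..b})"
proof -
  let ?N = "real (Suc n)"
  have "round_down a n ` {a..b} \<subseteq> (\<lambda>k. max a (of_int k / ?N)) ` {\<lfloor>?N * a\<rfloor>..\<lfloor>?N * b\<rfloor>}"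
    by (auto simp: round_down_def simp del: of_nat_Suc
        intro!: image_eqI[where x = "\<lfloor>?N * _\<rfloor>"] floor_mono mult_left_mono)
  thus ?thesis by (rule finite_subset) simp
qed

lemma round_down_measurable [measurable]: "round_down a n \<in> borel_measurable borel"
  unfolding round_down_def by measurable

context
  fixes a b :: real and \<phi> :: "real \<Rightarrow> complex"
  assumes \<phi>: "continuous_supported a b \<phi>"
begin

lemma continuous_supported_outside: "x \<notin> {a..b} \<Longrightarrow> \<phi> x = 0"
  using \<phi> by (auto simp: continuous_supported_def)

lemma integrable_supported_mult:
  assumes "continuous_on {a..b} f"
  shows "integrable lborel (\<lambda>y. \<phi> y * f y)"
proof -
  have "continuous_on {a..b} (\<lambda>y. \<phi> y * f y)"
    using \<phi> assms unfolding continuous_supported_def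
    by (auto intro!: continuous_intros intro: continuous_on_subset)
  hence "set_integrable lborel {a..b} (\<lambda>y. \<phi> y * f y)"
    by (rule borel_integrable_atLeastAtMost')
  moreover have "indicator {a..b} y *\<^sub>R (\<phi> y * f y) = \<phi> y * f y" for y
    using continuous_supported_outside[of y] by (auto simp: indicator_def)
  ultimately show ?thesis by (simp add: set_integrable_def)
qed

lemma integrable_supported: "integrable lborel \<phi>"
  using integrable_supported_mult[of "\<lambda>_. 1"] by simp

lemma integrable_cell: "integrable lborel (\<lambda>y. if round_down a n y = x then \<phi> y else 0)"
proof -
  have "{y. round_down a n y = x} = round_down a n -` {x} \<inter> space borel" by auto
  also have "\<dots> \<in> sets borel" by measurable
  finally have "{y. round_down a n y = x} \<in> sets lborel" by simp
  from integrable_mult_indicator[OF this integrable_supported]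
  have "integrable lborel (\<lambda>y. indicator {y. round_down a n y = x} y *\<^sub>R \<phi> y)" .
  moreover have "indicator {y. round_down a n y = x} y *\<^sub>R \<phi> y = (if round_down a n y = x then \<phi> y else 0)" for y
    by simp
  ultimately show ?thesis by (simp only:)
qed

lemma cell_masses_support:
  "{x. cell_masses a \<phi> n x \<noteq> 0} \<subseteq> round_down a n ` {a..b}"
proof
  fix x assume x: "x \<in> {x. cell_masses a \<phi> n x \<noteq> 0}"
  show "x \<in> round_down a n ` {a..b}"
  proof (rule ccontr)
    assume "x \<notin> round_down a n ` {a..b}"
    hence "(\<lambda>y. if round_down a n y = x then \<phi> y else 0) = (\<lambda>y. 0)"
      using continuous_supported_outside by (fastforce intro!: ext)
    thus False using x by (simp add: cell_masses_def)
  qed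
qed

lemma cell_masses_coefficients: "{a..b} \<subseteq> \<Omega> \<Longrightarrow> cell_masses a \<phi> n \<in> coefficients \<Omega>"
  using cell_masses_support[of n] finite_subset[OF cell_masses_support finite_round_down] round_down_range(1)
  unfolding coefficients_def by blast

lemma sum_round_down:
  fixes g :: "real \<Rightarrow> 'a::comm_monoid_add"
  assumes "y \<in> {a..b}"
  shows "(\<Sum>x\<in>round_down a n ` {a..b}. if round_down a n y = x then g x else 0) = g (round_down a n y)"
  using assms finite_round_down by (subst sum.delta') auto

text \<open>
  Change of variables for the image measure; the sum over the cells is exchanged with the integral.
\<close>

lemma cell_masses_sum:
  "integrable lborel (\<lambda>y. \<phi> y * f (round_down a n y))"
  "(\<Sum>x | cell_masses a \<phi> n x \<noteq> 0. cell_masses a \<phi> n x * f x) = (LINT y|lborel. \<phi> y * f (round_down a n y))"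
proof -
  let ?R = "round_down a n ` {a..b}"
  have eq: "(\<Sum>x\<in>?R. (if round_down a n y = x then \<phi> y else 0) * f x) = \<phi> y * f (round_down a n y)" for y
  proof (cases "y \<in> {a..b}")
    case True
    have "(\<Sum>x\<in>?R. (if round_down a n y = x then \<phi> y else 0) * f x) =
        (\<Sum>x\<in>?R. if round_down a n y = x then \<phi> y * f x else 0)"
      by (intro sum.cong) auto
    thus ?thesis using sum_round_down[OF True, of n "\<lambda>x. \<phi> y * f x"] by simp
  next
    case False
    hence "\<phi> y = 0" by (rule continuous_supported_outside)
    thus ?thesis by (auto intro!: sum.neutral)
  qed
  have "integrable lborel (\<lambda>y. \<Sum>x\<in>?R. (if round_down a n y = x then \<phi> y else 0) * f x)"
    by (intro Bochner_Integration.integrable_sum integrable_mult_left integrable_cell)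
  thus "integrable lborel (\<lambda>y. \<phi> y * f (round_down a n y))" by (simp only: eq)
  have "(\<Sum>x | cell_masses a \<phi> n x \<noteq> 0. cell_masses a \<phi> n x * f x) = (\<Sum>x\<in>?R. cell_masses a \<phi> n x * f x)"
    using cell_masses_support by (intro sum.mono_neutral_left finite_round_down) auto
  also have "\<dots> = (\<Sum>x\<in>?R. (LINT y|lborel. (if round_down a n y = x then \<phi> y else 0) * f x))"
    unfolding cell_masses_def by (intro sum.cong refl integral_mult_left_zero[symmetric])
  also have "\<dots> = (LINT y|lborel. (\<Sum>x\<in>?R. (if round_down a n y = x then \<phi> y else 0) * f x))"
    by (intro Bochner_Integration.integral_sum[symmetric] integrable_mult_left integrable_cell)
  finally show "(\<Sum>x | cell_masses a \<phi> n x \<noteq> 0. cell_masses a \<phi> n x * f x) =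
      (LINT y|lborel. \<phi> y * f (round_down a n y))"
    by (simp only: eq)
qed

lemma cell_masses_variation:
  "(\<Sum>x | cell_masses a \<phi> n x \<noteq> 0. norm (cell_masses a \<phi> n x)) \<le> L1_norm \<phi>"
proof -
  let ?R = "round_down a n ` {a..b}"
  let ?g = "\<lambda>x y. if round_down a n y = x then \<phi> y else 0"
  have eq: "(\<Sum>x\<in>?R. norm (?g x y)) = norm (\<phi> y)" for y
  proof (cases "y \<in> {a..b}")
    case True
    have "(\<Sum>x\<in>?R. norm (?g x y)) = (\<Sum>x\<in>?R. if round_down a n y = x then norm (\<phi> y) else 0)"
      by (intro sum.cong) auto
    thus ?thesis using sum_round_down[OF True, of n "\<lambda>x. norm (\<phi> y)"] by simp
  next
    case False
    hence "\<phi> y = 0" by (rule continuous_supported_outside)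
    thus ?thesis by (auto intro!: sum.neutral)
  qed
  have "(\<Sum>x | cell_masses a \<phi> n x \<noteq> 0. norm (cell_masses a \<phi> n x)) = (\<Sum>x\<in>?R. norm (cell_masses a \<phi> n x))"
    using cell_masses_support by (intro sum.mono_neutral_left finite_round_down) auto
  also have "\<dots> \<le> (\<Sum>x\<in>?R. (LINT y|lborel. norm (?g x y)))"
    unfolding cell_masses_def by (intro sum_mono integral_norm_bound)
  also have "\<dots> = (LINT y|lborel. (\<Sum>x\<in>?R. norm (?g x y)))"
    by (intro Bochner_Integration.integral_sum[symmetric] integrable_norm integrable_cell)
  finally show ?thesis by (simp only: eq L1_norm_def)
qed

lemma L1_norm_nonneg: "0 \<le> L1_norm \<phi>"
  unfolding L1_norm_def by simp

text \<open>
  Both sides are integrals against \<open>\<phi>\<close>, of \<open>f\<close> after and before rounding, and rounding moves points by at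
  most one cell.
\<close>

lemma cell_masses_approximate:
  assumes f: "continuous_on {a..b} f" and "e \<ge> 0"
    and e: "\<And>x y. \<lbrakk>x \<in> {a..b}; y \<in> {a..b}; \<bar>x - y\<bar> \<le> 1 / real (Suc n)\<rbrakk> \<Longrightarrow> norm (f x - f y) \<le> e"
  shows "norm ((\<Sum>x | cell_masses a \<phi> n x \<noteq> 0. cell_masses a \<phi> n x * f x) - (LINT y|lborel. \<phi> y * f y))
    \<le> e * L1_norm \<phi>"
proof -
  have "(\<Sum>x | cell_masses a \<phi> n x \<noteq> 0. cell_masses a \<phi> n x * f x) - (LINT y|lborel. \<phi> y * f y) =
      (LINT y|lborel. \<phi> y * f (round_down a n y) - \<phi> y * f y)"
    unfolding cell_masses_sum(2)
    by (rule Bochner_Integration.integral_diff[symmetric, OF cell_masses_sum(1) integrable_supported_mult[OF f]])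
  also have "norm \<dots> \<le> (LINT y|lborel. norm (\<phi> y * f (round_down a n y) - \<phi> y * f y))"
    by (rule integral_norm_bound)
  also have "\<dots> \<le> (LINT y|lborel. e * norm (\<phi> y))"
  proof (rule integral_mono)
    show "integrable lborel (\<lambda>y. norm (\<phi> y * f (round_down a n y) - \<phi> y * f y))"
      by (intro integrable_norm Bochner_Integration.integrable_diff cell_masses_sum(1) integrable_supported_mult f)
    show "integrable lborel (\<lambda>y. e * norm (\<phi> y))"
      by (intro integrable_mult_right integrable_norm integrable_supported)
    show "norm (\<phi> y * f (round_down a n y) - \<phi> y * f y) \<le> e * norm (\<phi> y)" for y
    proof (cases "y \<in> {a..b}")
      case True
      have "norm (f (round_down a n y) - f y) \<le> e"
        using round_down_range[OF True, of n] True by (intro e) (auto simp: abs_minus_commute)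
      hence "norm (\<phi> y) * norm (f (round_down a n y) - f y) \<le> norm (\<phi> y) * e"
        by (rule mult_left_mono) simp
      thus ?thesis by (simp add: norm_mult[symmetric] algebra_simps)
    qed (simp add: continuous_supported_outside)
  qed
  also have "\<dots> = e * L1_norm \<phi>" by (simp add: L1_norm_def)
  finally show ?thesis .
qed

context
  fixes \<Omega> :: "real set" and F :: "real \<Rightarrow> complex"
  assumes ab: "{a..b} \<subseteq> \<Omega>" and F: "continuous_on (difference_set \<Omega>) F"
begin

lemma continuous_on_kernel: "z \<in> \<Omega> \<Longrightarrow> continuous_on {a..b} (\<lambda>y. F (z - y))"
  using ab by (intro continuous_on_compose2[OF F] continuous_intros image_subsetI difference_setI) auto

lemma smear_integral:
  assumes z: "z \<in> \<Omega>"
  shows "smear \<Omega> F \<phi> z = (LINT y|lborel. \<phi> y * F (z - y))"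
proof -
  have "y \<notin> \<Omega> \<Longrightarrow> \<phi> y = 0" for y using ab by (intro continuous_supported_outside) auto
  hence "indicator \<Omega> y *\<^sub>R (\<phi> y * F (z - y)) = \<phi> y * F (z - y)" for y
    by (auto simp: indicator_def)
  thus ?thesis using z by (simp add: smear_def set_lebesgue_integral_def)
qed

text \<open>The kernel \<open>F(z - y)\<close> is uniformly continuous on the compact set \<open>Z \<times> {a..b}\<close>.\<close>

lemma span_fun_cell_masses_uniform_limit:
  assumes Z: "compact Z" "Z \<subseteq> \<Omega>"
  shows "uniform_limit Z (\<lambda>n. span_fun \<Omega> F (cell_masses a \<phi> n)) (smear \<Omega> F \<phi>) sequentially"
proof (rule uniform_limitI)
  fix e :: real assume e: "e > 0"
  define r where "r = e / (L1_norm \<phi> + 1)"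
  have r: "r > 0" "r * L1_norm \<phi> < e"
    using e L1_norm_nonneg by (auto simp: r_def field_simps add_nonneg_pos)
  have "continuous_on (Z \<times> {a..b}) (\<lambda>p. F (fst p - snd p))"
    using ab Z by (intro continuous_on_compose2[OF F])
      (auto intro!: continuous_intros difference_setI)
  hence "uniformly_continuous_on (Z \<times> {a..b}) (\<lambda>p. F (fst p - snd p))"
    by (intro compact_uniformly_continuous compact_Times Z) auto
  then obtain d where d: "d > 0" and dF: "\<And>p q. \<lbrakk>p \<in> Z \<times> {a..b}; q \<in> Z \<times> {a..b}; dist q p < d\<rbrakk>
      \<Longrightarrow> dist (F (fst q - snd q)) (F (fst p - snd p)) < r"
    using r(1) unfolding uniformly_continuous_on_def by meson
  obtain N where N: "1 / real (Suc N) < d"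
    using d reals_Archimedean[of d] by (auto simp: inverse_eq_divide)
  show "\<forall>\<^sub>F n in sequentially. \<forall>z\<in>Z. dist (span_fun \<Omega> F (cell_masses a \<phi> n) z) (smear \<Omega> F \<phi> z) < e"
    using eventually_ge_at_top[of N]
  proof eventually_elim
    case (elim n)
    have n: "1 / real (Suc n) < d"
      using elim N by (intro order.strict_trans1[OF _ N] frac_le) auto
    show ?case
    proof
      fix z assume z: "z \<in> Z"
      hence z': "z \<in> \<Omega>" using Z by auto
      have "norm ((\<Sum>x | cell_masses a \<phi> n x \<noteq> 0. cell_masses a \<phi> n x * F (z - x)) -
          (LINT y|lborel. \<phi> y * F (z - y))) \<le> r * L1_norm \<phi>"
      proof (rule cell_masses_approximate[OF continuous_on_kernel[OF z']])
        fix x y assume xy: "x \<in> {a..b}" "y \<in> {a..b}" "\<bar>x - y\<bar> \<le> 1 / real (Suc n)"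
        hence "dist (F (z - x)) (F (z - y)) < r"
          using dF[of "(z, y)" "(z, x)"] z n by (simp add: dist_Pair_Pair dist_real_def del: of_nat_Suc)
        thus "norm (F (z - x) - F (z - y)) \<le> r" by (simp add: dist_norm)
      qed (use r in simp)
      thus "dist (span_fun \<Omega> F (cell_masses a \<phi> n) z) (smear \<Omega> F \<phi> z) < e"
        using r(2) z' by (simp add: dist_norm span_fun_def smear_integral)
    qed
  qed
qed

context
  assumes pd: "positive_definite_on \<Omega> F"
begin

lemma cell_masses_span_ip_bound:
  assumes "\<And>x. x \<in> {a..b} \<Longrightarrow> norm (span_fun \<Omega> F d x) \<le> M"
  shows "norm (span_ip F (cell_masses a \<phi> n) d) \<le> L1_norm \<phi> * M"
proof (cases "{x. cell_masses a \<phi> n x \<noteq> 0} = {}")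
  case True
  hence "span_ip F (cell_masses a \<phi> n) d = 0" by (simp add: span_ip_def)
  moreover have "{a..b} = {} \<Longrightarrow> \<phi> = (\<lambda>_. 0)" using continuous_supported_outside by auto
  hence "{a..b} = {} \<Longrightarrow> L1_norm \<phi> = 0" by (simp add: L1_norm_def)
  moreover have "{a..b} \<noteq> {} \<Longrightarrow> 0 \<le> M" using assms norm_ge_zero order_trans by blast
  ultimately show ?thesis using L1_norm_nonneg by (cases "{a..b} = {}") auto
next
  case False
  let ?c = "cell_masses a \<phi> n"
  have S: "{x. ?c x \<noteq> 0} \<subseteq> {a..b}" using cell_masses_support[of n] round_down_range(1) by blast
  hence M: "M \<ge> 0" using False assms norm_ge_zero order_trans by blast
  have "norm (span_ip F ?c d) \<le> (\<Sum>x | ?c x \<noteq> 0. norm (cnj (?c x) * span_fun \<Omega> F d x))"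
    unfolding span_ip_fun[OF cell_masses_coefficients[OF ab]] by (rule norm_sum)
  also have "\<dots> \<le> (\<Sum>x | ?c x \<noteq> 0. norm (?c x) * M)"
    using S assms by (intro sum_mono) (auto simp: norm_mult intro!: mult_left_mono)
  also have "\<dots> \<le> L1_norm \<phi> * M"
    unfolding sum_distrib_right[symmetric] using M by (intro mult_right_mono cell_masses_variation)
  finally show ?thesis .
qed

text \<open>
  Uniform convergence of \<open>span_fun\<close> on the support, paired with coefficients of bounded variation,
  gives norm convergence.
\<close>

lemma cell_masses_represents: "represents \<Omega> F (cell_masses a \<phi>) (smear \<Omega> F \<phi>)"
proof -
  let ?c = "cell_masses a \<phi>"
  have co: "?c n \<in> coefficients \<Omega>" for n by (rule cell_masses_coefficients[OF ab])
  have "(\<lambda>n. span_fun \<Omega> F (?c n) z) \<longlonglongrightarrow> smear \<Omega> F \<phi> z" for z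
  proof (cases "z \<in> \<Omega>")
    case True
    thus ?thesis
      using tendsto_uniform_limitI[OF span_fun_cell_masses_uniform_limit[of "{z}"]] by simp
  qed (simp add: span_fun_def smear_def)
  moreover have "hcauchy (span_ip F) ?c" unfolding hcauchy_def
  proof (intro allI impI)
    fix e :: real assume e: "e > 0"
    define L where "L = L1_norm \<phi>"
    \<comment> \<open>With \<open>r\<close> as sup-norm error below, the squared distance is at most \<open>4 L r < e\<^sup>2\<close>.\<close>
    define q where "q = e\<^sup>2 / (L + 1)"
    define r where "r = q / 4"
    have L: "L \<ge> 0" using L1_norm_nonneg by (simp add: L_def)
    have r: "r > 0" using e L by (simp add: r_def q_def add_nonneg_pos)
    have "\<forall>\<^sub>F n in sequentially. \<forall>z\<in>{a..b}. dist (span_fun \<Omega> F (?c n) z) (smear \<Omega> F \<phi> z) < r"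
      by (rule uniform_limitD[OF span_fun_cell_masses_uniform_limit[OF compact_Icc ab] r])
    then obtain N where N: "\<And>n z. \<lbrakk>n \<ge> N; z \<in> {a..b}\<rbrakk> \<Longrightarrow> dist (span_fun \<Omega> F (?c n) z) (smear \<Omega> F \<phi> z) < r"
      unfolding eventually_sequentially by blast
    have "hnorm (span_ip F) (?c m - ?c n) < e" if mn: "m \<ge> N" "n \<ge> N" for m n
    proof -
      let ?d = "?c m - ?c n"
      have d: "?d \<in> coefficients \<Omega>" by (rule coefficients_closed(2)[OF co co])
      have dz: "norm (span_fun \<Omega> F ?d z) \<le> 2 * r" if z: "z \<in> {a..b}" for z
        using N[OF mn(1) z] N[OF mn(2) z] dist_triangle2[of "span_fun \<Omega> F (?c m) z" "span_fun \<Omega> F (?c n) z" "smear \<Omega> F \<phi> z"]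
        by (simp add: span_fun_linear[OF co co] dist_norm)
      have "(hnorm (span_ip F) ?d)\<^sup>2 = norm (span_ip F (?c m) ?d - span_ip F (?c n) ?d)"
        using span_hnorm(2)[OF pd d] span_ip_linear(4)[OF d co co] by simp
      also have "\<dots> \<le> norm (span_ip F (?c m) ?d) + norm (span_ip F (?c n) ?d)" by (rule norm_triangle_ineq4)
      also have "\<dots> \<le> L * (2 * r) + L * (2 * r)"
        unfolding L_def by (intro add_mono cell_masses_span_ip_bound dz)
      also have "\<dots> = L * q" by (simp add: r_def)
      also have "\<dots> = e\<^sup>2 * (L / (L + 1))" by (simp add: q_def)
      also have "\<dots> < e\<^sup>2 * 1" using e L by (intro mult_strict_left_mono) auto
      finally show ?thesis using e by (simp add: power_less_imp_less_base)
    qed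
    thus "\<exists>N. \<forall>m\<ge>N. \<forall>n\<ge>N. hnorm (span_ip F) (?c m - ?c n) < e" by blast
  qed
  ultimately show ?thesis using co by (simp add: represents_def)
qed

lemma smear_rkhs: "smear \<Omega> F \<phi> \<in> rkhs \<Omega> F"
  using cell_masses_represents by (auto simp: rkhs_def)

text \<open>
  Pairing the approximants \<open>c\<close> with themselves, \<open>\<parallel>c\<parallel>\<^sup>2 \<le> \<parallel>\<phi>\<parallel>\<^sub>1 F(0)\<^sup>1\<^sup>/\<^sup>2 \<parallel>c\<parallel>\<close> by their bounded variation and the
  bound on point evaluations; one factor \<open>\<parallel>c\<parallel>\<close> cancels, and the estimate passes to the limit.
\<close>

lemma smear_hnorm_bound: "hnorm (rkhs_ip \<Omega> F) (smear \<Omega> F \<phi>) \<le> sqrt (Re (F 0)) * L1_norm \<phi>"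
proof (rule LIMSEQ_le_const2[OF rkhs_hnorm_limit[OF pd cell_masses_represents]], intro exI allI impI)
  fix n :: nat
  let ?c = "cell_masses a \<phi> n" and ?n = "hnorm (span_ip F)"
  have co: "?c \<in> coefficients \<Omega>" by (rule cell_masses_coefficients[OF ab])
  have "?n ?c * ?n ?c = norm (span_ip F ?c ?c)"
    using span_hnorm(2)[OF pd co] by (simp add: power2_eq_square)
  also have "\<dots> \<le> L1_norm \<phi> * (sqrt (Re (F 0)) * ?n ?c)"
    by (intro cell_masses_span_ip_bound span_fun_bound[OF pd co])
  finally have le: "?n ?c * ?n ?c \<le> (sqrt (Re (F 0)) * L1_norm \<phi>) * ?n ?c" by (simp add: algebra_simps)
  show "?n ?c \<le> sqrt (Re (F 0)) * L1_norm \<phi>"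
  proof (cases "?n ?c = 0")
    case True
    show ?thesis
    proof (cases "{a..b} = {}")
      case True
      hence "\<phi> = (\<lambda>_. 0)" using continuous_supported_outside by auto
      thus ?thesis using \<open>?n ?c = 0\<close> by (simp add: L1_norm_def)
    next
      case False
      then obtain x where "x \<in> \<Omega>" using ab by blast
      thus ?thesis using positive_definite_bound(2)[OF pd] L1_norm_nonneg True by simp
    qed
  next
    case False
    thus ?thesis using le span_hnorm(1)[OF pd co] by (simp add: less_le)
  qed
qed

end

end

end

lemma smear_diff:
  assumes \<phi>: "continuous_supported a b \<phi>" and \<psi>: "continuous_supported a b \<psi>"
    and ab: "{a..b} \<subseteq> \<Omega>" and F: "continuous_on (difference_set \<Omega>) F"
  shows "smear \<Omega> F (\<phi> - \<psi>) = smear \<Omega> F \<phi> - smear \<Omega> F \<psi>"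
proof
  fix z
  have d: "continuous_supported a b (\<phi> - \<psi>)"
    using \<phi> \<psi> by (auto simp: continuous_supported_def fun_diff_def intro: continuous_on_diff)
  show "smear \<Omega> F (\<phi> - \<psi>) z = (smear \<Omega> F \<phi> - smear \<Omega> F \<psi>) z"
    using integrable_supported_mult[OF \<phi> continuous_on_kernel[OF \<phi> ab F]]
      integrable_supported_mult[OF \<psi> continuous_on_kernel[OF \<psi> ab F]]
    by (cases "z \<in> \<Omega>")
      (simp add: smear_integral[OF \<phi> ab F] smear_integral[OF \<psi> ab F] smear_integral[OF d ab F]
        left_diff_distrib, simp add: smear_def)
qed

lemma smear_scale: "smear \<Omega> F (fun_scale c \<phi>) = fun_scale c (smear \<Omega> F \<phi>)"
  by (auto simp: smear_def fun_scale_def mult.assoc)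

section \<open>Test functions: translation, Taylor expansion, bumps\<close>

definition smooth :: "(real \<Rightarrow> complex) \<Rightarrow> bool"
  where "smooth \<phi> \<longleftrightarrow> (\<forall>n x. (derivative ^^ n) \<phi> differentiable (at x))"

definition translate :: "real \<Rightarrow> (real \<Rightarrow> complex) \<Rightarrow> real \<Rightarrow> complex"
  where "translate s f = (\<lambda>x. f (x + s))"

lemma smooth_has_derivative: "smooth \<phi> \<Longrightarrow> (\<phi> has_vector_derivative derivative \<phi> x) (at x)"
  unfolding smooth_def derivative_def
  by (metis funpow_0 vector_derivative_works)

lemma smooth_continuous: "smooth \<phi> \<Longrightarrow> continuous_on S \<phi>"
  by (intro continuous_at_imp_continuous_on ballI)
     (rule has_vector_derivative_continuous[OF smooth_has_derivative])

lemma smooth_derivative: "smooth \<phi> \<Longrightarrow> smooth (derivative \<phi>)"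
  unfolding smooth_def by (metis funpow_Suc_right o_apply)

lemma derivative_eqI: "(\<And>x. (f has_vector_derivative f' x) (at x)) \<Longrightarrow> derivative f = f'"
  unfolding derivative_def by (intro ext vector_derivative_at)

text \<open>
  Iterated derivatives never leave a set of differentiable functions that contains their derivatives.
  This avoids formulas for derivatives of higher order.
\<close>

lemma smooth_coinduct:
  assumes "\<phi> \<in> S" and S: "\<And>f. f \<in> S \<Longrightarrow> \<exists>f'\<in>S. \<forall>x. (f has_vector_derivative f' x) (at x)"
  shows "smooth \<phi>"
proof -
  have "(derivative ^^ n) \<phi> \<in> S" for n
  proof (induction n)
    case (Suc n)
    obtain f' where f': "f' \<in> S" "\<And>x. ((derivative ^^ n) \<phi> has_vector_derivative f' x) (at x)"
      using S[OF Suc.IH] by blast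
    hence "derivative ((derivative ^^ n) \<phi>) = f'" by (intro derivative_eqI)
    thus ?case using f'(1) by simp
  qed (use assms in simp)
  thus ?thesis unfolding smooth_def using S by (meson differentiableI_vector)
qed

lemma translate_has_derivative:
  assumes "smooth \<phi>"
  shows "(translate s \<phi> has_vector_derivative translate s (derivative \<phi>) x) (at x)"
proof -
  have "((\<lambda>x. x + s) has_vector_derivative 1) (at x)"
    by (auto intro!: derivative_eq_intros)
  from vector_diff_chain_at[OF this smooth_has_derivative[OF assms]]
  show ?thesis by (simp add: translate_def o_def)
qed

lemma smooth_translate: "smooth \<phi> \<Longrightarrow> smooth (translate s \<phi>)"
  by (rule smooth_coinduct[where S = "translate s ` {\<psi>. smooth \<psi>}"])
     (auto intro: translate_has_derivative smooth_derivative)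

lemma continuous_supported_translate:
  assumes "continuous_supported a b \<phi>"
  shows "continuous_supported (a - s) (b - s) (translate s \<phi>)"
  using assms unfolding continuous_supported_def translate_def
  by (auto intro!: continuous_intros continuous_on_compose2[of UNIV \<phi>])

lemma continuous_supported_mono:
  "continuous_supported a b \<phi> \<Longrightarrow> a' \<le> a \<Longrightarrow> b \<le> b' \<Longrightarrow> continuous_supported a' b' \<phi>"
  by (auto simp: continuous_supported_def)

lemma continuous_supported_diff:
  "continuous_supported a b \<phi> \<Longrightarrow> continuous_supported a b \<psi> \<Longrightarrow> continuous_supported a b (\<phi> - \<psi>)"
  by (auto simp: continuous_supported_def fun_diff_def intro: continuous_on_diff)

lemma continuous_supported_scale:
  "continuous_supported a b \<phi> \<Longrightarrow> continuous_supported a b (fun_scale c \<phi>)"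
  by (auto simp: continuous_supported_def fun_scale_def intro: continuous_on_mult_left)

lemma continuous_supported_derivative:
  assumes sm: "smooth \<phi>" and \<phi>: "continuous_supported a b \<phi>"
  shows "continuous_supported a b (derivative \<phi>)"
  unfolding continuous_supported_def
proof (intro conjI allI impI)
  show "continuous_on UNIV (derivative \<phi>)" by (rule smooth_continuous[OF smooth_derivative[OF sm]])
  fix x assume x: "x \<notin> {a..b}"
  have "((\<lambda>_. 0) has_vector_derivative 0) (at x)" by (auto intro!: derivative_eq_intros)
  hence "(\<phi> has_vector_derivative 0) (at x)"
    by (rule has_vector_derivative_transform_within_open[where S = "- {a..b}"])
       (use x continuous_supported_outside[OF \<phi>] in \<open>auto simp: open_Compl\<close>)
  thus "derivative \<phi> x = 0" unfolding derivative_def by (rule vector_derivative_at)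
qed

lemma test_functionI:
  assumes "smooth \<phi>" "continuous_supported a b \<phi>" "{a..b} \<subseteq> \<Omega>"
  shows "\<phi> \<in> test_functions \<Omega>"
proof -
  have "closure {x. \<phi> x \<noteq> 0} \<subseteq> {a..b}"
    using continuous_supported_outside[OF assms(2)] by (intro closure_minimal closed_atLeastAtMost) blast
  moreover from this have "compact (closure {x. \<phi> x \<noteq> 0})"
    using compact_Int_closed[OF compact_Icc closed_closure] by (metis inf.absorb2)
  ultimately show ?thesis using assms by (auto simp: test_functions_def smooth_def)
qed

text \<open>
  The convex hull of the compact support still lies in the interval \<open>\<Omega>\<close>; for \<open>\<phi> = 0\<close> any point of \<open>\<Omega>\<close>
  serves as support.
\<close>

lemma test_functionE:
  assumes \<phi>: "\<phi> \<in> test_functions \<Omega>" and \<Omega>: "is_interval \<Omega>" "\<Omega> \<noteq> {}"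
  obtains a b where "smooth \<phi>" "continuous_supported a b \<phi>" "{a..b} \<subseteq> \<Omega>"
proof -
  let ?S = "closure {x. \<phi> x \<noteq> 0}"
  have sm: "smooth \<phi>" and S: "compact ?S" "?S \<subseteq> \<Omega>" using \<phi> by (auto simp: test_functions_def smooth_def)
  have "\<exists>a b. a \<in> \<Omega> \<and> b \<in> \<Omega> \<and> ?S \<subseteq> {a..b}"
  proof (cases "?S = {}")
    case True
    thus ?thesis using \<Omega> by auto
  next
    case False
    obtain a b where "a \<in> ?S" "b \<in> ?S" "\<forall>x\<in>?S. a \<le> x" "\<forall>x\<in>?S. x \<le> b"
      using compact_attains_inf[OF S(1) False] compact_attains_sup[OF S(1) False] by blast
    thus ?thesis using S(2) by (intro exI[of _ a] exI[of _ b]) auto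
  qed
  then obtain a b where ab: "a \<in> \<Omega>" "b \<in> \<Omega>" "?S \<subseteq> {a..b}" by blast
  have "{x. \<phi> x \<noteq> 0} \<subseteq> {a..b}" using ab(3) closure_subset by (rule order_trans[rotated])
  hence "continuous_supported a b \<phi>"
    using smooth_continuous[OF sm] by (auto simp: continuous_supported_def)
  moreover have "{a..b} \<subseteq> \<Omega>" using mem_is_interval_1_I[OF \<Omega>(1) ab(1,2)] by auto
  ultimately show ?thesis using that sm by blast
qed

lemma L1_norm_translate: "L1_norm (translate s \<phi>) = L1_norm \<phi>"
  using lborel_integral_real_affine[of 1 "\<lambda>y. norm (\<phi> y)" s]
  by (simp add: L1_norm_def translate_def add.commute)

lemma L1_norm_bound:
  assumes \<phi>: "continuous_supported a b \<phi>" and B: "\<And>x. norm (\<phi> x) \<le> B"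
  shows "L1_norm \<phi> \<le> B * measure lborel {a..b}"
proof -
  have "L1_norm \<phi> \<le> (LINT y|lborel. indicator {a..b} y * B)"
    unfolding L1_norm_def
  proof (rule integral_mono)
    show "integrable lborel (\<lambda>y. norm (\<phi> y))" by (intro integrable_norm integrable_supported[OF \<phi>])
    show "integrable lborel (\<lambda>y. indicator {a..b} y * B)"
      by (intro integrable_mult_left integrable_real_indicator) (auto simp: emeasure_lborel_Icc_eq)
    show "norm (\<phi> y) \<le> indicator {a..b} y * B" for y
      using B[of y] continuous_supported_outside[OF \<phi>, of y] by (auto simp: indicator_def)
  qed
  thus ?thesis by (simp add: mult.commute)
qed

lemma continuous_supported_bounded:
  assumes \<phi>: "continuous_supported a b \<phi>"
  obtains B where "B \<ge> 0" "\<And>x. norm (\<phi> x) \<le> B"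
proof -
  have "bounded (\<phi> ` {a..b})"
    using \<phi> unfolding continuous_supported_def
    by (intro compact_imp_bounded compact_continuous_image) (auto intro: continuous_on_subset)
  then obtain B where B: "B > 0" "\<And>x. x \<in> {a..b} \<Longrightarrow> norm (\<phi> x) \<le> B"
    unfolding bounded_pos by auto
  have "norm (\<phi> x) \<le> B" for x
    using B continuous_supported_outside[OF \<phi>, of x] by (cases "x \<in> {a..b}") auto
  thus ?thesis using that[of B] B(1) by simp
qed

text \<open>
  The mean value inequality, applied to \<open>\<phi>\<close> and to \<open>\<phi>'\<close>, bounds the remainder uniformly by a multiple
  of \<open>\<parallel>\<phi>''\<parallel>\<^sub>\<infinity> h\<^sup>2\<close>; the common compact support for \<open>\<bar>h\<bar> \<le> 1\<close> turns this into an \<open>L\<^sup>1\<close> bound.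
\<close>

lemma L1_norm_taylor:
  assumes sm: "smooth \<phi>" and \<phi>: "continuous_supported a b \<phi>"
  obtains M where "M \<ge> 0"
    "\<And>h. \<bar>h\<bar> \<le> 1 \<Longrightarrow> L1_norm (translate h \<phi> - \<phi> - fun_scale (of_real h) (derivative \<phi>)) \<le> M * h\<^sup>2"
proof -
  note sm1 = smooth_derivative[OF sm]
  obtain B where B: "B \<ge> 0" "\<And>x. norm (derivative (derivative \<phi>) x) \<le> B"
    using continuous_supported_bounded[OF continuous_supported_derivative[OF sm1
        continuous_supported_derivative[OF sm \<phi>]]] by metis
  \<comment> \<open>The linearized mean value inequality costs \<open>2 B\<close>, the linear term another \<open>B\<close>.\<close>
  have lip: "norm (derivative \<phi> x - derivative \<phi> y) \<le> 3 * B * \<bar>x - y\<bar>" for x y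
  proof -
    have "norm (derivative \<phi> x - derivative \<phi> y - (x - y) *\<^sub>R derivative (derivative \<phi>) y) \<le> norm (x - y) * (2 * B)"
    proof (rule vector_differentiable_bound_linearization[where S = UNIV])
      show "norm (derivative (derivative \<phi>) u - derivative (derivative \<phi>) y) \<le> 2 * B" for u
        using norm_triangle_ineq4[of "derivative (derivative \<phi>) u" "derivative (derivative \<phi>) y"] B(2)[of u] B(2)[of y]
        by linarith
    qed (auto intro: smooth_has_derivative[OF sm1])
    moreover have "norm ((x - y) *\<^sub>R derivative (derivative \<phi>) y) \<le> norm (x - y) * B"
      using B(2)[of y] by (simp add: mult_left_mono)
    ultimately have "norm (derivative \<phi> x - derivative \<phi> y) \<le> norm (x - y) * (2 * B) + norm (x - y) * B"
      using norm_triangle_sub[of "derivative \<phi> x - derivative \<phi> y" "(x - y) *\<^sub>R derivative (derivative \<phi>) y"]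
      by linarith
    thus ?thesis by (simp add: algebra_simps)
  qed
  define M where "M = 3 * B * measure lborel {a - 1..b + 1}"
  have "L1_norm (translate h \<phi> - \<phi> - fun_scale (of_real h) (derivative \<phi>)) \<le> M * h\<^sup>2" if h: "\<bar>h\<bar> \<le> 1" for h
  proof -
    have "L1_norm (translate h \<phi> - \<phi> - fun_scale (of_real h) (derivative \<phi>)) \<le> (3 * B * h\<^sup>2) * measure lborel {a - 1..b + 1}"
    proof (rule L1_norm_bound)
      show "continuous_supported (a - 1) (b + 1) (translate h \<phi> - \<phi> - fun_scale (of_real h) (derivative \<phi>))"
        using h
        by (intro continuous_supported_diff continuous_supported_scale
            continuous_supported_mono[OF \<phi>] continuous_supported_mono[OF continuous_supported_derivative[OF sm \<phi>]]
            continuous_supported_mono[OF continuous_supported_translate[OF \<phi>]]) auto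
      fix y
      have "norm (\<phi> (y + h) - \<phi> y - (y + h - y) *\<^sub>R derivative \<phi> y) \<le> norm (y + h - y) * (3 * B * \<bar>h\<bar>)"
      proof (rule vector_differentiable_bound_linearization[where S = "closed_segment y (y + h)"])
        fix x assume "x \<in> closed_segment y (y + h)"
        hence "\<bar>x - y\<bar> \<le> \<bar>h\<bar>" by (auto simp: closed_segment_eq_real_ivl split: if_splits)
        thus "norm (derivative \<phi> x - derivative \<phi> y) \<le> 3 * B * \<bar>h\<bar>"
          using B(1) by (intro order_trans[OF lip] mult_left_mono) auto
      qed (auto intro: has_vector_derivative_at_within smooth_has_derivative[OF sm])
      thus "norm ((translate h \<phi> - \<phi> - fun_scale (of_real h) (derivative \<phi>)) y) \<le> 3 * B * h\<^sup>2"
        by (simp add: translate_def fun_scale_def scaleR_conv_of_real power2_eq_square algebra_simps)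
    qed
    thus ?thesis by (simp add: M_def mult.assoc mult.commute mult.left_commute)
  qed
  moreover have "M \<ge> 0" using B(1) by (simp add: M_def)
  ultimately show ?thesis using that by blast
qed

text \<open>
  The derivative of \<open>exp (-1/t) / t\<^sup>k\<close> is a combination of the same functions with exponents
  \<open>k + 2\<close> and \<open>k + 1\<close>, and each of them tends to \<open>0\<close> at \<open>0\<close>.
\<close>

definition flat :: "nat \<Rightarrow> real \<Rightarrow> real"
  where "flat k t = (if t > 0 then exp (- 1 / t) / t ^ k else 0)"

lemma flat_tendsto_0: "(flat k \<longlongrightarrow> 0) (at 0)"
proof (rule filterlim_split_at)
  show "(flat k \<longlongrightarrow> 0) (at_left 0)"
    by (rule tendsto_eventually) (auto simp: flat_def eventually_at_filter)
  have "((\<lambda>t. inverse t ^ k / exp (inverse t)) \<longlongrightarrow> (0::real)) (at_right 0)"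
    by (rule filterlim_compose[OF tendsto_power_div_exp_0 filterlim_inverse_at_top_right])
  thus "(flat k \<longlongrightarrow> 0) (at_right 0)"
    by (rule Lim_transform_eventually)
       (auto simp: flat_def eventually_at_filter exp_minus power_inverse field_simps inverse_eq_divide)
qed

lemma flat_has_derivative:
  "(flat k has_real_derivative flat (k + 2) t - real k * flat (k + 1) t) (at t)"
proof -
  consider "t < 0" | "t = 0" | "t > 0" by linarith
  thus ?thesis
  proof cases
    case 1
    have "((\<lambda>_. 0) has_real_derivative 0) (at t)" by simp
    hence "(flat k has_real_derivative 0) (at t)"
      by (rule has_field_derivative_transform_within_open[where S = "{..<0}"]) (use 1 in \<open>auto simp: flat_def\<close>)
    thus ?thesis using 1 by (simp add: flat_def)
  next
    case 2
    have "(flat (k + 1) \<longlongrightarrow> 0) (at 0)" by (rule flat_tendsto_0)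
    hence "((\<lambda>h. (flat k (0 + h) - flat k 0) / h) \<longlongrightarrow> 0) (at 0)"
      by (rule Lim_transform_eventually) (auto simp: flat_def eventually_at_filter)
    thus ?thesis unfolding 2 DERIV_def by (simp add: flat_def)
  next
    case 3
    have "((\<lambda>t. exp (- 1 / t) / t ^ k) has_real_derivative
        (exp (- 1 / t) * (1 / t\<^sup>2) * t ^ k - exp (- 1 / t) * (real k * t ^ (k - 1))) / (t ^ k * t ^ k)) (at t)"
      using 3 by (auto intro!: derivative_eq_intros simp: power2_eq_square)
    also have "(exp (- 1 / t) * (1 / t\<^sup>2) * t ^ k - exp (- 1 / t) * (real k * t ^ (k - 1))) / (t ^ k * t ^ k) =
        flat (k + 2) t - real k * flat (k + 1) t"
      using 3 by (cases k) (auto simp: flat_def field_simps power2_eq_square)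
    finally have "((\<lambda>t. exp (- 1 / t) / t ^ k) has_real_derivative flat (k + 2) t - real k * flat (k + 1) t) (at t)" .
    thus ?thesis
      by (rule has_field_derivative_transform_within_open[where S = "{0<..}"]) (use 3 in \<open>auto simp: flat_def\<close>)
  qed
qed

text \<open>
  The span of products that vanish outside \<open>{a..b}\<close>; the product rule and \<open>flat_has_derivative\<close> keep it
  closed under differentiation.
\<close>

inductive_set bump_space :: "real \<Rightarrow> real \<Rightarrow> (real \<Rightarrow> real) set" for a b where
  product: "(\<lambda>x. flat k (x - a) * flat l (b - x)) \<in> bump_space a b"
| add: "f \<in> bump_space a b \<Longrightarrow> g \<in> bump_space a b \<Longrightarrow> (\<lambda>x. f x + g x) \<in> bump_space a b"
| scale: "f \<in> bump_space a b \<Longrightarrow> (\<lambda>x. c * f x) \<in> bump_space a b"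

lemma bump_space_derivative:
  "f \<in> bump_space a b \<Longrightarrow> \<exists>f'\<in>bump_space a b. \<forall>x. (f has_real_derivative f' x) (at x)"
proof (induction rule: bump_space.induct)
  case (product k l)
  let ?p = "\<lambda>k l x. flat k (x - a) * flat l (b - x)"
  let ?f' = "\<lambda>x. (?p (k + 2) l x + (- real k) * ?p (k + 1) l x) +
    ((- 1) * ?p k (l + 2) x + real l * ?p k (l + 1) x)"
  have "?f' \<in> bump_space a b" by (intro bump_space.intros)
  moreover have "(?p k l has_real_derivative ?f' x) (at x)" for x
  proof -
    have "((\<lambda>x. flat k (x - a)) has_real_derivative (flat (k + 2) (x - a) - real k * flat (k + 1) (x - a)) * 1) (at x)"
      by (rule DERIV_chain2[OF flat_has_derivative]) (auto intro!: derivative_eq_intros)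
    moreover have "((\<lambda>x. flat l (b - x)) has_real_derivative (flat (l + 2) (b - x) - real l * flat (l + 1) (b - x)) * (-1)) (at x)"
      by (rule DERIV_chain2[OF flat_has_derivative]) (auto intro!: derivative_eq_intros)
    ultimately show ?thesis
      by (rule DERIV_cong[OF DERIV_mult]) (simp add: algebra_simps)
  qed
  ultimately show ?case by (intro bexI[of _ ?f'] allI)
next
  case (add f g)
  then obtain f' g' where "f' \<in> bump_space a b" "g' \<in> bump_space a b"
    "\<And>x. (f has_real_derivative f' x) (at x)" "\<And>x. (g has_real_derivative g' x) (at x)" by blast
  thus ?case by (intro bexI[of _ "\<lambda>x. f' x + g' x"] allI DERIV_add bump_space.add) auto
next
  case (scale f c)
  then obtain f' where "f' \<in> bump_space a b" "\<And>x. (f has_real_derivative f' x) (at x)" by blast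
  thus ?case by (intro bexI[of _ "\<lambda>x. c * f' x"] allI DERIV_cmult bump_space.scale) auto
qed

lemma bump_space_smooth: "f \<in> bump_space a b \<Longrightarrow> smooth (\<lambda>x. of_real (f x))"
proof (rule smooth_coinduct[where S = "(\<lambda>f x. of_real (f x)) ` bump_space a b"])
  fix \<phi> :: "real \<Rightarrow> complex" assume "\<phi> \<in> (\<lambda>f x. of_real (f x)) ` bump_space a b"
  then obtain f where f: "f \<in> bump_space a b" "\<phi> = (\<lambda>x. of_real (f x))" by blast
  obtain f' where "f' \<in> bump_space a b" "\<forall>x. (f has_real_derivative f' x) (at x)"
    using bump_space_derivative[OF f(1)] by blast
  thus "\<exists>f'\<in>(\<lambda>f x. of_real (f x)) ` bump_space a b. \<forall>x. (\<phi> has_vector_derivative f' x) (at x)"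
    unfolding f(2) by (intro bexI[of _ "\<lambda>x. of_real (f' x)"]) (auto intro: has_vector_derivative_of_real)
qed auto

text \<open>
  The interval is enlarged so that it has nonempty interior, where a nonnegative continuous function
  with integral zero vanishes.
\<close>

lemma L1_norm_pos:
  assumes \<phi>: "continuous_supported a b \<phi>" and x: "\<phi> x \<noteq> 0"
  shows "L1_norm \<phi> > 0"
proof -
  have "L1_norm \<phi> \<noteq> 0"
  proof
    assume 0: "L1_norm \<phi> = 0"
    let ?I = "{a - 1..b + 1}"
    have xI: "x \<in> {a..b}" using x continuous_supported_outside[OF \<phi>] by blast
    have "((\<lambda>y. norm (\<phi> y)) has_integral 0) UNIV"
      using has_integral_integral_lborel[OF integrable_norm[OF integrable_supported[OF \<phi>]]] 0
      by (simp add: L1_norm_def)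
    moreover have "(\<lambda>y. if y \<in> ?I then norm (\<phi> y) else 0) = (\<lambda>y. norm (\<phi> y))"
      using continuous_supported_outside[OF \<phi>] by fastforce
    ultimately have "((\<lambda>y. norm (\<phi> y)) has_integral 0) ?I"
      using has_integral_restrict_UNIV[of ?I "\<lambda>y. norm (\<phi> y)" 0] by simp
    moreover have "continuous_on ?I (\<lambda>y. norm (\<phi> y))"
      using \<phi> unfolding continuous_supported_def by (auto intro: continuous_on_norm continuous_on_subset)
    ultimately have "norm (\<phi> x) = 0"
      using xI by (intro has_integral_0_cbox_imp_0[of "a - 1" "b + 1" "\<lambda>y. norm (\<phi> y)"]) auto
    thus False using x by simp
  qed
  thus ?thesis using L1_norm_nonneg[OF \<phi>] by linarith
qed

lemma bump_exists:
  assumes "a < b"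
  obtains \<phi> where "smooth \<phi>" "continuous_supported a b \<phi>" "L1_norm \<phi> = 1" "(LINT y|lborel. \<phi> y) = 1"
proof -
  define f where "f = (\<lambda>x. flat 0 (x - a) * flat 0 (b - x))"
  define \<psi> where "\<psi> = (\<lambda>x. complex_of_real (f x))"
  have f0: "f x \<ge> 0" for x by (simp add: f_def flat_def)
  have fB: "f \<in> bump_space a b" unfolding f_def by (rule bump_space.product)
  have sm: "smooth \<psi>" unfolding \<psi>_def by (rule bump_space_smooth[OF fB])
  have \<psi>: "continuous_supported a b \<psi>"
    using smooth_continuous[OF sm] by (auto simp: continuous_supported_def \<psi>_def f_def flat_def)
  have "\<psi> ((a + b) / 2) \<noteq> 0" using assms by (simp add: \<psi>_def f_def flat_def field_simps)
  hence L: "L1_norm \<psi> > 0" by (rule L1_norm_pos[OF \<psi>])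
  define c where "c = 1 / L1_norm \<psi>"
  define \<phi> where "\<phi> = (\<lambda>x. complex_of_real (c * f x))"
  have \<phi>\<psi>: "\<phi> x = of_real c * \<psi> x" for x by (simp add: \<phi>_def \<psi>_def)
  have "smooth \<phi>" unfolding \<phi>_def by (rule bump_space_smooth[OF bump_space.scale[OF fB]])
  moreover have \<phi>: "continuous_supported a b \<phi>"
    using continuous_supported_scale[OF \<psi>, of "of_real c"] by (simp add: fun_scale_def \<phi>\<psi>[symmetric])
  moreover have L1: "L1_norm \<phi> = 1"
  proof -
    have "norm (\<phi> y) = c * norm (\<psi> y)" for y using L by (simp add: \<phi>\<psi> norm_divide c_def)
    hence "L1_norm \<phi> = c * L1_norm \<psi>" by (simp add: L1_norm_def)
    thus ?thesis using L by (simp add: c_def)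
  qed
  moreover have "(LINT y|lborel. \<phi> y) = 1"
  proof -
    have "\<phi> y = complex_of_real (norm (\<phi> y))" for y using f0[of y] L unfolding \<phi>_def norm_of_real by (simp add: c_def)
    hence "(LINT y|lborel. \<phi> y) = (LINT y|lborel. complex_of_real (norm (\<phi> y)))" by metis
    also have "\<dots> = complex_of_real (L1_norm \<phi>)" unfolding L1_norm_def by (rule integral_complex_of_real)
    finally show ?thesis using L1 by simp
  qed
  ultimately show ?thesis using that by blast
qed

section \<open>From an extension to a unitary group\<close>

text \<open>
  The bound \<open>\<parallel>F\<^sub>\<phi>\<parallel> \<le> F(0)\<^sup>1\<^sup>/\<^sup>2 \<parallel>\<phi>\<parallel>\<^sub>1\<close> turns the Taylor expansion of \<open>\<phi>\<close> into one of the translation flow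
  on smeared vectors, as long as the translated support stays in \<open>\<Omega>\<close>.
\<close>

lemma smear_taylor:
  assumes pd: "positive_definite_on \<Omega> F" and F: "continuous_on (difference_set \<Omega>) F"
    and sm: "smooth \<phi>" and \<phi>: "continuous_supported a b \<phi>"
  obtains C where "\<And>h. \<lbrakk>\<bar>h\<bar> \<le> 1; {min a (a - h)..max b (b - h)} \<subseteq> \<Omega>\<rbrakk> \<Longrightarrow>
    hnorm (rkhs_ip \<Omega> F) (smear \<Omega> F (translate h \<phi>) - smear \<Omega> F \<phi> - fun_scale (of_real h) (smear \<Omega> F (derivative \<phi>)))
      \<le> C * h\<^sup>2"
proof -
  obtain M where M: "M \<ge> 0"
    "\<And>h. \<bar>h\<bar> \<le> 1 \<Longrightarrow> L1_norm (translate h \<phi> - \<phi> - fun_scale (of_real h) (derivative \<phi>)) \<le> M * h\<^sup>2"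
    using L1_norm_taylor[OF sm \<phi>] by blast
  have "hnorm (rkhs_ip \<Omega> F) (smear \<Omega> F (translate h \<phi>) - smear \<Omega> F \<phi> - fun_scale (of_real h) (smear \<Omega> F (derivative \<phi>)))
      \<le> \<bar>sqrt (Re (F 0))\<bar> * M * h\<^sup>2"
    if h: "\<bar>h\<bar> \<le> 1" and sub: "{min a (a - h)..max b (b - h)} \<subseteq> \<Omega>" for h
  proof -
    let ?a = "min a (a - h)" and ?b = "max b (b - h)"
    have 1: "continuous_supported ?a ?b (translate h \<phi>)"
      by (rule continuous_supported_mono[OF continuous_supported_translate[OF \<phi>]]) auto
    have 2: "continuous_supported ?a ?b \<phi>"
      by (rule continuous_supported_mono[OF \<phi>]) auto
    have 3: "continuous_supported ?a ?b (fun_scale (of_real h) (derivative \<phi>))"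
      by (rule continuous_supported_scale[OF continuous_supported_mono[OF continuous_supported_derivative[OF sm \<phi>]]]) auto
    note 12 = continuous_supported_diff[OF 1 2]
    let ?r = "translate h \<phi> - \<phi> - fun_scale (of_real h) (derivative \<phi>)"
    have eq: "smear \<Omega> F (translate h \<phi>) - smear \<Omega> F \<phi> - fun_scale (of_real h) (smear \<Omega> F (derivative \<phi>)) = smear \<Omega> F ?r"
      by (simp only: smear_diff[OF 12 3 sub F] smear_diff[OF 1 2 sub F] smear_scale)
    have "hnorm (rkhs_ip \<Omega> F) (smear \<Omega> F ?r) \<le> sqrt (Re (F 0)) * L1_norm ?r"
      by (rule smear_hnorm_bound[OF continuous_supported_diff[OF 12 3] sub F pd])
    also have "\<dots> \<le> \<bar>sqrt (Re (F 0))\<bar> * (M * h\<^sup>2)"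
      by (intro mult_mono M(2)[OF h] L1_norm_nonneg[OF continuous_supported_diff[OF 12 3]]) simp_all
    finally show ?thesis by (simp only: eq mult.assoc)
  qed
  thus ?thesis using that by blast
qed

context complex_hilbert_space
begin

lemma difference_quotient_carrier:
  "\<lbrakk>unitary_group sc K ip U; k \<in> K\<rbrakk> \<Longrightarrow> sc c (U t k - k) \<in> K"
  by (auto simp: unitary_group_def unitary_op_def linear_isometry_def intro!: carrier_scale carrier_diff)

lemma generator_eqI:
  assumes U: "unitary_group sc K ip U" and k: "k \<in> K" and l: "generates_at sc K ip U k l"
  shows "k \<in> generator_dom sc K ip U" "generator sc K ip U k = l"
proof -
  show "k \<in> generator_dom sc K ip U" using k l by (auto simp: generator_dom_def)
  show "generator sc K ip U k = l" unfolding generator_def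
  proof (rule the_equality)
    show "generates_at sc K ip U k l" by (rule l)
    fix l' assume l': "generates_at sc K ip U k l'"
    show "l' = l"
      by (rule hlim_unique[OF l'[unfolded generates_at_def] l[unfolded generates_at_def]
            difference_quotient_carrier[OF U k]]) simp
  qed
qed

lemma generates_at_generator:
  assumes U: "unitary_group sc K ip U" and k: "k \<in> generator_dom sc K ip U"
  shows "generates_at sc K ip U k (generator sc K ip U k)"
proof -
  obtain l where "k \<in> K" "generates_at sc K ip U k l" using k by (auto simp: generator_dom_def)
  thus ?thesis using generator_eqI(2)[OF U] by metis
qed

end

context
  fixes G :: "real \<Rightarrow> complex"
  assumes pd: "positive_definite_on UNIV G"
begin

lemma sum_translate:
  "(\<Sum>x | translate s c x \<noteq> 0. f (c (x + s)) x) = (\<Sum>y | c y \<noteq> 0. f (c y) (y - s))"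
  by (rule sum.reindex_bij_witness[where i = "\<lambda>y. y - s" and j = "\<lambda>x. x + s"]) (auto simp: translate_def)

lemma translate_coefficients:
  assumes "c \<in> coefficients UNIV"
  shows "translate s c \<in> coefficients UNIV"
proof -
  have "{x. translate s c x \<noteq> 0} = (\<lambda>y. y - s) ` {y. c y \<noteq> 0}"
    by (auto simp: translate_def image_iff intro!: exI[of _ "_ + s"])
  thus ?thesis using assms by (simp add: coefficients_def)
qed

lemma span_fun_translate: "span_fun UNIV G (translate s c) = translate s (span_fun UNIV G c)"
proof
  fix z
  have "span_fun UNIV G (translate s c) z = (\<Sum>x | translate s c x \<noteq> 0. c (x + s) * G (z - x))"
    by (simp add: span_fun_def translate_def)
  also have "\<dots> = (\<Sum>y | c y \<noteq> 0. c y * G (z - (y - s)))"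
    by (rule sum_translate[where f = "\<lambda>v x. v * G (z - x)"])
  finally show "span_fun UNIV G (translate s c) z = translate s (span_fun UNIV G c) z"
    by (simp add: span_fun_def translate_def algebra_simps)
qed

lemma span_ip_translate:
  "span_ip G (translate s c) (translate t d) =
    (\<Sum>x | c x \<noteq> 0. \<Sum>y | d y \<noteq> 0. cnj (c x) * d y * G ((x - s) - (y - t)))"
proof -
  have "span_ip G (translate s c) (translate t d) =
      (\<Sum>x | translate s c x \<noteq> 0. \<Sum>y | translate t d y \<noteq> 0. cnj (c (x + s)) * d (y + t) * G (x - y))"
    by (simp add: span_ip_def translate_def)
  also have "\<dots> = (\<Sum>x | translate s c x \<noteq> 0. \<Sum>y | d y \<noteq> 0. cnj (c (x + s)) * d y * G (x - (y - t)))"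
    by (intro sum.cong refl sum_translate[where f = "\<lambda>v y. cnj (c (x + s)) * v * G (x - y)" for x])
  also have "\<dots> = (\<Sum>x | c x \<noteq> 0. \<Sum>y | d y \<noteq> 0. cnj (c x) * d y * G ((x - s) - (y - t)))"
    by (rule sum_translate[where f = "\<lambda>v x. \<Sum>y | d y \<noteq> 0. cnj v * d y * G (x - (y - t))"])
  finally show ?thesis .
qed

lemma span_ip_translate_same: "span_ip G (translate s c) (translate s d) = span_ip G c d"
  unfolding span_ip_translate by (simp add: span_ip_def)

lemma represents_translate:
  assumes "represents UNIV G c f"
  shows "represents UNIV G (\<lambda>n. translate s (c n)) (translate s f)"
proof -
  have "translate s p - translate s q = translate s (p - q)" for p q
    by (auto simp: translate_def)
  thus ?thesis using assms
    unfolding represents_def hcauchy_def hnorm_def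
    by (simp add: span_ip_translate_same span_fun_translate translate_coefficients)
       (simp add: translate_def)
qed

lemma translate_rkhs: "f \<in> rkhs UNIV G \<Longrightarrow> translate s f \<in> rkhs UNIV G"
  using represents_translate by (auto simp: rkhs_def)

lemma translate_hnorm:
  assumes "f \<in> rkhs UNIV G"
  shows "hnorm (rkhs_ip UNIV G) (translate s f) = hnorm (rkhs_ip UNIV G) f"
proof -
  obtain c where c: "represents UNIV G c f" using assms by (auto simp: rkhs_def)
  have eq: "hnorm (span_ip G) (translate s (c n)) = hnorm (span_ip G) (c n)" for n
    by (simp add: hnorm_def span_ip_translate_same)
  show ?thesis
    using rkhs_hnorm_limit[OF pd represents_translate[OF c, of s]] rkhs_hnorm_limit[OF pd c]
    unfolding eq by (rule LIMSEQ_unique)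
qed

lemma translate_linear:
  "translate s (f + g) = translate s f + translate s g"
  "translate s (f - g) = translate s f - translate s g"
  "translate s (fun_scale a f) = fun_scale a (translate s f)"
  by (auto simp: translate_def fun_scale_def)

lemma translate_unitary: "unitary_op fun_scale (rkhs UNIV G) (rkhs_ip UNIV G) (translate s)"
proof -
  have "f = translate s (translate (- s) f)" for f by (simp add: translate_def)
  hence "translate s ` rkhs UNIV G = rkhs UNIV G"
    using translate_rkhs by (auto simp: image_iff)
  thus ?thesis
    by (auto simp: unitary_op_def linear_isometry_def translate_hnorm translate_linear)
qed

text \<open>
  On the span, \<open>\<parallel>U\<^sub>t c - U\<^sub>s c\<parallel>\<^sup>2\<close> is a finite combination of values of \<open>G\<close>; density and isometry carry
  strong continuity over to the whole space.
\<close>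

lemma translate_strongly_continuous:
  assumes G: "continuous_on UNIV G" and f: "f \<in> rkhs UNIV G"
  shows "hlim (rkhs UNIV G) (rkhs_ip UNIV G) (\<lambda>t. translate t f) (translate s f) (at s)"
proof -
  interpret H: complex_hilbert_space fun_scale "rkhs UNIV G" "rkhs_ip UNIV G"
    by (rule rkhs_hilbert_space[OF pd])
  let ?n = "hnorm (rkhs_ip UNIV G)"
  have "((\<lambda>t. ?n (translate t f - translate s f)) \<longlongrightarrow> 0) (at s)"
  proof (rule tendstoI)
    fix e :: real assume e: "e > 0"
    obtain c where c: "c \<in> coefficients UNIV" "?n (f - span_fun UNIV G c) < e / 3"
      using rkhs_span_dense[OF pd f, of "e / 3"] e by auto
    let ?g = "span_fun UNIV G c"
    have g: "?g \<in> rkhs UNIV G" by (rule span_fun_rkhs[OF c(1)])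
    have ip: "rkhs_ip UNIV G (translate t ?g) (translate s ?g) = span_ip G (translate t c) (translate s c)" for t
      unfolding span_fun_translate[symmetric]
      by (intro rkhs_ip_span_fun[OF pd] translate_coefficients c(1))
    have n: "(?n (translate t ?g))\<^sup>2 = Re (span_ip G c c)" for t
      by (simp add: translate_hnorm g H.hnorm_square rkhs_ip_span_fun[OF pd c(1) c(1)])
    have sq: "(?n (translate t ?g - translate s ?g))\<^sup>2 =
        2 * Re (span_ip G c c) - 2 * Re (span_ip G (translate t c) (translate s c))" for t
      by (simp add: H.hnorm_diff_square translate_rkhs g ip n)
    have "((\<lambda>t. span_ip G (translate t c) (translate s c)) \<longlongrightarrow> span_ip G (translate s c) (translate s c)) (at s)"
      unfolding span_ip_translate
      by (intro tendsto_intros isCont_tendsto_compose[of _ G]) (use G in \<open>auto simp: continuous_on_eq_continuous_at\<close>)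
    hence "((\<lambda>t. 2 * Re (span_ip G c c) - 2 * Re (span_ip G (translate t c) (translate s c)))
        \<longlongrightarrow> 2 * Re (span_ip G c c) - 2 * Re (span_ip G c c)) (at s)"
      unfolding span_ip_translate_same by (intro tendsto_intros)
    hence "((\<lambda>t. (?n (translate t ?g - translate s ?g))\<^sup>2) \<longlongrightarrow> 0) (at s)" by (simp add: sq)
    hence "\<forall>\<^sub>F t in at s. (?n (translate t ?g - translate s ?g))\<^sup>2 < (e / 3)\<^sup>2"
      by (rule order_tendstoD(2)) (use e in simp)
    thus "\<forall>\<^sub>F t in at s. dist (?n (translate t f - translate s f)) 0 < e"
    proof eventually_elim
      case (elim t)
      have "?n (translate t ?g - translate s ?g) < e / 3"
        by (rule power_less_imp_less_base[OF elim]) (use e in simp)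
      moreover have "?n (translate t f - translate s f) \<le>
          ?n (translate t f - translate t ?g) + (?n (translate t ?g - translate s ?g) + ?n (translate s ?g - translate s f))"
        using H.hnorm_triangle_diff[of "translate t f" "translate t ?g" "translate s f"]
          H.hnorm_triangle_diff[of "translate t ?g" "translate s ?g" "translate s f"]
        by (simp add: translate_rkhs f g)
      moreover have "?n (translate t f - translate t ?g) = ?n (f - ?g)"
        unfolding translate_linear(2)[symmetric] by (rule translate_hnorm[OF H.carrier_diff[OF f g]])
      moreover have "?n (translate s ?g - translate s f) = ?n (f - ?g)"
        unfolding translate_linear(2)[symmetric] translate_hnorm[OF H.carrier_diff[OF g f]]
        by (rule H.hnorm_minus[OF g f])
      moreover have "0 \<le> ?n (translate t f - translate s f)"
        by (intro H.hnorm_nonneg H.carrier_diff translate_rkhs f)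
      ultimately show ?case using c(2) by simp
    qed
  qed
  thus ?thesis using translate_rkhs[OF f] by (simp add: hlim_def)
qed

lemma translate_unitary_group:
  assumes "continuous_on UNIV G"
  shows "unitary_group fun_scale (rkhs UNIV G) (rkhs_ip UNIV G) translate"
  using translate_unitary translate_strongly_continuous[OF assms]
  by (auto simp: unitary_group_def translate_def algebra_simps)

lemma smear_translate:
  "smear UNIV G (translate t \<phi>) = translate t (smear UNIV G \<phi>)"
proof
  fix x
  show "smear UNIV G (translate t \<phi>) x = translate t (smear UNIV G \<phi>) x"
    using lborel_integral_real_affine[of 1 "\<lambda>y. \<phi> y * G (x + t - y)" t]
    by (simp add: smear_def translate_def set_lebesgue_integral_def algebra_simps)
qed

text \<open>By \<open>smear_taylor\<close> the difference quotient deviates from its limit by \<open>O(t)\<close>.\<close>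

lemma translate_generator:
  assumes G: "continuous_on UNIV G" and sm: "smooth \<phi>" and \<phi>: "continuous_supported a b \<phi>"
  shows "generates_at fun_scale (rkhs UNIV G) (rkhs_ip UNIV G) translate
    (smear UNIV G \<phi>) (smear UNIV G (derivative \<phi>))"
proof -
  interpret H: complex_hilbert_space fun_scale "rkhs UNIV G" "rkhs_ip UNIV G"
    by (rule rkhs_hilbert_space[OF pd])
  let ?n = "hnorm (rkhs_ip UNIV G)"
  define k l where "k = smear UNIV G \<phi>" and "l = smear UNIV G (derivative \<phi>)"
  have G': "continuous_on (difference_set UNIV) G" using G by (rule continuous_on_subset) simp
  have k: "k \<in> rkhs UNIV G" unfolding k_def by (rule smear_rkhs[OF \<phi> _ G' pd]) simp
  have l: "l \<in> rkhs UNIV G" unfolding l_def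
    by (rule smear_rkhs[OF continuous_supported_derivative[OF sm \<phi>] _ G' pd]) simp
  obtain C where C: "\<And>h. \<bar>h\<bar> \<le> 1 \<Longrightarrow> ?n (translate h k - k - fun_scale (of_real h) l) \<le> C * h\<^sup>2"
    using smear_taylor[OF pd G' sm \<phi>] unfolding smear_translate k_def l_def by (metis subset_UNIV)
  have "((\<lambda>t. ?n (fun_scale (of_real (1 / t)) (translate t k - k) - l)) \<longlongrightarrow> 0) (at 0)"
  proof (rule Lim_null_comparison)
    show "((\<lambda>t. C * \<bar>t\<bar>) \<longlongrightarrow> 0) (at 0)" by (auto intro!: tendsto_eq_intros)
    have "\<forall>\<^sub>F t in at (0::real). dist t 0 < 1" unfolding eventually_at by (intro exI[of _ 1]) auto
    thus "\<forall>\<^sub>F t in at 0. norm (?n (fun_scale (of_real (1 / t)) (translate t k - k) - l)) \<le> C * \<bar>t\<bar>"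
      using eventually_neq_at_within[of "0::real" 0 UNIV]
    proof eventually_elim
      case (elim t)
      let ?v = "translate t k - k - fun_scale (of_real t) l"
      have v: "?v \<in> rkhs UNIV G" by (intro H.carrier_diff H.carrier_scale translate_rkhs k l)
      have "fun_scale (of_real (1 / t)) (translate t k - k) - l = fun_scale (of_real (1 / t)) ?v"
        using elim by (auto simp: fun_scale_def field_simps)
      hence "?n (fun_scale (of_real (1 / t)) (translate t k - k) - l) = ?n ?v / \<bar>t\<bar>"
        using H.hnorm_scale[OF v] by (simp add: norm_divide)
      also have "\<dots> \<le> C * t\<^sup>2 / \<bar>t\<bar>" using C[of t] elim by (intro divide_right_mono) auto
      also have "\<dots> = C * \<bar>t\<bar>" using elim by (simp add: power2_eq_square field_simps)
      finally show ?case using H.hnorm_nonneg[OF H.carrier_diff[OF H.carrier_scale[OF H.carrier_diff[OF translate_rkhs[OF k] k]] l]]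
        by simp
    qed
  qed
  thus ?thesis using l unfolding generates_at_def hlim_def k_def l_def by blast
qed

end

text \<open>
  The isometry into the space of an extension \<open>G\<close>: a vector is sent to the limit that the same
  coefficients have with respect to \<open>G\<close>. It does not depend on the chosen coefficients, since two
  choices differ by a sequence that is null in norm.
\<close>

definition extend_vector ::
  "real set \<Rightarrow> (real \<Rightarrow> complex) \<Rightarrow> (real \<Rightarrow> complex) \<Rightarrow> (real \<Rightarrow> complex) \<Rightarrow> real \<Rightarrow> complex"
  where "extend_vector \<Omega> F G f = (SOME g. \<exists>c. represents \<Omega> F c f \<and> represents UNIV G c g)"

lemma represents_functional: "represents \<Omega> F c f \<Longrightarrow> represents \<Omega> F c g \<Longrightarrow> f = g"
  unfolding represents_def by (intro ext) (blast intro: LIMSEQ_unique)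

context
  fixes \<Omega> :: "real set" and F G :: "real \<Rightarrow> complex"
  assumes pdF: "positive_definite_on \<Omega> F" and pdG: "positive_definite_on UNIV G"
    and FG: "\<And>x. x \<in> difference_set \<Omega> \<Longrightarrow> G x = F x"
begin

lemma span_ip_extension:
  assumes "c \<in> coefficients \<Omega>" "d \<in> coefficients \<Omega>"
  shows "span_ip G c d = span_ip F c d"
  unfolding span_ip_def using assms
  by (intro sum.cong refl) (auto simp: coefficients_def FG difference_setI subset_iff)

lemma coefficients_UNIV: "c \<in> coefficients \<Omega> \<Longrightarrow> c \<in> coefficients UNIV"
  by (simp add: coefficients_def)

lemma represents_extend_vector:
  assumes c: "represents \<Omega> F c f"
  shows "represents UNIV G c (extend_vector \<Omega> F G f)"
proof -
  have ex: "\<exists>g. represents UNIV G c g" if "represents \<Omega> F c f" for c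
  proof (rule represents_exists[OF pdG])
    note co = represents_coefficients[OF that]
    show "c n \<in> coefficients UNIV" for n by (rule coefficients_UNIV[OF co])
    show "hcauchy (span_ip G) c"
      using that co coefficients_closed(2)[OF co co]
      by (simp add: represents_def hcauchy_def hnorm_def span_ip_extension)
  qed
  have "\<exists>g c. represents \<Omega> F c f \<and> represents UNIV G c g" using ex[OF c] c by blast
  hence "\<exists>c. represents \<Omega> F c f \<and> represents UNIV G c (extend_vector \<Omega> F G f)"
    unfolding extend_vector_def by (rule someI_ex)
  then obtain c' where c': "represents \<Omega> F c' f" "represents UNIV G c' (extend_vector \<Omega> F G f)" by blast
  obtain g where g: "represents UNIV G c g" using ex[OF c] by blast
  interpret H: complex_hilbert_space fun_scale "rkhs UNIV G" "rkhs_ip UNIV G"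
    by (rule rkhs_hilbert_space[OF pdG])
  let ?g = "extend_vector \<Omega> F G f"
  have gK: "g \<in> rkhs UNIV G" "?g \<in> rkhs UNIV G" using g c'(2) by (auto simp: rkhs_def)
  have "hnorm (span_ip G) (c n - c' n) = hnorm (span_ip F) (c n - c' n)" for n
    using coefficients_closed(2)[OF represents_coefficients[OF c] represents_coefficients[OF c'(1)]]
    by (simp add: hnorm_def span_ip_extension)
  hence "(\<lambda>n. hnorm (span_ip G) (c n - c' n)) \<longlonglongrightarrow> 0"
    using represents_unique[OF pdF c c'(1)] by simp
  hence "hnorm (rkhs_ip UNIV G) (g - ?g) = 0"
    using rkhs_hnorm_limit[OF pdG represents_diff[OF pdG g c'(2)]] by (blast intro: LIMSEQ_unique)
  hence "g = ?g" using H.hnorm_eq_0_iff[OF H.carrier_diff[OF gK]] by simp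
  thus ?thesis using g by simp
qed

lemma extend_vector_isometry:
  "linear_isometry fun_scale (rkhs \<Omega> F) (rkhs_ip \<Omega> F)
    fun_scale (rkhs UNIV G) (rkhs_ip UNIV G) (extend_vector \<Omega> F G)"
  unfolding linear_isometry_def
proof (intro conjI ballI allI)
  let ?W = "extend_vector \<Omega> F G"
  show "?W ` rkhs \<Omega> F \<subseteq> rkhs UNIV G"
    using represents_extend_vector by (auto simp: rkhs_def)
  fix f assume "f \<in> rkhs \<Omega> F"
  then obtain c where c: "represents \<Omega> F c f" by (auto simp: rkhs_def)
  show "?W (fun_scale a f) = fun_scale a (?W f)" for a
    by (rule represents_functional[OF represents_extend_vector[OF represents_scale[OF c]]
          represents_scale[OF represents_extend_vector[OF c]]])
  have eq: "hnorm (span_ip G) (c n) = hnorm (span_ip F) (c n)" for n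
    using represents_coefficients[OF c] by (simp add: hnorm_def span_ip_extension)
  show "hnorm (rkhs_ip UNIV G) (?W f) = hnorm (rkhs_ip \<Omega> F) f"
    using rkhs_hnorm_limit[OF pdG represents_extend_vector[OF c]] rkhs_hnorm_limit[OF pdF c]
    unfolding eq by (rule LIMSEQ_unique)
  fix g assume "g \<in> rkhs \<Omega> F"
  then obtain d where d: "represents \<Omega> F d g" by (auto simp: rkhs_def)
  show "?W (f + g) = ?W f + ?W g"
    by (rule represents_functional[OF represents_extend_vector[OF represents_add[OF pdF c d]]
          represents_add[OF pdG represents_extend_vector[OF c] represents_extend_vector[OF d]]])
qed

text \<open>The approximating coefficients \<open>cell_masses a \<phi>\<close> depend on \<open>\<phi>\<close> alone, not on the kernel.\<close>

lemma extend_vector_smear: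
  assumes "continuous_on (difference_set \<Omega>) F" and G: "continuous_on UNIV G"
    and \<phi>: "continuous_supported a b \<phi>" and "{a..b} \<subseteq> \<Omega>"
  shows "extend_vector \<Omega> F G (smear \<Omega> F \<phi>) = smear UNIV G \<phi>"
proof (rule represents_functional)
  show "represents UNIV G (cell_masses a \<phi>) (extend_vector \<Omega> F G (smear \<Omega> F \<phi>))"
    by (intro represents_extend_vector cell_masses_represents[OF \<phi>] assms pdF)
  show "represents UNIV G (cell_masses a \<phi>) (smear UNIV G \<phi>)"
    by (intro cell_masses_represents[OF \<phi>] pdG continuous_on_subset[OF G]) auto
qed

end

theorem extension_group_realization:
  assumes \<Omega>: "is_interval \<Omega>" "\<Omega> \<noteq> {}"
    and F: "continuous_on (difference_set \<Omega>) F" "positive_definite_on \<Omega> F"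
    and G: "continuous_on UNIV G" "positive_definite_on UNIV G"
    and FG: "\<And>x. x \<in> difference_set \<Omega> \<Longrightarrow> G x = F x"
  shows "group_realization \<Omega> F fun_scale (rkhs UNIV G) (rkhs_ip UNIV G) (extend_vector \<Omega> F G) translate"
  unfolding group_realization_def
proof (intro conjI ballI)
  interpret H: complex_hilbert_space fun_scale "rkhs UNIV G" "rkhs_ip UNIV G"
    by (rule rkhs_hilbert_space[OF G(2)])
  show "complex_hilbert_space fun_scale (rkhs UNIV G) (rkhs_ip UNIV G)"
    by (rule rkhs_hilbert_space[OF G(2)])
  show "linear_isometry fun_scale (rkhs \<Omega> F) (rkhs_ip \<Omega> F) fun_scale (rkhs UNIV G) (rkhs_ip UNIV G) (extend_vector \<Omega> F G)"
    by (rule extend_vector_isometry[OF F(2) G(2) FG])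
  show U: "unitary_group fun_scale (rkhs UNIV G) (rkhs_ip UNIV G) translate"
    by (rule translate_unitary_group[OF G(2,1)])
  fix \<phi> assume "\<phi> \<in> test_functions \<Omega>"
  then obtain a b where sm: "smooth \<phi>" and \<phi>: "continuous_supported a b \<phi>" and ab: "{a..b} \<subseteq> \<Omega>"
    using test_functionE \<Omega> by blast
  have W: "extend_vector \<Omega> F G (smear \<Omega> F \<phi>) = smear UNIV G \<phi>"
    "extend_vector \<Omega> F G (smear \<Omega> F (derivative \<phi>)) = smear UNIV G (derivative \<phi>)"
    using extend_vector_smear[OF F(2) G(2) FG F(1) G(1) _ ab] \<phi> continuous_supported_derivative[OF sm \<phi>]
    by auto
  have k: "smear UNIV G \<phi> \<in> rkhs UNIV G"
    by (rule smear_rkhs[OF \<phi> _ continuous_on_subset[OF G(1)] G(2)]) auto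
  note gen = H.generator_eqI[OF U k translate_generator[OF G(2,1) sm \<phi>]]
  show "extend_vector \<Omega> F G (smear \<Omega> F \<phi>) \<in> generator_dom fun_scale (rkhs UNIV G) (rkhs_ip UNIV G) translate"
    "generator fun_scale (rkhs UNIV G) (rkhs_ip UNIV G) translate (extend_vector \<Omega> F G (smear \<Omega> F \<phi>)) =
      extend_vector \<Omega> F G (smear \<Omega> F (derivative \<phi>))"
    unfolding W by (rule gen)+
qed

section \<open>From a unitary group to an extension\<close>

abbreviation kernel_vector :: "real set \<Rightarrow> (real \<Rightarrow> complex) \<Rightarrow> real \<Rightarrow> real \<Rightarrow> complex"
  where "kernel_vector \<Omega> F x \<equiv> (\<lambda>z. if z \<in> \<Omega> then F (z - x) else 0)"

lemma kernel_vector_rkhs: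
  "\<lbrakk>positive_definite_on \<Omega> F; x \<in> \<Omega>\<rbrakk> \<Longrightarrow> kernel_vector \<Omega> F x \<in> rkhs \<Omega> F"
  using represents_kernel by (auto simp: rkhs_def)

text \<open>
  For an approximate identity \<open>\<phi>\<close> at \<open>x\<close>, \<open>\<parallel>F\<^sub>\<phi> - k\<^sub>x\<parallel>\<^sup>2 \<le> 2 F(0) - 2 Re F\<^sub>\<phi>(x)\<close> by the norm bound and the
  reproducing property, and \<open>F\<^sub>\<phi>(x) \<rightarrow> F(0)\<close> by continuity of \<open>F\<close> at \<open>0\<close>.
\<close>

lemma smear_approximates_kernel:
  assumes pd: "positive_definite_on \<Omega> F" and F: "continuous_on (difference_set \<Omega>) F"
    and "\<Omega> \<noteq> {}" and e: "e > 0"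
  obtains d where "d > 0" "\<And>x r \<phi>. \<lbrakk>0 < r; r \<le> d; {x - r..x + r} \<subseteq> \<Omega>; continuous_supported (x - r) (x + r) \<phi>;
      L1_norm \<phi> = 1; (LINT y|lborel. \<phi> y) = 1\<rbrakk>
    \<Longrightarrow> hnorm (rkhs_ip \<Omega> F) (smear \<Omega> F \<phi> - kernel_vector \<Omega> F x) \<le> e"
proof -
  interpret H: complex_hilbert_space fun_scale "rkhs \<Omega> F" "rkhs_ip \<Omega> F"
    by (rule rkhs_hilbert_space[OF pd])
  obtain x0 where x0: "x0 \<in> \<Omega>" using \<open>\<Omega> \<noteq> {}\<close> by blast
  have F0: "0 \<le> Re (F 0)" by (rule positive_definite_bound(2)[OF pd x0 x0])
  have "0 \<in> difference_set \<Omega>" using difference_setI[OF x0 x0] by simp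
  moreover have e2: "e\<^sup>2 / 2 > 0" using e by simp
  ultimately obtain d where d: "d > 0"
    and dF: "\<And>u. \<lbrakk>u \<in> difference_set \<Omega>; dist u 0 < d\<rbrakk> \<Longrightarrow> dist (F u) (F 0) < e\<^sup>2 / 2"
    using F unfolding continuous_on_iff by blast
  have "hnorm (rkhs_ip \<Omega> F) (smear \<Omega> F \<phi> - kernel_vector \<Omega> F x) \<le> e"
    if r: "0 < r" "r \<le> d / 2" and sub: "{x - r..x + r} \<subseteq> \<Omega>"
      and \<phi>: "continuous_supported (x - r) (x + r) \<phi>" and L1: "L1_norm \<phi> = 1" and int: "(LINT y|lborel. \<phi> y) = 1"
    for x r \<phi>
  proof -
    have x: "x \<in> \<Omega>" using sub r by auto
    let ?f = "smear \<Omega> F \<phi>" and ?k = "kernel_vector \<Omega> F x" and ?n = "hnorm (rkhs_ip \<Omega> F)"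
    have f: "?f \<in> rkhs \<Omega> F" by (rule smear_rkhs[OF \<phi> sub F pd])
    have k: "?k \<in> rkhs \<Omega> F" by (rule kernel_vector_rkhs[OF pd x])
    have "?n ?f \<le> sqrt (Re (F 0))" using smear_hnorm_bound[OF \<phi> sub F pd] L1 by simp
    hence nf: "(?n ?f)\<^sup>2 \<le> Re (F 0)"
      using power_mono[of "?n ?f" "sqrt (Re (F 0))" 2] H.hnorm_nonneg[OF f] F0 by simp
    have nk: "(?n ?k)\<^sup>2 = Re (F 0)" using rkhs_ip_kernel[OF pd x x] by (simp add: H.hnorm_square[OF k])
    have "rkhs_ip \<Omega> F ?f ?k = cnj (?f x)"
      using H.ip_cnj[OF k f] rkhs_reproducing[OF pd x f] by simp
    hence re: "Re (rkhs_ip \<Omega> F ?f ?k) = Re (?f x)" by simp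
    have "norm (?f x - F 0) \<le> e\<^sup>2 / 2"
    proof -
      have "?f x - F 0 = (LINT y|lborel. \<phi> y * F (x - y)) - (LINT y|lborel. \<phi> y * F 0)"
        using int by (simp add: smear_integral[OF \<phi> sub F x])
      also have "\<dots> = (LINT y|lborel. \<phi> y * F (x - y) - \<phi> y * F 0)"
        by (intro Bochner_Integration.integral_diff[symmetric] integrable_supported_mult[OF \<phi>]
            continuous_on_kernel[OF \<phi> sub F x] continuous_on_const)
      also have "norm \<dots> \<le> (LINT y|lborel. norm (\<phi> y * F (x - y) - \<phi> y * F 0))"
        by (rule integral_norm_bound)
      also have "\<dots> \<le> (LINT y|lborel. (e\<^sup>2 / 2) * norm (\<phi> y))"
      proof (rule integral_mono)
        show "integrable lborel (\<lambda>y. norm (\<phi> y * F (x - y) - \<phi> y * F 0))"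
          by (intro integrable_norm Bochner_Integration.integrable_diff integrable_supported_mult[OF \<phi>]
              continuous_on_kernel[OF \<phi> sub F x] continuous_on_const)
        show "integrable lborel (\<lambda>y. (e\<^sup>2 / 2) * norm (\<phi> y))"
          by (intro integrable_mult_right integrable_norm integrable_supported[OF \<phi>])
        fix y
        show "norm (\<phi> y * F (x - y) - \<phi> y * F 0) \<le> (e\<^sup>2 / 2) * norm (\<phi> y)"
        proof (cases "y \<in> {x - r..x + r}")
          case True
          hence "y \<in> \<Omega>" "\<bar>x - y\<bar> < d" using sub r d by auto
          hence "norm (F (x - y) - F 0) \<le> e\<^sup>2 / 2"
            using dF[OF difference_setI[OF x \<open>y \<in> \<Omega>\<close>]] by (simp add: dist_norm)
          hence "norm (\<phi> y) * norm (F (x - y) - F 0) \<le> norm (\<phi> y) * (e\<^sup>2 / 2)"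
            by (rule mult_left_mono) simp
          thus ?thesis by (simp add: norm_mult[symmetric] algebra_simps)
        qed (simp add: continuous_supported_outside[OF \<phi>])
      qed
      also have "\<dots> = e\<^sup>2 / 2" using L1 by (simp add: L1_norm_def)
      finally show ?thesis .
    qed
    hence "Re (F 0) - Re (?f x) \<le> e\<^sup>2 / 2"
      using complex_Re_le_cmod[of "F 0 - ?f x"] by (simp add: norm_minus_commute)
    hence "(?n (?f - ?k))\<^sup>2 \<le> e\<^sup>2"
      using nf nk by (simp add: H.hnorm_diff_square[OF f k] re)
    thus ?thesis by (rule power2_le_imp_le) (use e in simp)
  qed
  thus ?thesis using that[of "d / 2"] d by simp
qed

text \<open>
  The admissible translations of a support form a convex set, so a path of translations between two
  admissible ones never leaves \<open>\<Omega>\<close>.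
\<close>

lemma convex_translations:
  fixes \<Omega> :: "real set"
  assumes "convex \<Omega>"
  shows "convex {s. {a - s..b - s} \<subseteq> \<Omega>}"
proof (rule convexI)
  fix s t u v :: real
  assume st: "s \<in> {s. {a - s..b - s} \<subseteq> \<Omega>}" "t \<in> {s. {a - s..b - s} \<subseteq> \<Omega>}"
    and uv: "0 \<le> u" "0 \<le> v" "u + v = 1"
  have "y \<in> \<Omega>" if y: "y \<in> {a - (u * s + v * t)..b - (u * s + v * t)}" for y
  proof -
    define x where "x = y + (u * s + v * t)"
    have "x - s \<in> {a - s..b - s}" "x - t \<in> {a - t..b - t}" using y by (auto simp: x_def)
    hence "x - s \<in> \<Omega>" "x - t \<in> \<Omega>" using st by blast+
    hence "u *\<^sub>R (x - s) + v *\<^sub>R (x - t) \<in> \<Omega>" by (rule convexD[OF assms _ _ uv])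
    also have "u *\<^sub>R (x - s) + v *\<^sub>R (x - t) = (u + v) * x - (u * s + v * t)" by (simp add: algebra_simps)
    finally show ?thesis by (simp add: uv x_def)
  qed
  thus "u *\<^sub>R s + v *\<^sub>R t \<in> {s. {a - s..b - s} \<subseteq> \<Omega>}" by auto
qed

context
  fixes \<Omega> :: "real set" and F :: "real \<Rightarrow> complex"
    and sc :: "complex \<Rightarrow> 'k::ab_group_add \<Rightarrow> 'k" and K ip W U
  assumes interval: "is_interval \<Omega>" and opn: "open \<Omega>" and nonempty: "\<Omega> \<noteq> {}"
    and F: "continuous_on (difference_set \<Omega>) F" and pd: "positive_definite_on \<Omega> F"
    and realization: "group_realization \<Omega> F sc K ip W U"
begin

interpretation K: complex_hilbert_space sc K ip
  using realization by (simp add: group_realization_def)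

interpretation H: complex_hilbert_space fun_scale "rkhs \<Omega> F" "rkhs_ip \<Omega> F"
  by (rule rkhs_hilbert_space[OF pd])

lemma realization_isometry: "linear_isometry fun_scale (rkhs \<Omega> F) (rkhs_ip \<Omega> F) sc K ip W"
  and realization_group: "unitary_group sc K ip U"
  using realization by (auto simp: group_realization_def)

lemmas W_carrier = linear_isometry_carrier[OF realization_isometry]
  and W_hnorm = linear_isometry_hnorm[OF realization_isometry]
  and W_scale = linear_isometry_scale[OF realization_isometry]
  and W_diff = linear_isometry_diff[OF H.complex_hilbert_space_axioms realization_isometry]

lemma U_isometry: "linear_isometry sc K ip sc K ip (U t)"
  using realization_group by (simp add: unitary_group_def unitary_op_def)

lemmas U_carrier = linear_isometry_carrier[OF U_isometry]
  and U_hnorm = linear_isometry_hnorm[OF U_isometry]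
  and U_diff = linear_isometry_diff[OF K.complex_hilbert_space_axioms U_isometry]
  and U_ip = linear_isometry_ip[OF K.complex_hilbert_space_axioms K.complex_hilbert_space_axioms U_isometry]

lemma U_0: "k \<in> K \<Longrightarrow> U 0 k = k"
  and U_add: "k \<in> K \<Longrightarrow> U (s + t) k = U s (U t k)"
  using realization_group by (auto simp: unitary_group_def)

lemma generates_smear:
  assumes "smooth \<phi>" "continuous_supported a b \<phi>" "{a..b} \<subseteq> \<Omega>"
  shows "generates_at sc K ip U (W (smear \<Omega> F \<phi>)) (W (smear \<Omega> F (derivative \<phi>)))"
proof -
  have "\<phi> \<in> test_functions \<Omega>" using assms by (rule test_functionI)
  hence "W (smear \<Omega> F \<phi>) \<in> generator_dom sc K ip U"
    "generator sc K ip U (W (smear \<Omega> F \<phi>)) = W (smear \<Omega> F (derivative \<phi>))"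
    using realization by (auto simp: group_realization_def)
  thus ?thesis using K.generates_at_generator[OF realization_group] by metis
qed

text \<open>
  The group translates smeared vectors while the support stays inside \<open>\<Omega>\<close>: both \<open>s \<mapsto> U\<^sub>s W F\<^sub>\<phi>\<close> and
  \<open>s \<mapsto> W F\<^sub>\<psi>\<close>, \<open>\<psi> = \<phi>(\<cdot> + s)\<close>, solve \<open>u' = A u\<close>. As \<open>U\<close> is isometric, the increment of the distance
  \<open>g(s)\<close> between them is at most the error of one step of the flow started at \<open>W F\<^sub>\<psi>\<close>, which is
  \<open>o(h)\<close>; hence \<open>g' = 0\<close> and \<open>g = g(0) = 0\<close>.
\<close>

lemma U_smear:
  assumes sm: "smooth \<phi>" and \<phi>: "continuous_supported a b \<phi>" and "a \<le> b"
    and ab: "{a..b} \<subseteq> \<Omega>" and abt: "{a - t..b - t} \<subseteq> \<Omega>"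
  shows "U t (W (smear \<Omega> F \<phi>)) = W (smear \<Omega> F (translate t \<phi>))"
proof -
  define S where "S = {s. {a - s..b - s} \<subseteq> \<Omega>}"
  have S: "convex S" "0 \<in> S" "t \<in> S"
    using convex_translations[of \<Omega> a b] interval ab abt by (auto simp: S_def is_interval_convex_1)
  define f where "f s = smear \<Omega> F (translate s \<phi>)" for s
  define v where "v = W (smear \<Omega> F \<phi>)"
  define g where "g s = hnorm ip (W (f s) - U s v)" for s
  have f: "f s \<in> rkhs \<Omega> F" if "s \<in> S" for s
    using smear_rkhs[OF continuous_supported_translate[OF \<phi>] _ F pd] that by (simp add: f_def S_def)
  have f0: "f 0 = smear \<Omega> F \<phi>" by (simp add: f_def translate_def)
  have v: "v \<in> K" using W_carrier[OF f[OF S(2)]] by (simp add: v_def f0)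
  have "(g has_field_derivative 0) (at s within S)" if s: "s \<in> S" for s
  proof -
    define l where "l = smear \<Omega> F (derivative (translate s \<phi>))"
    define q where "q h = hnorm ip (sc (of_real (1 / h)) (U h (W (f s)) - W (f s)) - W l)" for h
    note sms = smooth_translate[OF sm, of s]
    note sups = continuous_supported_translate[OF \<phi>, of s]
    have subs: "{a - s..b - s} \<subseteq> \<Omega>" using s by (simp add: S_def)
    have l: "l \<in> rkhs \<Omega> F" unfolding l_def
      by (rule smear_rkhs[OF continuous_supported_derivative[OF sms sups] subs F pd])
    have fs: "W (f s) \<in> K" by (rule W_carrier[OF f[OF s]])
    have q: "(q \<longlongrightarrow> 0) (at 0)"
      using generates_smear[OF sms sups subs] by (simp add: generates_at_def hlim_def q_def[abs_def] f_def l_def)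
    obtain C where C: "\<And>h. \<lbrakk>\<bar>h\<bar> \<le> 1; {min (a - s) (a - s - h)..max (b - s) (b - s - h)} \<subseteq> \<Omega>\<rbrakk> \<Longrightarrow>
        hnorm (rkhs_ip \<Omega> F) (smear \<Omega> F (translate h (translate s \<phi>)) - f s - fun_scale (of_real h) l) \<le> C * h\<^sup>2"
      using smear_taylor[OF pd F sms sups] unfolding f_def l_def by metis
    have step: "\<bar>(g y - g s) / (y - s)\<bar> \<le> C * \<bar>y - s\<bar> + q (y - s)"
      if y: "y \<in> S" "y \<noteq> s" "\<bar>y - s\<bar> \<le> 1" for y
    proof -
      define h where "h = y - s"
      have h: "h \<noteq> 0" "\<bar>h\<bar> \<le> 1" "y = s + h" using y by (auto simp: h_def)
      have fy: "W (f y) \<in> K" by (rule W_carrier[OF f[OF y(1)]])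
      have hl: "sc (of_real h) (W l) \<in> K" by (intro K.carrier_scale W_carrier l)
      have "\<bar>g y - g s\<bar> \<le> hnorm ip (W (f y) - U h (W (f s)))"
      proof -
        have "U y v = U h (U s v)" using U_add[OF v, of h s] h by (simp add: add.commute)
        moreover have "g s = hnorm ip (U h (W (f s)) - U h (U s v))"
          unfolding g_def U_diff[OF fs U_carrier[OF v], symmetric]
          by (rule U_hnorm[OF K.carrier_diff[OF fs U_carrier[OF v]], symmetric])
        ultimately have "\<bar>g y - g s\<bar> \<le> hnorm ip ((W (f y) - U h (U s v)) - (U h (W (f s)) - U h (U s v)))"
          unfolding g_def using K.hnorm_reverse_triangle[of "W (f y) - U h (U s v)" "U h (W (f s)) - U h (U s v)"]
          by (simp add: K.carrier_diff fy fs v U_carrier)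
        thus ?thesis by simp
      qed
      \<comment> \<open>Both flows have the same first-order expansion at \<open>s\<close>.\<close>
      also have "\<dots> \<le> hnorm ip (W (f y) - (W (f s) + sc (of_real h) (W l))) +
          hnorm ip ((W (f s) + sc (of_real h) (W l)) - U h (W (f s)))"
        by (intro K.hnorm_triangle_diff fy K.carrier_add fs hl U_carrier)
      also have "hnorm ip (W (f y) - (W (f s) + sc (of_real h) (W l))) \<le> C * h\<^sup>2"
      proof -
        have ty: "translate h (translate s \<phi>) = translate y \<phi>"
          by (simp add: translate_def h(3) algebra_simps)
        have m: "f y - f s - fun_scale (of_real h) l \<in> rkhs \<Omega> F"
          by (intro H.carrier_diff H.carrier_scale f y(1) s l)
        have "W (f y - f s - fun_scale (of_real h) l) = W (f y) - (W (f s) + sc (of_real h) (W l))"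
          by (simp add: W_diff W_scale H.carrier_diff H.carrier_scale f y(1) s l)
        hence "hnorm ip (W (f y) - (W (f s) + sc (of_real h) (W l))) =
            hnorm (rkhs_ip \<Omega> F) (f y - f s - fun_scale (of_real h) l)"
          using W_hnorm[OF m] by simp
        also have "{min (a - s) (a - s - h)..max (b - s) (b - s - h)} \<subseteq> \<Omega>"
        proof
          fix x assume x: "x \<in> {min (a - s) (a - s - h)..max (b - s) (b - s - h)}"
          have "min (a - s) (a - s - h) \<in> \<Omega>" "max (b - s) (b - s - h) \<in> \<Omega>"
            using s y(1) \<open>a \<le> b\<close> unfolding S_def h(3) by (auto simp: min_def max_def algebra_simps)
          thus "x \<in> \<Omega>" using mem_is_interval_1_I[OF interval] x by (meson atLeastAtMost_iff)
        qed
        from C[OF h(2) this] have "hnorm (rkhs_ip \<Omega> F) (f y - f s - fun_scale (of_real h) l) \<le> C * h\<^sup>2"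
          unfolding ty by (simp only: f_def)
        finally show ?thesis .
      qed
      also have "hnorm ip ((W (f s) + sc (of_real h) (W l)) - U h (W (f s))) = \<bar>h\<bar> * q h"
      proof -
        let ?w = "sc (of_real (1 / h)) (U h (W (f s)) - W (f s)) - W l"
        have w: "?w \<in> K" by (intro K.carrier_diff K.carrier_scale U_carrier fs W_carrier l)
        have "sc (of_real h) ?w = U h (W (f s)) - (W (f s) + sc (of_real h) (W l))"
          using h(1) by (simp add: K.scale_right_diff_distrib)
        hence "hnorm ip (U h (W (f s)) - (W (f s) + sc (of_real h) (W l))) = \<bar>h\<bar> * q h"
          using K.hnorm_scale[OF w, of "of_real h"] unfolding q_def by simp
        thus ?thesis
          using K.hnorm_minus[of "U h (W (f s))" "W (f s) + sc (of_real h) (W l)"] fs hl U_carrier K.carrier_add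
          by metis
      qed
      finally have "\<bar>g y - g s\<bar> \<le> \<bar>h\<bar> * (C * \<bar>h\<bar> + q h)" by (simp add: power2_eq_square algebra_simps)
      thus ?thesis using h(1) by (simp add: h_def[symmetric] field_simps)
    qed
    have "((\<lambda>y. (g y - g s) / (y - s)) \<longlongrightarrow> 0) (at s within S)"
    proof (rule Lim_null_comparison)
      have "filterlim (\<lambda>y. y - s) (at 0) (at s within S)"
        by (rule filterlim_atI) (auto intro!: tendsto_eq_intros simp: eventually_at_filter)
      hence "((\<lambda>y. q (y - s)) \<longlongrightarrow> 0) (at s within S)" by (rule filterlim_compose[OF q])
      thus "((\<lambda>y. C * \<bar>y - s\<bar> + q (y - s)) \<longlongrightarrow> 0) (at s within S)"
        by (auto intro!: tendsto_eq_intros)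
      show "\<forall>\<^sub>F y in at s within S. norm ((g y - g s) / (y - s)) \<le> C * \<bar>y - s\<bar> + q (y - s)"
        unfolding eventually_at
      proof (intro exI[of _ "1::real"] conjI ballI impI)
        fix y assume "y \<in> S" "y \<noteq> s \<and> dist y s < 1"
        thus "norm ((g y - g s) / (y - s)) \<le> C * \<bar>y - s\<bar> + q (y - s)"
          unfolding real_norm_def by (intro step) (auto simp: dist_real_def)
      qed simp
    qed
    thus ?thesis by (simp add: has_field_derivative_iff)
  qed
  then obtain c where c: "\<And>s. s \<in> S \<Longrightarrow> g s = c"
    using has_field_derivative_zero_constant[OF S(1)] by blast
  have "g 0 = 0" by (simp add: g_def f0 v_def[symmetric] U_0[OF v] K.hnorm_zero)
  hence "g t = 0" using c S by metis
  hence "W (f t) - U t v = 0"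
    using K.hnorm_eq_0_iff[OF K.carrier_diff[OF W_carrier[OF f[OF S(3)]] U_carrier[OF v]]] by (simp add: g_def)
  thus ?thesis by (simp add: f_def v_def)
qed

text \<open>
  Bumps shrinking to \<open>x\<close> approximate \<open>k\<^sub>x\<close>, their translates approximate \<open>k\<^bsub>x - t\<^esub>\<close>, and \<open>U_smear\<close> carries one
  family to the other. The radius of approximation does not depend on the point, so one bump serves
  both.
\<close>

lemma U_kernel:
  assumes x: "x \<in> \<Omega>" and xt: "x - t \<in> \<Omega>"
  shows "U t (W (kernel_vector \<Omega> F x)) = W (kernel_vector \<Omega> F (x - t))"
proof -
  let ?k = "kernel_vector \<Omega> F" and ?n = "hnorm (rkhs_ip \<Omega> F)"
  note k = kernel_vector_rkhs[OF pd x] kernel_vector_rkhs[OF pd xt]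
  have UK: "U t (W (?k x)) \<in> K" "W (?k (x - t)) \<in> K" by (intro U_carrier W_carrier k)+
  have "hnorm ip (U t (W (?k x)) - W (?k (x - t))) \<le> 0 + e" if e: "e > 0" for e
  proof -
    obtain d where d: "d > 0" and approx: "\<And>x r \<phi>. \<lbrakk>0 < r; r \<le> d; {x - r..x + r} \<subseteq> \<Omega>;
        continuous_supported (x - r) (x + r) \<phi>; L1_norm \<phi> = 1; (LINT y|lborel. \<phi> y) = 1\<rbrakk>
        \<Longrightarrow> ?n (smear \<Omega> F \<phi> - ?k x) \<le> e / 2"
      using smear_approximates_kernel[OF pd F nonempty, of "e / 2"] e by auto
    obtain r1 r2 where r12: "r1 > 0" "cball x r1 \<subseteq> \<Omega>" "r2 > 0" "cball (x - t) r2 \<subseteq> \<Omega>"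
      using opn x xt unfolding open_contains_cball by meson
    define r where "r = min d (min r1 r2)"
    have r: "r > 0" "r \<le> d" using d r12 by (auto simp: r_def)
    have sub: "{x - r..x + r} \<subseteq> \<Omega>"
      using r12(2) by (auto simp: r_def cball_def dist_real_def subset_iff)
    have subt: "{x - r - t..x + r - t} \<subseteq> \<Omega>"
      using r12(4) by (auto simp: r_def cball_def dist_real_def subset_iff)
    obtain \<phi> where \<phi>: "smooth \<phi>" "continuous_supported (x - r) (x + r) \<phi>" "L1_norm \<phi> = 1" "(LINT y|lborel. \<phi> y) = 1"
      using bump_exists[of "x - r" "x + r"] r by auto
    let ?f = "smear \<Omega> F \<phi>" and ?ft = "smear \<Omega> F (translate t \<phi>)"
    have f: "?f \<in> rkhs \<Omega> F" by (rule smear_rkhs[OF \<phi>(2) sub F pd])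
    have supt: "continuous_supported (x - r - t) (x + r - t) (translate t \<phi>)"
      by (rule continuous_supported_translate[OF \<phi>(2)])
    have ft: "?ft \<in> rkhs \<Omega> F" by (rule smear_rkhs[OF supt subt F pd])
    have "?n (?f - ?k x) \<le> e / 2" by (intro approx[of r] r sub \<phi>)
    moreover have "?n (?ft - ?k (x - t)) \<le> e / 2"
    proof (rule approx[OF r])
      have eq: "x - t - r = x - r - t" "x - t + r = x + r - t" by auto
      show "{x - t - r..x - t + r} \<subseteq> \<Omega>" unfolding eq by (rule subt)
      show "continuous_supported (x - t - r) (x - t + r) (translate t \<phi>)" unfolding eq by (rule supt)
      show "L1_norm (translate t \<phi>) = 1" unfolding L1_norm_translate by (rule \<phi>(3))
      show "(LINT y|lborel. translate t \<phi> y) = 1"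
        using lborel_integral_real_affine[of 1 \<phi> t] \<phi>(4) by (simp add: translate_def add.commute)
    qed
    moreover have "U t (W ?f) = W ?ft"
      by (rule U_smear[OF \<phi>(1,2) _ sub subt]) (use r in simp)
    moreover have "hnorm ip (U t (W (?k x)) - U t (W ?f)) = ?n (?f - ?k x)"
    proof -
      have "hnorm ip (U t (W (?k x)) - U t (W ?f)) = hnorm ip (U t (W (?k x - ?f)))"
        by (simp only: W_diff[OF k(1) f] U_diff[OF W_carrier[OF k(1)] W_carrier[OF f]])
      also have "\<dots> = ?n (?k x - ?f)"
        using U_hnorm[OF W_carrier[OF H.carrier_diff[OF k(1) f]]] W_hnorm[OF H.carrier_diff[OF k(1) f]] by simp
      also have "\<dots> = ?n (?f - ?k x)" by (rule H.hnorm_minus[OF k(1) f])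
      finally show ?thesis .
    qed
    moreover have "hnorm ip (W ?ft - W (?k (x - t))) = ?n (?ft - ?k (x - t))"
      using W_hnorm[OF H.carrier_diff[OF ft k(2)]] by (simp add: W_diff[OF ft k(2)])
    moreover have "hnorm ip (U t (W (?k x)) - W (?k (x - t))) \<le>
        hnorm ip (U t (W (?k x)) - W ?ft) + hnorm ip (W ?ft - W (?k (x - t)))"
      by (intro K.hnorm_triangle_diff UK W_carrier ft)
    ultimately show ?thesis by simp
  qed
  hence "hnorm ip (U t (W (?k x)) - W (?k (x - t))) \<le> 0" by (rule field_le_epsilon)
  thus ?thesis
    using K.hnorm_nonneg[OF K.carrier_diff[OF UK]] K.hnorm_eq_0_iff[OF K.carrier_diff[OF UK]] by simp
qed

text \<open>The matrix coefficient \<open>t \<mapsto> \<langle>w, U\<^sub>t w\<rangle>\<close> of a single kernel vector \<open>w\<close> is the extension.\<close>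

theorem realization_extendable: "extendable \<Omega> F"
proof -
  obtain x0 where x0: "x0 \<in> \<Omega>" using nonempty by blast
  let ?k = "kernel_vector \<Omega> F"
  define w where "w = W (?k x0)"
  define G where "G t = ip w (U t w)" for t
  have w: "w \<in> K" unfolding w_def by (intro W_carrier kernel_vector_rkhs[OF pd x0])
  have G_diff: "ip (U s w) (U t w) = G (t - s)" for s t
  proof -
    have "ip (U s w) (U t w) = ip (U (- s) (U s w)) (U (- s) (U t w))"
      by (rule U_ip[OF U_carrier[OF w] U_carrier[OF w], symmetric])
    thus ?thesis using U_add[OF w, of "- s" s] U_add[OF w, of "- s" t] U_0[OF w] by (simp add: G_def)
  qed
  have "continuous_on UNIV G" unfolding continuous_on_def
  proof
    fix s :: real
    have "hlim K ip (\<lambda>t. U t w) (U s w) (at s)" using realization_group w by (auto simp: unitary_group_def)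
    from K.hlim_ip[OF this U_carrier[OF w] w] show "(G \<longlongrightarrow> G s) (at s within UNIV)" by (simp add: G_def[abs_def])
  qed
  moreover have "positive_definite_on UNIV G" unfolding positive_definite_on_def
  proof (intro allI impI)
    fix n :: nat and c :: "nat \<Rightarrow> complex" and x :: "nat \<Rightarrow> real"
    let ?u = "\<lambda>i. sc (c i) (U (- x i) w)"
    have u: "?u i \<in> K" for i by (intro K.carrier_scale U_carrier w)
    have "(\<Sum>i<n. \<Sum>j<n. cnj (c i) * c j * G (x i - x j)) = (\<Sum>i<n. \<Sum>j<n. ip (?u i) (?u j))"
      by (intro sum.cong refl)
         (simp add: K.ip_scale K.ip_scale_left U_carrier w K.carrier_scale G_diff)
    also have "\<dots> = ip (\<Sum>i<n. ?u i) (\<Sum>j<n. ?u j)"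
      by (simp add: K.ip_sum K.ip_sum_left K.carrier_sum u) (rule sum.swap)
    also have "\<dots> \<in> \<real>\<^sub>\<ge>\<^sub>0" by (intro K.ip_nonneg K.carrier_sum u)
    finally show "(\<Sum>i<n. \<Sum>j<n. cnj (c i) * c j * G (x i - x j)) \<in> \<real>\<^sub>\<ge>\<^sub>0" .
  qed
  moreover have "G t = F t" if tD: "t \<in> difference_set \<Omega>" for t
  proof -
    obtain x y where t: "t = x - y" "x \<in> \<Omega>" "y \<in> \<Omega>" using tD by (auto simp: difference_set_def)
    have "W (?k z) = U (x0 - z) w" if "z \<in> \<Omega>" for z
    proof -
      have eq: "x0 - (x0 - z) = z" by simp
      show ?thesis using U_kernel[OF x0, of "x0 - z"] that unfolding eq w_def by simp
    qed
    hence "G t = ip (W (?k x)) (W (?k y))" using G_diff t by simp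
    also have "\<dots> = rkhs_ip \<Omega> F (?k x) (?k y)"
      by (rule linear_isometry_ip[OF H.complex_hilbert_space_axioms K.complex_hilbert_space_axioms
            realization_isometry kernel_vector_rkhs[OF pd t(2)] kernel_vector_rkhs[OF pd t(3)]])
    also have "\<dots> = F t" using rkhs_ip_kernel[OF pd t(2,3)] t(1) by simp
    finally show ?thesis .
  qed
  ultimately show ?thesis unfolding extendable_def by blast
qed

end

theorem theorem2p1p1:
  fixes \<Omega> :: "real set" and F :: "real \<Rightarrow> complex"
  assumes "is_interval \<Omega>" and "open \<Omega>" and "bounded \<Omega>" and "\<Omega> \<noteq> {}"
    and "continuous_on (difference_set \<Omega>) F"
    and "positive_definite_on \<Omega> F"
  shows
    "(extendable \<Omega> F \<longleftrightarrow>
       (\<exists>(sc :: complex \<Rightarrow> (real \<Rightarrow> complex) \<Rightarrow> (real \<Rightarrow> complex)) K ip W U.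
          group_realization \<Omega> F sc K ip W U)) \<and>
     ((\<exists>(sc :: complex \<Rightarrow> 'k::ab_group_add \<Rightarrow> 'k) K ip W U.
          group_realization \<Omega> F sc K ip W U) \<longrightarrow> extendable \<Omega> F)"
proof (intro conjI iffI impI)
  assume "extendable \<Omega> F"
  then obtain G where "continuous_on UNIV G" "positive_definite_on UNIV G"
    "\<And>x. x \<in> difference_set \<Omega> \<Longrightarrow> G x = F x"
    unfolding extendable_def by blast
  thus "\<exists>(sc :: complex \<Rightarrow> (real \<Rightarrow> complex) \<Rightarrow> (real \<Rightarrow> complex)) K ip W U. group_realization \<Omega> F sc K ip W U"
    using extension_group_realization[OF assms(1,4,5,6)] by blast
qed (use realization_extendable[OF assms(1,2,4,5,6)] in blast)+

end
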